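(* Let $R$ be a Noetherian ring and let $M\in D_b^f(R)$ be a complex. If $B_M^R<\infty$, $P_R(M,R)<\infty$, and $P_R(M,M)<\infty$, then $\operatorname{pd}_R M<\infty$ and $$\operatorname{pd}_R M=-\inf H(\mathbb{R}\operatorname{Hom}_R(M,R)).$$
   Context: Rings are commutative with identity. Complexes of $R$-modules are indexed homologically. For a complex $M$, $\inf H(M)=\inf\{i\mid H_i(M)\neq 0\}$ (conventions $\sup\emptyset=-\infty$, $\inf\emptyset=\infty$). $D(R)$ is the derived category, and $D_b^f(R)$ is its full subcategory of complexes that are isomorphic in $D(R)$ to a bounded complex and have every $H_i$ finitely generated. $\operatorname{Ext}_R^n(M,N)=H_{-n}(\mathbb{R}\operatorname{Hom}_R(M,N))$. For complexes $M,N$ with $\inf H(N)$ an integer, $$P_R(M,N)=\sup\{n\in\mathbb{Z}\mid \operatorname{Ext}_R^{\,n-\inf H(N)}(M,N)\neq 0\}=\inf H(N)-\inf H(\mathbb{R}\operatorname{Hom}_R(M,N)).$$ For $M\in D_b^f(R)$, the Auslander bound is $B_M^R=\sup\{P_R(M,N)\mid N\in D_b^f(R)\text{ and }P_R(M,N)<\infty\}$. A complex $P$ is semiprojective if each $P_i$ is projective and $\operatorname{Hom}_R(P,-)$ preserves quasiisomorphisms; a semiprojective resolution of $M$ is a quasiisomorphism $P\to M$ with $P$ semiprojective. The projective dimension $\operatorname{pd}_R M$ is the infimum of the $p\in\mathbb{Z}$ for which there is a semiprojective resolution $P\to M$ with $P_i=0$ for all $i>p$. *)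

theory Defs
  imports "HOL-Algebra.Module" "HOL-Algebra.Ring_Divisibility" "HOL-Library.Extended_Real"
begin

text \<open>
  HOL cannot quantify over types inside a formula, so ``for all modules'' and ``there is a
  complex'' have to range over modules whose carriers live in one fixed type.  That type is
  always \<open>('a, 'm) univ\<close>, where \<open>'a\<close> is the type of the ring and \<open>'m\<close> the type of the given
  module or complex.  It is infinite and at least as large as the ring and the given object, so
  it contains an isomorphic copy of every object that matters: free modules on carriers in
  \<open>'m\<close>, countable direct sums and subquotients of these, semiprojective resolutions of the given
  complex, and representatives of all isomorphism classes of finitely generated modules.
\<close>

type_synonym ('a, 'm) univ = "('a + 'm) list"


subsection \<open>Modules\<close>

definition module_hom ::
  "('a, 'r) ring_scheme \<Rightarrow> ('a, 'm) module \<Rightarrow> ('a, 'n) module \<Rightarrow> ('m \<Rightarrow> 'n) set" where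
  "module_hom R M N = {f \<in> carrier M \<rightarrow> carrier N.
     (\<forall>x \<in> carrier M. \<forall>y \<in> carrier M. f (x \<oplus>\<^bsub>M\<^esub> y) = f x \<oplus>\<^bsub>N\<^esub> f y) \<and>
     (\<forall>r \<in> carrier R. \<forall>x \<in> carrier M. f (r \<odot>\<^bsub>M\<^esub> x) = r \<odot>\<^bsub>N\<^esub> f x)}"

definition zero_module :: "('a, 'm) module \<Rightarrow> bool" where
  "zero_module M \<longleftrightarrow> carrier M = {\<zero>\<^bsub>M\<^esub>}"

definition fin_gen_module :: "('a, 'r) ring_scheme \<Rightarrow> ('a, 'm) module \<Rightarrow> bool" where
  "fin_gen_module R M \<longleftrightarrow> (\<exists>A \<subseteq> carrier M. finite A \<and>
     (\<forall>H. submodule H R M \<and> A \<subseteq> H \<longrightarrow> H = carrier M))"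

text \<open>
  Projectivity is the lifting property against surjections.  Every lifting problem for \<open>P\<close>
  restricts to one between submodules generated by at most \<open>|P|\<close> elements, and these fit into
  \<open>('a, 'p) univ\<close>.
\<close>

definition projective_module :: "('a, 'r) ring_scheme \<Rightarrow> ('a, 'p) module \<Rightarrow> bool" where
  "projective_module R P \<longleftrightarrow> module R P \<and>
     (\<forall>(X :: ('a, ('a, 'p) univ) module) (Y :: ('a, ('a, 'p) univ) module) g f.
        module R X \<and> module R Y \<and> g \<in> module_hom R X Y \<and> g ` carrier X = carrier Y \<and>
        f \<in> module_hom R P Y \<longrightarrow>
        (\<exists>h \<in> module_hom R P X. \<forall>p \<in> carrier P. g (h p) = f p))"

text \<open>The fields \<open>mult\<close> and \<open>one\<close> of the record type of modules carry no meaning.\<close>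

definition quotient_module :: "('a, 'm) module \<Rightarrow> 'm set \<Rightarrow> ('a, 'm set) module" where
  "quotient_module M B =
     \<lparr>carrier = {B +>\<^bsub>M\<^esub> x | x. x \<in> carrier M}, mult = undefined, one = undefined,
      zero = B, add = (\<lambda>X Y. X <+>\<^bsub>M\<^esub> Y),
      smult = (\<lambda>r X. \<Union>x\<in>X. B +>\<^bsub>M\<^esub> (r \<odot>\<^bsub>M\<^esub> x))\<rparr>"


subsection \<open>Complexes, indexed homologically\<close>

record ('a, 'm) cpx =
  obj :: "int \<Rightarrow> ('a, 'm) module"
  diff :: "int \<Rightarrow> 'm \<Rightarrow> 'm"

definition is_complex :: "('a, 'r) ring_scheme \<Rightarrow> ('a, 'm) cpx \<Rightarrow> bool" where
  "is_complex R C \<longleftrightarrow> (\<forall>i. module R (obj C i) \<and>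
     diff C i \<in> module_hom R (obj C i) (obj C (i - 1)) \<and>
     (\<forall>x \<in> carrier (obj C i). diff C (i - 1) (diff C i x) = \<zero>\<^bsub>obj C (i - 2)\<^esub>))"

definition cycles :: "('a, 'm) cpx \<Rightarrow> int \<Rightarrow> 'm set" where
  "cycles C i = {x \<in> carrier (obj C i). diff C i x = \<zero>\<^bsub>obj C (i - 1)\<^esub>}"

definition boundaries :: "('a, 'm) cpx \<Rightarrow> int \<Rightarrow> 'm set" where
  "boundaries C i = diff C (i + 1) ` carrier (obj C (i + 1))"

definition homology :: "('a, 'm) cpx \<Rightarrow> int \<Rightarrow> ('a, 'm set) module" where
  "homology C i = quotient_module ((obj C i)\<lparr>carrier := cycles C i\<rparr>) (boundaries C i)"

definition homology_inf :: "('a, 'm) cpx \<Rightarrow> ereal" where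
  "homology_inf C = Inf {ereal (of_int i) | i. \<not> zero_module (homology C i)}"

definition chain_map ::
  "('a, 'r) ring_scheme \<Rightarrow> ('a, 'm) cpx \<Rightarrow> ('a, 'n) cpx \<Rightarrow> (int \<Rightarrow> 'm \<Rightarrow> 'n) \<Rightarrow> bool" where
  "chain_map R C D \<alpha> \<longleftrightarrow> (\<forall>i. \<alpha> i \<in> module_hom R (obj C i) (obj D i) \<and>
     (\<forall>x \<in> carrier (obj C i). diff D i (\<alpha> i x) = \<alpha> (i - 1) (diff C i x)))"

text \<open>\<open>H\<^sub>i(\<alpha>)\<close> sends the coset of \<open>z\<close> to the coset of \<open>\<alpha> z\<close>.\<close>

definition homology_map ::
  "('a, 'n) cpx \<Rightarrow> (int \<Rightarrow> 'm \<Rightarrow> 'n) \<Rightarrow> int \<Rightarrow> 'm set \<Rightarrow> 'n set" where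
  "homology_map D \<alpha> i X = boundaries D i <+>\<^bsub>obj D i\<^esub> (\<alpha> i ` X)"

definition quasi_iso ::
  "('a, 'r) ring_scheme \<Rightarrow> ('a, 'm) cpx \<Rightarrow> ('a, 'n) cpx \<Rightarrow> (int \<Rightarrow> 'm \<Rightarrow> 'n) \<Rightarrow> bool" where
  "quasi_iso R C D \<alpha> \<longleftrightarrow> chain_map R C D \<alpha> \<and>
     (\<forall>i. bij_betw (homology_map D \<alpha> i) (carrier (homology C i)) (carrier (homology D i)))"

definition bounded_complex :: "('a, 'm) cpx \<Rightarrow> bool" where
  "bounded_complex C \<longleftrightarrow> (\<exists>a b. \<forall>i. i < a \<or> b < i \<longrightarrow> zero_module (obj C i))"

text \<open>The ring, regarded as a complex concentrated in degree 0.\<close>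

definition ring_complex :: "('a, 'r) ring_scheme \<Rightarrow> ('a, 'a) cpx" where
  "ring_complex R =
     \<lparr>obj = (\<lambda>i. \<lparr>carrier = (if i = 0 then carrier R else {\<zero>\<^bsub>R\<^esub>}),
                  mult = mult R, one = one R, zero = zero R, add = add R, smult = mult R\<rparr>),
      diff = (\<lambda>i x. \<zero>\<^bsub>R\<^esub>)\<rparr>"


subsection \<open>The derived category\<close>

text \<open>
  An isomorphism \<open>M \<cong> N\<close> in \<open>D(R)\<close> is a roof \<open>M \<leftarrow> X \<rightarrow> N\<close> of quasiisomorphisms; \<open>X\<close> may be taken
  to be a semiprojective resolution of \<open>M\<close> and hence to live in the type below.
\<close>

definition derived_iso :: "('a, 'r) ring_scheme \<Rightarrow> ('a, 'm) cpx \<Rightarrow> ('a, 'n) cpx \<Rightarrow> bool" where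
  "derived_iso R M N \<longleftrightarrow> (\<exists>(X :: ('a, ('a, 'm + 'n) univ) cpx) \<alpha> \<beta>.
     is_complex R X \<and> quasi_iso R X M \<alpha> \<and> quasi_iso R X N \<beta>)"

text \<open>
  The category \<open>D\<^sub>b\<^sup>f(R)\<close>.  If \<open>M\<close> is isomorphic to some bounded complex then it is isomorphic to
  a bounded truncation of \<open>M\<close> itself, so the bounded complex can be found in \<open>('a, 'm) univ\<close>.
\<close>

definition in_Dbf :: "('a, 'r) ring_scheme \<Rightarrow> ('a, 'm) cpx \<Rightarrow> bool" where
  "in_Dbf R M \<longleftrightarrow> is_complex R M \<and>
     (\<exists>N :: ('a, ('a, 'm) univ) cpx. is_complex R N \<and> bounded_complex N \<and> derived_iso R M N) \<and>
     (\<forall>i. fin_gen_module R (homology M i))"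

text \<open>
  The complex \<open>Hom\<^sub>R(P, N)\<close>: its elements of degree \<open>n\<close> are the families of homomorphisms
  \<open>f\<^sub>i : P\<^sub>i \<rightarrow> N\<^sub>i\<^sub>+\<^sub>n\<close>, and its differential is \<open>(\<partial> f)\<^sub>i = d\<^sup>N f\<^sub>i - (-1)\<^sup>n f\<^sub>i\<^sub>-\<^sub>1 d\<^sup>P\<close>.  A homomorphism
  is represented by the function that is \<open>undefined\<close> outside the carrier of \<open>P\<^sub>i\<close>.
\<close>

definition hom_complex ::
  "('a, 'r) ring_scheme \<Rightarrow> ('a, 'p) cpx \<Rightarrow> ('a, 'n) cpx \<Rightarrow> ('a, int \<Rightarrow> 'p \<Rightarrow> 'n) cpx" where
  "hom_complex R P N =
     \<lparr>obj = (\<lambda>n. \<lparr>carrier = {f. \<forall>i. f i \<in> extensional (carrier (obj P i)) \<and>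
                                      f i \<in> module_hom R (obj P i) (obj N (i + n))},
                  mult = undefined, one = undefined,
                  zero = (\<lambda>i. \<lambda>p\<in>carrier (obj P i). \<zero>\<^bsub>obj N (i + n)\<^esub>),
                  add = (\<lambda>f g i. \<lambda>p\<in>carrier (obj P i). f i p \<oplus>\<^bsub>obj N (i + n)\<^esub> g i p),
                  smult = (\<lambda>r f i. \<lambda>p\<in>carrier (obj P i). r \<odot>\<^bsub>obj N (i + n)\<^esub> f i p)\<rparr>),
      diff = (\<lambda>n f i. \<lambda>p\<in>carrier (obj P i).
                if even n
                then diff N (i + n) (f i p) \<ominus>\<^bsub>obj N (i + n - 1)\<^esub> f (i - 1) (diff P i p)
                else diff N (i + n) (f i p) \<oplus>\<^bsub>obj N (i + n - 1)\<^esub> f (i - 1) (diff P i p))\<rparr>"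

definition hom_complex_map ::
  "('a, 'p) cpx \<Rightarrow> (int \<Rightarrow> 'm \<Rightarrow> 'n) \<Rightarrow> int \<Rightarrow> (int \<Rightarrow> 'p \<Rightarrow> 'm) \<Rightarrow> (int \<Rightarrow> 'p \<Rightarrow> 'n)" where
  "hom_complex_map P \<alpha> n f = (\<lambda>i. \<lambda>p\<in>carrier (obj P i). \<alpha> (i + n) (f i p))"

text \<open>
  It suffices to test against quasiisomorphisms in \<open>('a, 'p) univ\<close>: passing to mapping cones, the
  condition says that every morphism from \<open>P\<close> to a shifted acyclic complex is null homotopic, and
  the image of such a morphism lies in an acyclic subcomplex of cardinality at most that of
  \<open>('a, 'p) univ\<close>.
\<close>

definition semiprojective :: "('a, 'r) ring_scheme \<Rightarrow> ('a, 'p) cpx \<Rightarrow> bool" where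
  "semiprojective R P \<longleftrightarrow> is_complex R P \<and> (\<forall>i. projective_module R (obj P i)) \<and>
     (\<forall>(X :: ('a, ('a, 'p) univ) cpx) (Y :: ('a, ('a, 'p) univ) cpx) \<alpha>.
        is_complex R X \<and> is_complex R Y \<and> quasi_iso R X Y \<alpha> \<longrightarrow>
        quasi_iso R (hom_complex R P X) (hom_complex R P Y) (hom_complex_map P \<alpha>))"

definition semiprojective_resolution ::
  "('a, 'r) ring_scheme \<Rightarrow> ('a, 'm) cpx \<Rightarrow> ('a, 'p) cpx \<Rightarrow> (int \<Rightarrow> 'p \<Rightarrow> 'm) \<Rightarrow> bool" where
  "semiprojective_resolution R M P \<pi> \<longleftrightarrow> semiprojective R P \<and> quasi_iso R P M \<pi>"

text \<open>
  \<open>RHom\<close> is computed from some semiprojective resolution; one exists in \<open>('a, 'm) univ\<close>, and up to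
  isomorphism in \<open>D(R)\<close> the choice is immaterial.
\<close>

definition RHom :: "('a, 'r) ring_scheme \<Rightarrow> ('a, 'm) cpx \<Rightarrow> ('a, 'n) cpx \<Rightarrow>
    ('a, int \<Rightarrow> ('a, 'm) univ \<Rightarrow> 'n) cpx" where
  "RHom R M N =
     hom_complex R (SOME P :: ('a, ('a, 'm) univ) cpx. \<exists>\<pi>. semiprojective_resolution R M P \<pi>) N"

definition Ext :: "('a, 'r) ring_scheme \<Rightarrow> int \<Rightarrow> ('a, 'm) cpx \<Rightarrow> ('a, 'n) cpx \<Rightarrow>
    ('a, (int \<Rightarrow> ('a, 'm) univ \<Rightarrow> 'n) set) module" where
  "Ext R n M N = homology (RHom R M N) (- n)"


subsection \<open>Invariants\<close>

text \<open>
  \<open>P\<^sub>R(M, N)\<close>, which is only meaningful if \<open>inf H(N)\<close> is an integer \<open>h\<close>.  If \<open>H(N) = 0\<close> the value is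
  \<open>-\<infinity>\<close>, in accordance with \<open>Ext(M, N) = 0\<close>; such \<open>N\<close> do not affect the Auslander bound.
\<close>

definition P_bound :: "('a, 'r) ring_scheme \<Rightarrow> ('a, 'm) cpx \<Rightarrow> ('a, 'n) cpx \<Rightarrow> ereal" where
  "P_bound R M N = Sup {ereal (of_int n) | n.
     \<exists>h :: int. homology_inf N = ereal (of_int h) \<and> \<not> zero_module (Ext R (n - h) M N)}"

text \<open>
  Every complex in \<open>D\<^sub>b\<^sup>f(R)\<close> over a Noetherian ring is isomorphic in \<open>D(R)\<close> to a complex of finitely
  generated modules, so \<open>N\<close> below ranges over representatives of all isomorphism classes.
\<close>

definition auslander_bound :: "('a, 'r) ring_scheme \<Rightarrow> ('a, 'm) cpx \<Rightarrow> ereal" where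
  "auslander_bound R M = Sup {P_bound R M N | N :: ('a, ('a, 'm) univ) cpx.
     in_Dbf R N \<and> P_bound R M N < \<infinity>}"

text \<open>
  Resolutions in \<open>('a, 'm) univ\<close> suffice: if \<open>M\<close> has a semiprojective resolution that vanishes
  above \<open>p\<close>, then truncating any other semiprojective resolution at \<open>p\<close> gives one as well.
\<close>

definition proj_dim :: "('a, 'r) ring_scheme \<Rightarrow> ('a, 'm) cpx \<Rightarrow> ereal" where
  "proj_dim R M = Inf {ereal (of_int p) | p.
     \<exists>(P :: ('a, ('a, 'm) univ) cpx) \<pi>. semiprojective_resolution R M P \<pi> \<and>
       (\<forall>i > p. zero_module (obj P i))}"

end

theory Submission
  imports Defs
begin

text \<open>
  Since \<open>M\<close> has bounded, finitely generated homology and \<open>R\<close> is Noetherian, there is a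
  quasiisomorphism \<open>F \<rightarrow> M\<close> from a bounded below complex of finitely generated free modules
  (\<open>free_resolution_exists\<close>).  For \<open>m\<close> above all nonzero homology let \<open>Z\<^sub>m\<close> be the module of
  cycles of \<open>F\<close> in degree \<open>m\<close>.  Cutting \<open>F\<close> at \<open>m\<close> presents \<open>M\<close>, in the derived category, as an
  extension of a shift of \<open>Z\<^sub>m\<close> by the finite complex \<open>F\<^sub>\<le>\<^sub>m\<close>.  The groups \<open>Ext(M, F\<^sub>\<le>\<^sub>m)\<close> vanish in
  large degrees because \<open>Ext(M, R)\<close> does, and so does \<open>Ext(M, M)\<close>; therefore \<open>Ext(M, Z\<^sub>m)\<close> vanishes
  in large degrees as well (\<open>syzygy_cocycle_extends\<close>).  The Auslander bound improves this to
  vanishing in all degrees beyond a number \<open>\<beta>\<close> that is independent of \<open>m\<close>.  Take \<open>m \<ge> \<beta>\<close>.  The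
  differential \<open>F\<^sub>m\<^sub>+\<^sub>1 \<rightarrow> Z\<^sub>m\<close> is a cocycle of degree \<open>m + 1\<close>, hence a coboundary \<open>g d\<close>, and
  \<open>g : F\<^sub>m \<rightarrow> Z\<^sub>m\<close> is then a retraction onto the boundaries \<open>Z\<^sub>m\<close>.  So \<open>F\<close> can be cut off at a
  complement of \<open>Z\<^sub>m\<close> in \<open>F\<^sub>m\<close> (\<open>truncate_resolution\<close>), which shows that the projective dimension is
  not \<open>\<infinity>\<close>.

  For the formula, consider a resolution \<open>F\<close> by finitely generated projective modules that
  vanishes above \<open>p\<close>.  If \<open>Ext\<^sup>p(M, R) = 0\<close>, then \<open>Ext\<^sup>p(M, F\<^sub>p) = 0\<close>, so the identity of \<open>F\<^sub>p\<close>, which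
  is a cocycle, is a coboundary \<open>g d\<close>; the last differential splits, and the resolution can be
  shortened (\<open>shorten_resolution\<close>).  Hence the resolution can be shortened down to the largest
  \<open>n\<close> with \<open>Ext\<^sup>n(M, R) \<noteq> 0\<close>, or indefinitely if there is no such \<open>n\<close>.  Conversely no semiprojective
  resolution vanishes in such a degree \<open>n\<close>, because it computes \<open>Ext\<^sup>n(M, R)\<close>.

  \<open>Ext\<close> is defined by an unspecified semiprojective resolution.  The vanishing of a homology
  module of \<open>Hom(P, N)\<close> says that all chain maps from \<open>P\<close> to a shift of \<open>N\<close> are null homotopic
  (\<open>homology_hom_zero_iff\<close>), and in this form it passes from one resolution of \<open>M\<close> to another as soon
  as maps into \<open>M\<close> lift, uniquely up to homotopy, along both resolutions (\<open>homs_null_transfer\<close>).  A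
  bounded below complex of finitely generated projective modules lifts along every
  quasiisomorphism, since its maps into the acyclic mapping cone are null homotopic
  (\<open>lifts_bounded_below\<close>); a semiprojective complex does so by definition (\<open>semiprojective_lifts\<close>).
\<close>

section \<open>Abelian groups and module homomorphisms\<close>

text \<open>
  Sorting a sum with associativity and commutativity can leave \<open>x\<close> and \<open>\<ominus> x\<close> a few places apart.
  The rules \<open>ag_cancel\<close> remove such pairs; together with the sorting rules they normalize the
  expressions in abelian groups that occur below.
\<close>

lemma (in abelian_group) ag_cancel1:
  "x \<in> carrier G \<Longrightarrow> y \<in> carrier G \<Longrightarrow>
    x \<oplus> (y \<oplus> \<ominus> x) = y"
  by (simp add: a_lcomm[of x y] r_neg)

lemma (in abelian_group) ag_cancel2:
  "x \<in> carrier G \<Longrightarrow> y \<in> carrier G \<Longrightarrow> w \<in> carrier G \<Longrightarrow>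
    x \<oplus> (y \<oplus> (\<ominus> x \<oplus> w)) = y \<oplus> w"
  by (simp add: a_lcomm[of x y] r_neg2)

lemma (in abelian_group) ag_cancel3:
  "x \<in> carrier G \<Longrightarrow> y \<in> carrier G \<Longrightarrow> z \<in> carrier G \<Longrightarrow>
    x \<oplus> (y \<oplus> (z \<oplus> \<ominus> x)) = y \<oplus> z"
  by (simp add: a_lcomm[of x y] ag_cancel1)

lemma (in abelian_group) ag_cancel4:
  "x \<in> carrier G \<Longrightarrow> y \<in> carrier G \<Longrightarrow> z \<in> carrier G \<Longrightarrow> w \<in> carrier G \<Longrightarrow>
    x \<oplus> (y \<oplus> (z \<oplus> (\<ominus> x \<oplus> w))) = y \<oplus> (z \<oplus> w)"
  by (simp add: a_lcomm[of x y] ag_cancel2)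

lemma (in abelian_group) ag_cancel5:
  "x \<in> carrier G \<Longrightarrow> y \<in> carrier G \<Longrightarrow>
    \<ominus> x \<oplus> (y \<oplus> x) = y"
  using ag_cancel1[of "\<ominus> x" y] by simp

lemma (in abelian_group) ag_cancel6:
  "x \<in> carrier G \<Longrightarrow> y \<in> carrier G \<Longrightarrow> w \<in> carrier G \<Longrightarrow>
    \<ominus> x \<oplus> (y \<oplus> (x \<oplus> w)) = y \<oplus> w"
  using ag_cancel2[of "\<ominus> x" y w] by simp

lemma (in abelian_group) ag_cancel7:
  "x \<in> carrier G \<Longrightarrow> y \<in> carrier G \<Longrightarrow> z \<in> carrier G \<Longrightarrow>
    \<ominus> x \<oplus> (y \<oplus> (z \<oplus> x)) = y \<oplus> z"
  using ag_cancel3[of "\<ominus> x" y z] by simp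

lemma (in abelian_group) ag_cancel8:
  "x \<in> carrier G \<Longrightarrow> y \<in> carrier G \<Longrightarrow> z \<in> carrier G \<Longrightarrow> w \<in> carrier G \<Longrightarrow>
    \<ominus> x \<oplus> (y \<oplus> (z \<oplus> (x \<oplus> w))) = y \<oplus> (z \<oplus> w)"
  using ag_cancel4[of "\<ominus> x" y z w] by simp

lemmas (in abelian_group) ag_normalize = minus_eq minus_add a_ac r_neg r_neg1 r_neg2 l_neg
  ag_cancel1 ag_cancel2 ag_cancel3 ag_cancel4 ag_cancel5 ag_cancel6 ag_cancel7 ag_cancel8

lemma ag_minus_zero:
  assumes "abelian_group G" "x \<in> carrier G"
  shows "x \<ominus>\<^bsub>G\<^esub> \<zero>\<^bsub>G\<^esub> = x"
proof -
  interpret abelian_group G by fact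
  have "\<ominus>\<^bsub>G\<^esub> \<zero>\<^bsub>G\<^esub> = \<zero>\<^bsub>G\<^esub>" using r_neg[of "\<zero>\<^bsub>G\<^esub>"] by simp
  then show ?thesis using assms(2) by (simp add: a_minus_def)
qed

lemma ag_minus_eq_zero:
  assumes "abelian_group G" "x \<in> carrier G" "y \<in> carrier G"
  shows "x \<ominus>\<^bsub>G\<^esub> y = \<zero>\<^bsub>G\<^esub> \<longleftrightarrow> x = y"
proof -
  interpret abelian_group G by fact
  show ?thesis
  proof
    assume *: "x \<ominus>\<^bsub>G\<^esub> y = \<zero>\<^bsub>G\<^esub>"
    have "x = (x \<ominus>\<^bsub>G\<^esub> y) \<oplus>\<^bsub>G\<^esub> y" using assms by (simp add: ag_normalize)
    then show "x = y" using * assms by simp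
  qed (use assms in \<open>simp add: ag_normalize\<close>)
qed

lemma ag_add_eq_zero:
  assumes "abelian_group G" "x \<in> carrier G" "y \<in> carrier G"
  shows "x \<oplus>\<^bsub>G\<^esub> y = \<zero>\<^bsub>G\<^esub> \<longleftrightarrow> \<ominus>\<^bsub>G\<^esub> x = y"
proof -
  interpret abelian_group G by fact
  show ?thesis
    using minus_equality[of y x] assms a_comm[of x y] r_neg[of x] by auto
qed

lemma ag_uminus_eq_zero:
  assumes "abelian_group G" "x \<in> carrier G"
  shows "\<ominus>\<^bsub>G\<^esub> x = \<zero>\<^bsub>G\<^esub> \<longleftrightarrow> x = \<zero>\<^bsub>G\<^esub>"
proof -
  interpret abelian_group G by fact
  show ?thesis using ag_add_eq_zero[OF assms, of "\<zero>\<^bsub>G\<^esub>"] assms by simp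
qed

lemma ag_uminus_zero: "abelian_group G \<Longrightarrow> \<ominus>\<^bsub>G\<^esub> \<zero>\<^bsub>G\<^esub> = \<zero>\<^bsub>G\<^esub>"
  using ag_uminus_eq_zero[of G "\<zero>\<^bsub>G\<^esub>"] by (simp add: abelian_group_def abelian_monoid.zero_closed)

lemma module_abelian_group: "module R M \<Longrightarrow> abelian_group M"
  by (simp add: module_def)

lemma module_homI:
  assumes "\<And>x. x \<in> carrier M \<Longrightarrow> f x \<in> carrier N"
    and "\<And>x y. x \<in> carrier M \<Longrightarrow> y \<in> carrier M \<Longrightarrow> f (x \<oplus>\<^bsub>M\<^esub> y) = f x \<oplus>\<^bsub>N\<^esub> f y"
    and "\<And>r x. r \<in> carrier R \<Longrightarrow> x \<in> carrier M \<Longrightarrow> f (r \<odot>\<^bsub>M\<^esub> x) = r \<odot>\<^bsub>N\<^esub> f x"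
  shows "f \<in> module_hom R M N"
  using assms by (auto simp: module_hom_def)

lemma hom_closed: "f \<in> module_hom R M N \<Longrightarrow> x \<in> carrier M \<Longrightarrow> f x \<in> carrier N"
  by (auto simp: module_hom_def)

lemma hom_add: "f \<in> module_hom R M N \<Longrightarrow> x \<in> carrier M \<Longrightarrow> y \<in> carrier M \<Longrightarrow>
    f (x \<oplus>\<^bsub>M\<^esub> y) = f x \<oplus>\<^bsub>N\<^esub> f y"
  by (auto simp: module_hom_def)

lemma hom_smult: "f \<in> module_hom R M N \<Longrightarrow> r \<in> carrier R \<Longrightarrow> x \<in> carrier M \<Longrightarrow>
    f (r \<odot>\<^bsub>M\<^esub> x) = r \<odot>\<^bsub>N\<^esub> f x"
  by (auto simp: module_hom_def)

lemma hom_zero: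
  assumes "module R M" "module R N" "f \<in> module_hom R M N"
  shows "f \<zero>\<^bsub>M\<^esub> = \<zero>\<^bsub>N\<^esub>"
proof -
  interpret M: module R M by fact
  interpret N: module R N by fact
  have "f \<zero>\<^bsub>M\<^esub> = f (\<zero>\<^bsub>R\<^esub> \<odot>\<^bsub>M\<^esub> \<zero>\<^bsub>M\<^esub>)" by simp
  also have "\<dots> = \<zero>\<^bsub>R\<^esub> \<odot>\<^bsub>N\<^esub> f \<zero>\<^bsub>M\<^esub>" by (rule hom_smult[OF assms(3)]) simp_all
  also have "\<dots> = \<zero>\<^bsub>N\<^esub>" using hom_closed[OF assms(3)] by simp
  finally show ?thesis .
qed

lemma hom_uminus:
  assumes "module R M" "module R N" "f \<in> module_hom R M N" "x \<in> carrier M"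
  shows "f (\<ominus>\<^bsub>M\<^esub> x) = \<ominus>\<^bsub>N\<^esub> f x"
proof -
  interpret M: module R M by fact
  interpret N: module R N by fact
  have "f (\<ominus>\<^bsub>M\<^esub> x) \<oplus>\<^bsub>N\<^esub> f x = f (\<ominus>\<^bsub>M\<^esub> x \<oplus>\<^bsub>M\<^esub> x)" using assms by (simp add: hom_add)
  also have "\<dots> = \<zero>\<^bsub>N\<^esub>" using assms by (simp add: M.l_neg hom_zero)
  finally show ?thesis
    using assms hom_closed[OF assms(3)] by (simp add: N.minus_equality)
qed

lemma hom_minus:
  assumes "module R M" "module R N" "f \<in> module_hom R M N" "x \<in> carrier M" "y \<in> carrier M"
  shows "f (x \<ominus>\<^bsub>M\<^esub> y) = f x \<ominus>\<^bsub>N\<^esub> f y"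
proof -
  interpret M: module R M by fact
  show ?thesis using assms by (simp add: a_minus_def hom_add hom_uminus)
qed

lemma module_hom_comp:
  "f \<in> module_hom R M N \<Longrightarrow> g \<in> module_hom R N L \<Longrightarrow> (\<lambda>x. g (f x)) \<in> module_hom R M L"
  by (auto simp: module_hom_def Pi_def)

lemma module_hom_id: "(\<lambda>x. x) \<in> module_hom R M M"
  by (auto simp: module_hom_def)

lemma module_hom_zero:
  assumes "module R N" shows "(\<lambda>x. \<zero>\<^bsub>N\<^esub>) \<in> module_hom R M N"
proof -
  interpret N: module R N by fact
  show ?thesis by (auto simp: module_hom_def)
qed

lemma module_hom_add:
  assumes "module R N" "f \<in> module_hom R M N" "g \<in> module_hom R M N"
  shows "(\<lambda>x. f x \<oplus>\<^bsub>N\<^esub> g x) \<in> module_hom R M N"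
proof -
  interpret N: module R N by fact
  show ?thesis using assms hom_closed[OF assms(2)] hom_closed[OF assms(3)]
    by (intro module_homI) (simp_all add: hom_add hom_smult N.smult_r_distr N.a_ac)
qed

lemma module_hom_uminus:
  assumes "module R N" "f \<in> module_hom R M N"
  shows "(\<lambda>x. \<ominus>\<^bsub>N\<^esub> f x) \<in> module_hom R M N"
proof -
  interpret N: module R N by fact
  show ?thesis using assms hom_closed[OF assms(2)]
    by (intro module_homI) (simp_all add: hom_add hom_smult N.smult_r_minus N.minus_add)
qed

lemma module_hom_diff:
  assumes "module R N" "f \<in> module_hom R M N" "g \<in> module_hom R M N"
  shows "(\<lambda>x. f x \<ominus>\<^bsub>N\<^esub> g x) \<in> module_hom R M N"
  unfolding a_minus_def by (intro module_hom_add module_hom_uminus assms)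

lemma hom_finsum:
  assumes "module R M" "module R N" "f \<in> module_hom R M N" "\<And>j. j < n \<Longrightarrow> g j \<in> carrier M"
  shows "f (\<Oplus>\<^bsub>M\<^esub>j\<in>{..<n::nat}. g j) = (\<Oplus>\<^bsub>N\<^esub>j\<in>{..<n}. f (g j))"
  using assms(4)
proof (induction n)
  case 0
  interpret M: module R M by fact
  interpret N: module R N by fact
  show ?case using assms by (simp add: hom_zero)
next
  case (Suc n)
  interpret M: module R M by fact
  interpret N: module R N by fact
  have "g \<in> {..<n} \<rightarrow> carrier M" "(\<lambda>j. f (g j)) \<in> {..<n} \<rightarrow> carrier N"
    "g n \<in> carrier M" "f (g n) \<in> carrier N"
    using Suc.prems hom_closed[OF assms(3)] by auto
  with Suc show ?case
    by (simp add: lessThan_Suc M.finsum_insert N.finsum_insert M.finsum_closed hom_add[OF assms(3)])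
qed

section \<open>Finitely generated projective modules\<close>

definition regular_module :: "('a, 'r) ring_scheme \<Rightarrow> ('a, 'a) module" where
  "regular_module R = \<lparr>carrier = carrier R, mult = mult R, one = one R, zero = zero R, add = add R,
     smult = mult R\<rparr>"

lemma regular_module:
  assumes "cring R" shows "module R (regular_module R)"
proof -
  interpret cring R by fact
  show ?thesis
    by (rule moduleI, rule assms, rule abelian_groupI)
      (auto simp: regular_module_def l_distr r_distr m_assoc a_assoc intro: a_comm l_neg)
qed

lemma regular_module_simps [simp]:
  "carrier (regular_module R) = carrier R" "zero (regular_module R) = zero R"
  "add (regular_module R) = add R" "smult (regular_module R) = mult R"
  by (simp_all add: regular_module_def)

lemma module_hom_lincomb:
  assumes "module R P" "module R N"
    and "\<And>j. j < n \<Longrightarrow> \<phi> j \<in> module_hom R P (regular_module R)"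
    and "\<And>j. j < n \<Longrightarrow> b j \<in> carrier N"
  shows "(\<lambda>x. \<Oplus>\<^bsub>N\<^esub>j\<in>{..<n::nat}. \<phi> j x \<odot>\<^bsub>N\<^esub> b j) \<in> module_hom R P N"
  using assms(3,4)
proof (induction n)
  case 0
  interpret N: module R N by fact
  show ?case by (simp add: module_hom_zero[OF assms(2)])
next
  case (Suc n)
  interpret N: module R N by fact
  have 1: "(\<lambda>x. \<phi> n x \<odot>\<^bsub>N\<^esub> b n) \<in> module_hom R P N"
    using Suc.prems(1)[of n] Suc.prems(2)[of n] hom_closed[OF Suc.prems(1)[of n]]
    by (intro module_homI)
      (simp_all add: hom_add[where N="regular_module R"] hom_smult[where N="regular_module R"]
        N.smult_l_distr N.smult_assoc1)
  have 2: "(\<lambda>x. \<phi> n x \<odot>\<^bsub>N\<^esub> b n \<oplus>\<^bsub>N\<^esub> (\<Oplus>\<^bsub>N\<^esub>j\<in>{..<n}. \<phi> j x \<odot>\<^bsub>N\<^esub> b j)) \<in> module_hom R P N"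
    by (rule module_hom_add[OF assms(2) 1]) (use Suc in auto)
  have eq: "(\<Oplus>\<^bsub>N\<^esub>j\<in>{..<Suc n}. \<phi> j x \<odot>\<^bsub>N\<^esub> b j) =
      \<phi> n x \<odot>\<^bsub>N\<^esub> b n \<oplus>\<^bsub>N\<^esub> (\<Oplus>\<^bsub>N\<^esub>j\<in>{..<n}. \<phi> j x \<odot>\<^bsub>N\<^esub> b j)" if "x \<in> carrier P" for x
  proof -
    have "\<And>j. j < Suc n \<Longrightarrow> \<phi> j x \<in> carrier R"
      using hom_closed[OF Suc.prems(1) that] by simp
    then show ?thesis unfolding lessThan_Suc
      by (subst N.finsum_insert) (use Suc.prems(2) in auto)
  qed
  interpret P: module R P by fact
  from 2 show ?case by (auto simp: module_hom_def eq)
qed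

text \<open>
  This is the dual basis criterion for finitely generated projective modules.  It mentions no test
  modules and therefore yields lifts against surjections between modules of arbitrary types.
\<close>

definition finite_projective :: "('a, 'r) ring_scheme \<Rightarrow> ('a, 'p) module \<Rightarrow> bool" where
  "finite_projective R P \<longleftrightarrow> module R P \<and> (\<exists>n b \<phi>.
     (\<forall>j<n. b j \<in> carrier P) \<and> (\<forall>j<n. \<phi> j \<in> module_hom R P (regular_module R)) \<and>
     (\<forall>x\<in>carrier P. x = (\<Oplus>\<^bsub>P\<^esub>j\<in>{..<n::nat}. \<phi> j x \<odot>\<^bsub>P\<^esub> b j)))"

lemma finite_projective_module: "finite_projective R P \<Longrightarrow> module R P"
  by (simp add: finite_projective_def)

text \<open>
  Lift the images of the dual basis and recombine these lifts with the coordinate functions.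
\<close>

lemma finite_projective_lift:
  assumes fp: "finite_projective R P" and A: "module R A" and B: "module R B"
    and \<rho>: "\<rho> \<in> module_hom R A B" and \<sigma>: "\<sigma> \<in> module_hom R P B"
    and sub: "\<And>x. x \<in> carrier P \<Longrightarrow> \<exists>u\<in>carrier A. \<rho> u = \<sigma> x"
  shows "\<exists>\<tau>\<in>module_hom R P A. \<forall>x\<in>carrier P. \<rho> (\<tau> x) = \<sigma> x"
proof -
  have P: "module R P" using fp by (rule finite_projective_module)
  interpret P: module R P by fact
  interpret A: module R A by fact
  interpret B: module R B by fact
  obtain n b \<phi> where b: "\<And>j. j < n \<Longrightarrow> b j \<in> carrier P"
    and \<phi>: "\<And>j. j < n \<Longrightarrow> \<phi> j \<in> module_hom R P (regular_module R)"
    and ex: "\<And>x. x \<in> carrier P \<Longrightarrow> x = (\<Oplus>\<^bsub>P\<^esub>j\<in>{..<n::nat}. \<phi> j x \<odot>\<^bsub>P\<^esub> b j)"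
    using fp unfolding finite_projective_def by blast
  have "\<forall>j. \<exists>u. j < n \<longrightarrow> u \<in> carrier A \<and> \<rho> u = \<sigma> (b j)"
    using sub b by blast
  then obtain u where u: "\<And>j. j < n \<Longrightarrow> u j \<in> carrier A" "\<And>j. j < n \<Longrightarrow> \<rho> (u j) = \<sigma> (b j)" by metis
  show ?thesis
  proof (intro bexI ballI)
    show "(\<lambda>x. \<Oplus>\<^bsub>A\<^esub>j\<in>{..<n}. \<phi> j x \<odot>\<^bsub>A\<^esub> u j) \<in> module_hom R P A"
      by (rule module_hom_lincomb[OF P A \<phi> u(1)])
    fix x assume x: "x \<in> carrier P"
    have c: "\<And>j. j < n \<Longrightarrow> \<phi> j x \<in> carrier R" using hom_closed[OF \<phi> x] by simp
    have "\<rho> (\<Oplus>\<^bsub>A\<^esub>j\<in>{..<n}. \<phi> j x \<odot>\<^bsub>A\<^esub> u j) = (\<Oplus>\<^bsub>B\<^esub>j\<in>{..<n}. \<rho> (\<phi> j x \<odot>\<^bsub>A\<^esub> u j))"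
      by (rule hom_finsum[OF A B \<rho>]) (simp add: c u)
    also have "\<dots> = (\<Oplus>\<^bsub>B\<^esub>j\<in>{..<n}. \<sigma> (\<phi> j x \<odot>\<^bsub>P\<^esub> b j))"
      by (rule B.finsum_cong')
        (auto simp: c u b hom_smult[OF \<rho>] hom_smult[OF \<sigma>] hom_closed[OF \<sigma>])
    also have "\<dots> = \<sigma> (\<Oplus>\<^bsub>P\<^esub>j\<in>{..<n}. \<phi> j x \<odot>\<^bsub>P\<^esub> b j)"
      by (rule hom_finsum[OF P B \<sigma>, symmetric]) (simp add: c b)
    also have "\<dots> = \<sigma> x" using ex[OF x] by simp
    finally show "\<rho> (\<Oplus>\<^bsub>A\<^esub>j\<in>{..<n}. \<phi> j x \<odot>\<^bsub>A\<^esub> u j) = \<sigma> x" .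
  qed
qed

lemma finite_projective_projective_module:
  fixes P :: "('a, 'p) module"
  assumes fp: "finite_projective R P" shows "projective_module R P"
  unfolding projective_module_def
proof (intro conjI allI impI finite_projective_module[OF fp])
  fix X Y :: "('a, ('a, 'p) univ) module" and g f
  assume *: "module R X \<and> module R Y \<and> g \<in> module_hom R X Y \<and> g ` carrier X = carrier Y \<and>
    f \<in> module_hom R P Y"
  show "\<exists>h\<in>module_hom R P X. \<forall>p\<in>carrier P. g (h p) = f p"
  proof (rule finite_projective_lift[OF fp, of X Y])
    fix x assume "x \<in> carrier P"
    then have "f x \<in> g ` carrier X" using * by (auto simp: hom_closed)
    then show "\<exists>u\<in>carrier X. g u = f x" by auto
  qed (use * in auto)
qed

text \<open>
  The image of a dual basis under the retraction is a dual basis, with coordinates restricted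
  along the inclusion.
\<close>

lemma finite_projective_retract:
  assumes fp: "finite_projective R P" and Q: "module R Q"
    and f: "f \<in> module_hom R Q P" and g: "g \<in> module_hom R P Q"
    and gf: "\<And>x. x \<in> carrier Q \<Longrightarrow> g (f x) = x"
  shows "finite_projective R Q"
proof -
  have P: "module R P" using fp by (rule finite_projective_module)
  interpret P: module R P by fact
  obtain n b \<phi> where b: "\<And>j. j < n \<Longrightarrow> b j \<in> carrier P"
    and \<phi>: "\<And>j. j < n \<Longrightarrow> \<phi> j \<in> module_hom R P (regular_module R)"
    and ex: "\<And>x. x \<in> carrier P \<Longrightarrow> x = (\<Oplus>\<^bsub>P\<^esub>j\<in>{..<n::nat}. \<phi> j x \<odot>\<^bsub>P\<^esub> b j)"
    using fp unfolding finite_projective_def by blast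
  show ?thesis unfolding finite_projective_def
  proof (intro conjI exI allI ballI impI Q)
    fix j assume "j < n"
    then show "g (b j) \<in> carrier Q" using b g by (simp add: hom_closed)
    show "(\<lambda>x. \<phi> j (f x)) \<in> module_hom R Q (regular_module R)"
      by (rule module_hom_comp[OF f \<phi>]) fact
  next
    interpret Q: module R Q by fact
    fix x assume x: "x \<in> carrier Q"
    then have fx: "f x \<in> carrier P" by (rule hom_closed[OF f])
    have cl: "\<And>j. j < n \<Longrightarrow> \<phi> j (f x) \<in> carrier R" using hom_closed[OF \<phi> fx] by simp
    have "x = g (\<Oplus>\<^bsub>P\<^esub>j\<in>{..<n::nat}. \<phi> j (f x) \<odot>\<^bsub>P\<^esub> b j)" using ex[OF fx] gf[OF x] by simp
    also have "\<dots> = (\<Oplus>\<^bsub>Q\<^esub>j\<in>{..<n::nat}. g (\<phi> j (f x) \<odot>\<^bsub>P\<^esub> b j))"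
      by (rule hom_finsum[OF P Q g]) (simp add: cl b)
    also have "\<dots> = (\<Oplus>\<^bsub>Q\<^esub>j\<in>{..<n::nat}. \<phi> j (f x) \<odot>\<^bsub>Q\<^esub> g (b j))"
      by (rule Q.finsum_cong') (auto simp: cl b hom_smult[OF g] hom_closed[OF g])
    finally show "x = (\<Oplus>\<^bsub>Q\<^esub>j\<in>{..<n::nat}. \<phi> j (f x) \<odot>\<^bsub>Q\<^esub> g (b j))" .
  qed
qed

section \<open>Linear spans and Noetherian modules\<close>

inductive_set linear_span :: "('a, 'r) ring_scheme \<Rightarrow> ('a, 'm) module \<Rightarrow> 'm set \<Rightarrow> 'm set"
  for R M A where
  zero: "\<zero>\<^bsub>M\<^esub> \<in> linear_span R M A"
| step: "r \<in> carrier R \<Longrightarrow> a \<in> A \<Longrightarrow> x \<in> linear_span R M A \<Longrightarrow> r \<odot>\<^bsub>M\<^esub> a \<oplus>\<^bsub>M\<^esub> x \<in> linear_span R M A"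

lemma linear_span_closed:
  assumes "module R M" "A \<subseteq> carrier M" "x \<in> linear_span R M A"
  shows "x \<in> carrier M"
proof -
  interpret M: module R M by fact
  show ?thesis using assms(3) by induction (use assms(2) in auto)
qed

lemma linear_span_base:
  assumes "module R M" "A \<subseteq> carrier M" "a \<in> A"
  shows "a \<in> linear_span R M A"
proof -
  interpret M: module R M by fact
  show ?thesis using linear_span.step[OF M.R.one_closed assms(3) linear_span.zero, of M] assms
    by (auto simp: subsetD)
qed

lemma submodule_linear_span:
  assumes "module R M" "A \<subseteq> carrier M"
  shows "submodule (linear_span R M A) R M"
proof -
  interpret M: module R M by fact
  have cl: "\<And>x. x \<in> linear_span R M A \<Longrightarrow> x \<in> carrier M" by (rule linear_span_closed[OF assms])
  have add: "x \<oplus>\<^bsub>M\<^esub> y \<in> linear_span R M A" if "x \<in> linear_span R M A" "y \<in> linear_span R M A" for x y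
    using that
  proof induction
    case (step r a x)
    have "r \<odot>\<^bsub>M\<^esub> a \<oplus>\<^bsub>M\<^esub> x \<oplus>\<^bsub>M\<^esub> y = r \<odot>\<^bsub>M\<^esub> a \<oplus>\<^bsub>M\<^esub> (x \<oplus>\<^bsub>M\<^esub> y)"
      using step assms(2) cl by (intro M.a_assoc) auto
    then show ?case using step by (auto intro: linear_span.step)
  qed (auto simp: cl)
  have smult: "s \<odot>\<^bsub>M\<^esub> x \<in> linear_span R M A" if "s \<in> carrier R" "x \<in> linear_span R M A" for s x
    using that(2)
  proof induction
    case (step r a x)
    have "s \<odot>\<^bsub>M\<^esub> (r \<odot>\<^bsub>M\<^esub> a \<oplus>\<^bsub>M\<^esub> x) = (s \<otimes>\<^bsub>R\<^esub> r) \<odot>\<^bsub>M\<^esub> a \<oplus>\<^bsub>M\<^esub> s \<odot>\<^bsub>M\<^esub> x"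
      using step assms(2) cl that(1) by (auto simp: M.smult_r_distr M.smult_assoc1 subsetD)
    then show ?case using step that by (auto intro: linear_span.step)
  qed (use that in \<open>auto intro: linear_span.zero\<close>)
  show ?thesis
  proof (rule M.submoduleI)
    fix a assume a: "a \<in> linear_span R M A"
    have "\<ominus>\<^bsub>M\<^esub> a = (\<ominus>\<^bsub>R\<^esub> \<one>\<^bsub>R\<^esub>) \<odot>\<^bsub>M\<^esub> a" using cl[OF a] by (simp add: M.smult_l_minus)
    then show "\<ominus>\<^bsub>M\<^esub> a \<in> linear_span R M A" using smult[of "\<ominus>\<^bsub>R\<^esub> \<one>\<^bsub>R\<^esub>" a] a by simp
  qed (use cl add smult linear_span.zero in auto)
qed

lemma submoduleD:
  assumes "module R M" "submodule H R M"
  shows "H \<subseteq> carrier M" "\<zero>\<^bsub>M\<^esub> \<in> H" "x \<in> H \<Longrightarrow> y \<in> H \<Longrightarrow> x \<oplus>\<^bsub>M\<^esub> y \<in> H"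
    "x \<in> H \<Longrightarrow> y \<in> H \<Longrightarrow> x \<ominus>\<^bsub>M\<^esub> y \<in> H" "r \<in> carrier R \<Longrightarrow> x \<in> H \<Longrightarrow> r \<odot>\<^bsub>M\<^esub> x \<in> H"
proof -
  interpret M: module R M by fact
  note * = M.submoduleE[OF assms(2)]
  show "H \<subseteq> carrier M" using * by simp
  show "x \<in> H \<Longrightarrow> y \<in> H \<Longrightarrow> x \<oplus>\<^bsub>M\<^esub> y \<in> H" using * by simp
  show "x \<in> H \<Longrightarrow> y \<in> H \<Longrightarrow> x \<ominus>\<^bsub>M\<^esub> y \<in> H" using * by (simp add: a_minus_def)
  show "r \<in> carrier R \<Longrightarrow> x \<in> H \<Longrightarrow> r \<odot>\<^bsub>M\<^esub> x \<in> H" using * by simp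
  obtain x where "x \<in> H" using * by auto
  then have "\<zero>\<^bsub>R\<^esub> \<odot>\<^bsub>M\<^esub> x \<in> H" using *(4)[of "\<zero>\<^bsub>R\<^esub>"] by simp
  then show "\<zero>\<^bsub>M\<^esub> \<in> H" using \<open>x \<in> H\<close> *(1) by auto
qed

lemma linear_span_minimal:
  assumes "module R M" "submodule H R M" "A \<subseteq> H"
  shows "linear_span R M A \<subseteq> H"
proof
  note H = submoduleD[OF assms(1,2)]
  fix x assume "x \<in> linear_span R M A"
  then show "x \<in> H" by induction (use H assms(3) in auto)
qed

lemma linear_span_mono: "A \<subseteq> B \<Longrightarrow> x \<in> linear_span R M A \<Longrightarrow> x \<in> linear_span R M B"
  by (erule linear_span.induct) (auto intro: linear_span.intros)

lemma linear_span_insertE: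
  assumes "module R M" "insert b B \<subseteq> carrier M" "x \<in> linear_span R M (insert b B)"
  shows "\<exists>r\<in>carrier R. \<exists>y\<in>linear_span R M B. x = r \<odot>\<^bsub>M\<^esub> b \<oplus>\<^bsub>M\<^esub> y"
proof -
  interpret M: module R M by fact
  have B: "B \<subseteq> carrier M" and b: "b \<in> carrier M" using assms by auto
  note sp = submodule_linear_span[OF assms(1) B]
  note cl = linear_span_closed[OF assms(1) B]
  show ?thesis using assms(3)
  proof induction
    case zero
    have "\<zero>\<^bsub>M\<^esub> = \<zero>\<^bsub>R\<^esub> \<odot>\<^bsub>M\<^esub> b \<oplus>\<^bsub>M\<^esub> \<zero>\<^bsub>M\<^esub>" using b by simp
    then show ?case using linear_span.zero by blast
  next
    case (step r a x)
    then obtain s y where sy: "s \<in> carrier R" "y \<in> linear_span R M B" "x = s \<odot>\<^bsub>M\<^esub> b \<oplus>\<^bsub>M\<^esub> y" by blast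
    show ?case
    proof (cases "a = b")
      case True
      have "r \<odot>\<^bsub>M\<^esub> a \<oplus>\<^bsub>M\<^esub> x = (r \<oplus>\<^bsub>R\<^esub> s) \<odot>\<^bsub>M\<^esub> b \<oplus>\<^bsub>M\<^esub> y"
        using sy step True b cl by (simp add: M.smult_l_distr M.a_assoc)
      then show ?thesis using sy step by blast
    next
      case False
      then have a: "a \<in> B" using step by simp
      have "r \<odot>\<^bsub>M\<^esub> a \<oplus>\<^bsub>M\<^esub> x = s \<odot>\<^bsub>M\<^esub> b \<oplus>\<^bsub>M\<^esub> (r \<odot>\<^bsub>M\<^esub> a \<oplus>\<^bsub>M\<^esub> y)"
        using sy step a b B cl by (simp add: M.a_lcomm subsetD)
      moreover have "r \<odot>\<^bsub>M\<^esub> a \<oplus>\<^bsub>M\<^esub> y \<in> linear_span R M B" by (rule linear_span.step) fact+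
      ultimately show ?thesis using sy(1) by blast
    qed
  qed
qed

lemma submodule_ideal:
  fixes R (structure)
  assumes "cring R" "submodule I R (regular_module R)"
  shows "ideal I R"
proof -
  interpret cring R by fact
  note sd = submoduleD[OF regular_module[OF assms(1)] assms(2)]
  show ?thesis
  proof (rule idealI)
    show "ring R" by (rule ring_axioms)
    have inv: "\<ominus> x \<in> I" if "x \<in> I" for x
      using sd(5)[of "\<ominus> \<one>" x] that sd(1) by (auto simp: l_minus)
    show "subgroup I (add_monoid R)"
      by (rule subgroup.intro) (use sd inv in \<open>auto simp: a_inv_def[symmetric]\<close>)
    show "\<And>a x. a \<in> I \<Longrightarrow> x \<in> carrier R \<Longrightarrow> x \<otimes> a \<in> I" using sd(5) by simp
    show "\<And>a x. a \<in> I \<Longrightarrow> x \<in> carrier R \<Longrightarrow> a \<otimes> x \<in> I" using sd(1) sd(5)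
      by (metis m_comm regular_module_simps(1,4) subsetD)
  qed
qed

lemma regular_submoduleI:
  fixes R (structure)
  assumes "cring R" "I \<subseteq> carrier R" "\<zero>\<^bsub>R\<^esub> \<in> I" "\<And>x y. x \<in> I \<Longrightarrow> y \<in> I \<Longrightarrow> x \<oplus>\<^bsub>R\<^esub> y \<in> I"
    "\<And>r x. r \<in> carrier R \<Longrightarrow> x \<in> I \<Longrightarrow> r \<otimes>\<^bsub>R\<^esub> x \<in> I"
  shows "ideal I R"
proof (rule submodule_ideal[OF assms(1)])
  interpret cring R by fact
  interpret M: module R "regular_module R" by (rule regular_module[OF assms(1)])
  have inv: "\<ominus>\<^bsub>regular_module R\<^esub> x \<in> I" if "x \<in> I" for x
  proof -
    have "x \<in> carrier R" using that assms(2) by auto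
    then have "\<ominus>\<^bsub>regular_module R\<^esub> x = \<ominus> \<one> \<otimes> x" using M.smult_l_minus[of \<one> x] by simp
    then show ?thesis using assms(5)[of "\<ominus> \<one>" x] that by simp
  qed
  show "submodule I R (regular_module R)"
    by (rule M.submoduleI) (simp_all add: assms(2-5) inv)
qed

text \<open>
  Induction on the generating set.  Elements of the span of \<open>insert b B\<close> have the form \<open>r b + y\<close> with
  \<open>y\<close> in the span of \<open>B\<close>, and the leading coefficients \<open>r\<close> of the elements of \<open>K\<close> form an ideal.  This
  ideal is finitely generated; subtracting a combination of elements of \<open>K\<close> with these leading
  coefficients reduces the claim to \<open>K \<inter> span B\<close>.
\<close>

lemma noetherian_submodule:
  fixes R (structure)
  assumes cr: "cring R" and noeth: "noetherian_ring R" and N: "module R N"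
    and fin: "finite B" and B: "B \<subseteq> carrier N"
  shows "submodule K R N \<Longrightarrow> K \<subseteq> linear_span R N B \<Longrightarrow> \<exists>A\<subseteq>K. finite A \<and> K \<subseteq> linear_span R N A"
  using fin B
proof (induction B arbitrary: K)
  case empty
  have "linear_span R N {} \<subseteq> {\<zero>\<^bsub>N\<^esub>}"
  proof
    fix x assume "x \<in> linear_span R N {}"
    then show "x \<in> {\<zero>\<^bsub>N\<^esub>}" by induction auto
  qed
  then show ?case using empty linear_span.zero[of N R "{}"] by (intro exI[of _ "{}"]) auto
next
  case (insert b B)
  interpret cring R by fact
  interpret N: module R N by fact
  have b: "b \<in> carrier N" and B: "B \<subseteq> carrier N" using insert by auto
  note K = submoduleD[OF N insert.prems(1)]
  note LB = submoduleD[OF N submodule_linear_span[OF N B]]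
  define lead where "lead H = {r \<in> carrier R. \<exists>y\<in>linear_span R N B. r \<odot>\<^bsub>N\<^esub> b \<oplus>\<^bsub>N\<^esub> y \<in> H}" for H
  have lead_ideal: "ideal (lead H) R" if "submodule H R N" for H
  proof (rule regular_submoduleI[OF cr])
    note H = submoduleD[OF N that]
    show "lead H \<subseteq> carrier R" by (auto simp: lead_def)
    show "\<zero> \<in> lead H" using b H(2) LB(2) by (auto simp: lead_def intro!: bexI[of _ "\<zero>\<^bsub>N\<^esub>"])
    fix x y assume "x \<in> lead H" "y \<in> lead H"
    then obtain x' y' where *: "x \<in> carrier R" "y \<in> carrier R" "x' \<in> linear_span R N B"
      "y' \<in> linear_span R N B"
      "x \<odot>\<^bsub>N\<^esub> b \<oplus>\<^bsub>N\<^esub> x' \<in> H" "y \<odot>\<^bsub>N\<^esub> b \<oplus>\<^bsub>N\<^esub> y' \<in> H" by (auto simp: lead_def)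
    have "(x \<oplus> y) \<odot>\<^bsub>N\<^esub> b \<oplus>\<^bsub>N\<^esub> (x' \<oplus>\<^bsub>N\<^esub> y') = x \<odot>\<^bsub>N\<^esub> b \<oplus>\<^bsub>N\<^esub> x' \<oplus>\<^bsub>N\<^esub> (y \<odot>\<^bsub>N\<^esub> b \<oplus>\<^bsub>N\<^esub> y')"
      using * b LB(1) by (simp add: N.smult_l_distr N.a_ac subsetD)
    then show "x \<oplus> y \<in> lead H"
      using * H(3)[OF *(5,6)] LB(3)[OF *(3,4)] unfolding lead_def
        by (auto intro!: bexI[of _ "x' \<oplus>\<^bsub>N\<^esub> y'"])
  next
    note H = submoduleD[OF N that]
    fix r x assume r: "r \<in> carrier R" and "x \<in> lead H"
    then obtain x' where *: "x \<in> carrier R" "x' \<in> linear_span R N B" "x \<odot>\<^bsub>N\<^esub> b \<oplus>\<^bsub>N\<^esub> x' \<in> H"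
      by (auto simp: lead_def)
    have "(r \<otimes> x) \<odot>\<^bsub>N\<^esub> b \<oplus>\<^bsub>N\<^esub> (r \<odot>\<^bsub>N\<^esub> x') = r \<odot>\<^bsub>N\<^esub> (x \<odot>\<^bsub>N\<^esub> b \<oplus>\<^bsub>N\<^esub> x')"
      using * r b LB(1) by (simp add: N.smult_r_distr N.smult_assoc1 subsetD)
    then show "r \<otimes> x \<in> lead H"
      using * r H(5)[OF r *(3)] LB(5)[OF r *(2)] unfolding lead_def
      by (auto intro!: bexI[of _ "r \<odot>\<^bsub>N\<^esub> x'"])
  qed
  obtain A0 where A0: "A0 \<subseteq> carrier R" "finite A0" "lead K = Idl A0"
    using noetherian_ring.finetely_gen[OF noeth lead_ideal[OF insert.prems(1)]] by blast
  have "\<forall>a\<in>A0. \<exists>x. x \<in> K \<and> (\<exists>y\<in>linear_span R N B. x = a \<odot>\<^bsub>N\<^esub> b \<oplus>\<^bsub>N\<^esub> y)"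
  proof
    fix a assume "a \<in> A0"
    then have "a \<in> lead K" using genideal_self[OF A0(1)] A0(3) by auto
    then show "\<exists>x. x \<in> K \<and> (\<exists>y\<in>linear_span R N B. x = a \<odot>\<^bsub>N\<^esub> b \<oplus>\<^bsub>N\<^esub> y)" by (auto simp: lead_def)
  qed
  then obtain w where w: "\<And>a. a \<in> A0 \<Longrightarrow> w a \<in> K"
    "\<And>a. a \<in> A0 \<Longrightarrow> \<exists>y\<in>linear_span R N B. w a = a \<odot>\<^bsub>N\<^esub> b \<oplus>\<^bsub>N\<^esub> y" by metis
  have wK: "w ` A0 \<subseteq> K" using w by auto
  have wN: "w ` A0 \<subseteq> carrier N" using wK K(1) by auto
  have "submodule (K \<inter> linear_span R N B) R N"
    by (rule N.submoduleI) (use K LB N.submoduleE[OF insert.prems(1)]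
      N.submoduleE[OF submodule_linear_span[OF N B]] in auto)
  from insert.IH[OF this _ B] obtain A2 where A2: "A2 \<subseteq> K \<inter> linear_span R N B" "finite A2"
    "K \<inter> linear_span R N B \<subseteq> linear_span R N A2" by auto
  define A where "A = w ` A0 \<union> A2"
  have AN: "A \<subseteq> carrier N" using wN A2 K(1) by (auto simp: A_def)
  note LA = submoduleD[OF N submodule_linear_span[OF N AN]]
  have "x \<in> linear_span R N A" if x: "x \<in> K" for x
  proof -
    obtain r y where ry: "r \<in> carrier R" "y \<in> linear_span R N B" "x = r \<odot>\<^bsub>N\<^esub> b \<oplus>\<^bsub>N\<^esub> y"
      using linear_span_insertE[OF N _ , of b B x] insert.prems x b B by blast
    then have "r \<in> lead K" using x by (auto simp: lead_def)
    moreover have "Idl A0 \<subseteq> lead (linear_span R N (w ` A0))"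
    proof (rule genideal_minimal[OF lead_ideal[OF submodule_linear_span[OF N wN]]], rule subsetI)
      fix a assume a: "a \<in> A0"
      then have "w a \<in> linear_span R N (w ` A0)" by (intro linear_span_base[OF N wN]) auto
      then show "a \<in> lead (linear_span R N (w ` A0))" using w(2)[OF a] A0(1) a
        by (auto simp: lead_def)
    qed
    ultimately obtain y' where y': "y' \<in> linear_span R N B"
      "r \<odot>\<^bsub>N\<^esub> b \<oplus>\<^bsub>N\<^esub> y' \<in> linear_span R N (w ` A0)"
      using A0(3) by (auto simp: lead_def)
    let ?z = "r \<odot>\<^bsub>N\<^esub> b \<oplus>\<^bsub>N\<^esub> y'"
    have zA: "?z \<in> linear_span R N A" using y'(2)
      by (rule linear_span_mono[rotated]) (simp add: A_def)
    have zK: "?z \<in> K" using y'(2) linear_span_minimal[OF N insert.prems(1) wK] by auto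
    have eq: "x \<ominus>\<^bsub>N\<^esub> ?z = y \<ominus>\<^bsub>N\<^esub> y'"
      using ry y' b LB(1) by (simp add: N.ag_normalize subsetD)
    have "x \<ominus>\<^bsub>N\<^esub> ?z \<in> K" by (rule K(4)[OF x zK])
    moreover have "y \<ominus>\<^bsub>N\<^esub> y' \<in> linear_span R N B" using LB(4) ry y' by simp
    ultimately have "x \<ominus>\<^bsub>N\<^esub> ?z \<in> linear_span R N A2" using A2 by (simp add: eq subset_eq)
    then have "x \<ominus>\<^bsub>N\<^esub> ?z \<in> linear_span R N A" by (rule linear_span_mono[rotated]) (simp add: A_def)
    from LA(3)[OF this zA] show ?thesis using x K(1) zK by (simp add: N.ag_normalize subsetD)
  qed
  moreover have "A \<subseteq> K" "finite A" using A0 A2 wK by (auto simp: A_def)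
  ultimately show ?case by blast
qed

section \<open>Free modules of finite rank\<close>

text \<open>
  Vectors are lists over the ring, so that all free modules of finite rank share the type
  \<open>('a, 'm) univ\<close>, whatever \<open>'m\<close> is.
\<close>

definition free_vec :: "nat \<Rightarrow> (nat \<Rightarrow> 'a) \<Rightarrow> ('a, 'm) univ" where
  "free_vec n f = map (\<lambda>j. Inl (f j)) [0..<n]"

definition coord :: "nat \<Rightarrow> ('a, 'm) univ \<Rightarrow> 'a" where
  "coord j x = projl (x ! j)"

definition free_module :: "('a, 'r) ring_scheme \<Rightarrow> nat \<Rightarrow> ('a, ('a, 'm) univ) module" where
  "free_module R n = \<lparr>carrier = {free_vec n f | f. f \<in> {..<n} \<rightarrow> carrier R}, mult = undefined,
     one = undefined, zero = free_vec n (\<lambda>j. \<zero>\<^bsub>R\<^esub>),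
     add = (\<lambda>x y. free_vec n (\<lambda>j. coord j x \<oplus>\<^bsub>R\<^esub> coord j y)),
     smult = (\<lambda>r x. free_vec n (\<lambda>j. r \<otimes>\<^bsub>R\<^esub> coord j x))\<rparr>"

definition unit_vec :: "('a, 'r) ring_scheme \<Rightarrow> nat \<Rightarrow> nat \<Rightarrow> ('a, 'm) univ" where
  "unit_vec R n i = free_vec n (\<lambda>j. if i = j then \<one>\<^bsub>R\<^esub> else \<zero>\<^bsub>R\<^esub>)"

lemma coord_free_vec [simp]: "j < n \<Longrightarrow> coord j (free_vec n f) = f j"
  by (simp add: coord_def free_vec_def)

lemma free_vec_eq_iff: "free_vec n f = free_vec n g \<longleftrightarrow> (\<forall>j<n. f j = g j)"
  by (auto simp: free_vec_def)

lemma free_module_eqI: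
  assumes "x \<in> carrier (free_module R n)" "y \<in> carrier (free_module R n)"
    "\<And>j. j < n \<Longrightarrow> coord j x = coord j y"
  shows "x = y"
  using assms by (auto simp: free_module_def free_vec_eq_iff)

lemma free_vec_carrier: "f \<in> {..<n} \<rightarrow> carrier R \<Longrightarrow> free_vec n f \<in> carrier (free_module R n)"
  by (auto simp: free_module_def)

lemma coord_closed: "x \<in> carrier (free_module R n) \<Longrightarrow> j < n \<Longrightarrow> coord j x \<in> carrier R"
  by (auto simp: free_module_def)

lemma coord_ops:
  "j < n \<Longrightarrow> coord j (x \<oplus>\<^bsub>free_module R n\<^esub> y) = coord j x \<oplus>\<^bsub>R\<^esub> coord j y"
  "j < n \<Longrightarrow> coord j (r \<odot>\<^bsub>free_module R n\<^esub> x) = r \<otimes>\<^bsub>R\<^esub> coord j x"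
  "j < n \<Longrightarrow> coord j \<zero>\<^bsub>free_module R n\<^esub> = \<zero>\<^bsub>R\<^esub>"
  by (simp_all add: free_module_def)

lemma free_module:
  fixes R (structure) and n :: nat
  assumes "cring R" shows "module R (free_module R n :: ('a, ('a, 'm) univ) module)"
proof -
  interpret R: cring R by fact
  let ?F = "free_module R n :: ('a, ('a, 'm) univ) module"
  have ops: "\<zero>\<^bsub>?F\<^esub> = free_vec n (\<lambda>j. \<zero>)"
    "\<And>x y. x \<oplus>\<^bsub>?F\<^esub> y = free_vec n (\<lambda>j. coord j x \<oplus> coord j y)"
    "\<And>r x. r \<odot>\<^bsub>?F\<^esub> x = free_vec n (\<lambda>j. r \<otimes> coord j x)" by (simp_all add: free_module_def)
  have z: "\<zero>\<^bsub>?F\<^esub> \<in> carrier ?F" unfolding ops by (rule free_vec_carrier) auto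
  have a: "x \<oplus>\<^bsub>?F\<^esub> y \<in> carrier ?F" if "x \<in> carrier ?F" "y \<in> carrier ?F" for x y
    unfolding ops using coord_closed[OF that(1)] coord_closed[OF that(2)]
    by (intro free_vec_carrier) auto
  have m: "r \<odot>\<^bsub>?F\<^esub> x \<in> carrier ?F" if "r \<in> carrier R" "x \<in> carrier ?F" for r x
    unfolding ops using that(1) coord_closed[OF that(2)] by (intro free_vec_carrier) auto
  note eq = free_module_eqI[of _ R n]
  show ?thesis
  proof (rule moduleI, rule assms, rule abelian_groupI)
    fix x assume x: "x \<in> carrier ?F"
    let ?y = "free_vec n (\<lambda>j. \<ominus> coord j x) :: ('a, 'm) univ"
    have y: "?y \<in> carrier ?F" using coord_closed[OF x] by (intro free_vec_carrier) auto
    have "?y \<oplus>\<^bsub>?F\<^esub> x = \<zero>\<^bsub>?F\<^esub>"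
      by (rule eq) (use x y z a coord_closed[OF x] in \<open>auto simp: coord_ops R.l_neg\<close>)
    with y show "\<exists>y\<in>carrier ?F. y \<oplus>\<^bsub>?F\<^esub> x = \<zero>\<^bsub>?F\<^esub>" by blast
  next
    fix x y assume "x \<in> carrier ?F" "y \<in> carrier ?F"
    then show "x \<oplus>\<^bsub>?F\<^esub> y = y \<oplus>\<^bsub>?F\<^esub> x"
      by (intro eq a) (simp_all add: coord_ops coord_closed R.a_comm)
  next
    fix x y v assume "x \<in> carrier ?F" "y \<in> carrier ?F" "v \<in> carrier ?F"
    then show "x \<oplus>\<^bsub>?F\<^esub> y \<oplus>\<^bsub>?F\<^esub> v = x \<oplus>\<^bsub>?F\<^esub> (y \<oplus>\<^bsub>?F\<^esub> v)"
      by (intro eq a) (simp_all add: coord_ops coord_closed R.a_assoc)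
  next
    fix x assume "x \<in> carrier ?F"
    then show "\<zero>\<^bsub>?F\<^esub> \<oplus>\<^bsub>?F\<^esub> x = x" "\<one> \<odot>\<^bsub>?F\<^esub> x = x"
      by (intro eq a m z; simp add: coord_ops coord_closed)+
  next
    fix r s x assume "r \<in> carrier R" "s \<in> carrier R" "x \<in> carrier ?F"
    then show "(r \<oplus> s) \<odot>\<^bsub>?F\<^esub> x = r \<odot>\<^bsub>?F\<^esub> x \<oplus>\<^bsub>?F\<^esub> s \<odot>\<^bsub>?F\<^esub> x"
      "(r \<otimes> s) \<odot>\<^bsub>?F\<^esub> x = r \<odot>\<^bsub>?F\<^esub> (s \<odot>\<^bsub>?F\<^esub> x)"
      by (intro eq a m; simp add: coord_ops coord_closed R.l_distr R.m_assoc)+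
  next
    fix r x y assume "r \<in> carrier R" "x \<in> carrier ?F" "y \<in> carrier ?F"
    then show "r \<odot>\<^bsub>?F\<^esub> (x \<oplus>\<^bsub>?F\<^esub> y) = r \<odot>\<^bsub>?F\<^esub> x \<oplus>\<^bsub>?F\<^esub> r \<odot>\<^bsub>?F\<^esub> y"
      by (intro eq a m; simp add: coord_ops coord_closed R.r_distr)
  qed (fact z a m)+
qed

lemma unit_vec_carrier:
  fixes R (structure)
  shows "cring R \<Longrightarrow> unit_vec R n j \<in> carrier (free_module R n)"
proof -
  assume "cring R"
  then interpret cring R .
  show ?thesis by (auto simp: unit_vec_def intro!: free_vec_carrier)
qed

lemma coord_hom: "i < n \<Longrightarrow> coord i \<in> module_hom R (free_module R n) (regular_module R)"
  by (intro module_homI) (auto simp: coord_ops coord_closed)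

lemma free_module_expand:
  fixes R (structure) and x :: "('a, 'm) univ"
  assumes "cring R" "x \<in> carrier (free_module R n)"
  shows "x = (\<Oplus>\<^bsub>free_module R n\<^esub>j\<in>{..<n}. coord j x \<odot>\<^bsub>free_module R n\<^esub> unit_vec R n j)"
proof -
  interpret cring R by fact
  let ?F = "free_module R n :: ('a, ('a, 'm) univ) module"
  interpret F: module R ?F by (rule free_module[OF assms(1)])
  have cl: "\<And>j. j < n \<Longrightarrow> coord j x \<odot>\<^bsub>?F\<^esub> unit_vec R n j \<in> carrier ?F"
    using coord_closed[OF assms(2)] by (simp add: unit_vec_carrier[OF assms(1)])
  show ?thesis
  proof (rule free_module_eqI[OF assms(2)])
    show "(\<Oplus>\<^bsub>?F\<^esub>j\<in>{..<n}. coord j x \<odot>\<^bsub>?F\<^esub> unit_vec R n j) \<in> carrier ?F"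
      by (rule F.finsum_closed) (use cl in auto)
    fix i assume i: "i < n"
    have "coord i (\<Oplus>\<^bsub>?F\<^esub>j\<in>{..<n}. coord j x \<odot>\<^bsub>?F\<^esub> unit_vec R n j) =
       (\<Oplus>\<^bsub>regular_module R\<^esub>j\<in>{..<n}. coord i (coord j x \<odot>\<^bsub>?F\<^esub> unit_vec R n j))"
      by (rule hom_finsum[OF F.module_axioms regular_module[OF assms(1)] coord_hom[OF i] cl])
    also have "\<dots> = (\<Oplus>\<^bsub>regular_module R\<^esub>j\<in>{..<n}. if i = j then coord j x else \<zero>\<^bsub>regular_module R\<^esub>)"
      using coord_closed[OF assms(2)] i
      by (intro abelian_monoid.finsum_cong' abelian_group.axioms(1)
          module_abelian_group[OF regular_module[OF assms(1)]])
        (auto simp: coord_ops unit_vec_def)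
    also have "\<dots> = coord i x"
      using coord_closed[OF assms(2)] i
      by (intro abelian_monoid.finsum_singleton abelian_group.axioms(1)
          module_abelian_group[OF regular_module[OF assms(1)]]) auto
    finally show "coord i x = coord i (\<Oplus>\<^bsub>?F\<^esub>j\<in>{..<n}. coord j x \<odot>\<^bsub>?F\<^esub> unit_vec R n j)" by simp
  qed
qed

lemma finite_projective_free:
  assumes "cring R" shows "finite_projective R (free_module R n)"
  unfolding finite_projective_def
  by (intro conjI exI[of _ n] exI[of _ "unit_vec R n"] exI[of _ coord] allI ballI impI
    free_module[OF assms]
      unit_vec_carrier[OF assms] coord_hom free_module_expand[OF assms])

lemma free_module_hom_exists:
  fixes R (structure)
  assumes R: "cring R" and N: "module R N" and b: "\<And>j. j < n \<Longrightarrow> b j \<in> carrier N"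
  shows "\<exists>f \<in> module_hom R (free_module R n) N. \<forall>j<n. f (unit_vec R n j) = b j"
proof (rule bexI, intro allI impI)
  interpret cring R by fact
  interpret N: module R N by fact
  let ?f = "\<lambda>x. \<Oplus>\<^bsub>N\<^esub>j\<in>{..<n}. coord j x \<odot>\<^bsub>N\<^esub> b j"
  show "?f \<in> module_hom R (free_module R n) N"
    by (rule module_hom_lincomb[OF free_module[OF R] N coord_hom b])
  fix i assume i: "i < n"
  have "?f (unit_vec R n i) = (\<Oplus>\<^bsub>N\<^esub>j\<in>{..<n}. if i = j then b j else \<zero>\<^bsub>N\<^esub>)"
    by (rule N.finsum_cong') (use b in \<open>auto simp: unit_vec_def\<close>)
  also have "\<dots> = b i" by (rule N.finsum_singleton) (use b i in auto)
  finally show "?f (unit_vec R n i) = b i" .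
qed

lemma submodule_carrier: "module R M \<Longrightarrow> submodule (carrier M) R M"
proof -
  assume "module R M"
  then interpret module R M .
  show ?thesis by (rule submoduleI) auto
qed

lemma lincomb_in_linear_span:
  assumes M: "module R M" and b: "\<And>j. j < n \<Longrightarrow> b j \<in> carrier M" and c: "\<And>j. j < n \<Longrightarrow> c j \<in> carrier R"
  shows "(\<Oplus>\<^bsub>M\<^esub>j\<in>{..<n::nat}. c j \<odot>\<^bsub>M\<^esub> b j) \<in> linear_span R M (b ` {..<n})"
  using b c
proof (induction n)
  case 0
  interpret M: module R M by fact
  show ?case by (simp add: linear_span.zero)
next
  case (Suc n)
  interpret M: module R M by fact
  have cl: "\<And>j. j < Suc n \<Longrightarrow> c j \<odot>\<^bsub>M\<^esub> b j \<in> carrier M" using Suc.prems by simp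
  have "(\<Oplus>\<^bsub>M\<^esub>j\<in>{..<Suc n}. c j \<odot>\<^bsub>M\<^esub> b j) = c n \<odot>\<^bsub>M\<^esub> b n \<oplus>\<^bsub>M\<^esub> (\<Oplus>\<^bsub>M\<^esub>j\<in>{..<n}. c j \<odot>\<^bsub>M\<^esub> b j)"
    unfolding lessThan_Suc by (subst M.finsum_insert) (use cl in auto)
  moreover have "(\<Oplus>\<^bsub>M\<^esub>j\<in>{..<n}. c j \<odot>\<^bsub>M\<^esub> b j) \<in> linear_span R M (b ` {..<Suc n})"
    by (rule linear_span_mono[of "b ` {..<n}"]) (use Suc in auto)
  ultimately show ?case using Suc.prems(2)[of n] by (auto intro: linear_span.step)
qed

lemma free_module_linear_span:
  assumes R: "cring R" and x: "x \<in> carrier (free_module R n)"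
  shows "x \<in> linear_span R (free_module R n) (unit_vec R n ` {..<n})"
  by (rule back_subst[where P="\<lambda>z. z \<in> _", OF lincomb_in_linear_span
    free_module_expand[OF assms, symmetric]])
    (auto intro: free_module unit_vec_carrier coord_closed assms)

lemma finite_projective_noetherian:
  assumes R: "cring R" and noeth: "noetherian_ring R" and fp: "finite_projective R P"
      and K: "submodule K R P"
  shows "\<exists>A\<subseteq>K. finite A \<and> K \<subseteq> linear_span R P A"
proof -
  have P: "module R P" using fp by (rule finite_projective_module)
  obtain n b \<phi> where b: "\<And>j. j < n \<Longrightarrow> b j \<in> carrier P"
    and \<phi>: "\<And>j. j < n \<Longrightarrow> \<phi> j \<in> module_hom R P (regular_module R)"
    and ex: "\<And>x. x \<in> carrier P \<Longrightarrow> (\<Oplus>\<^bsub>P\<^esub>j\<in>{..<n::nat}. \<phi> j x \<odot>\<^bsub>P\<^esub> b j) = x"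
    using fp unfolding finite_projective_def by metis
  have span: "x \<in> linear_span R P (b ` {..<n})" if x: "x \<in> carrier P" for x
  proof -
    have "(\<Oplus>\<^bsub>P\<^esub>j\<in>{..<n}. \<phi> j x \<odot>\<^bsub>P\<^esub> b j) \<in> linear_span R P (b ` {..<n})"
      by (rule lincomb_in_linear_span[OF P]) (use b hom_closed[OF \<phi> x] in auto)
    then show ?thesis unfolding ex[OF x] .
  qed
  show ?thesis
  proof (rule noetherian_submodule[OF R noeth P _ _ K])
    show "K \<subseteq> linear_span R P (b ` {..<n})" using span submoduleD(1)[OF P K] by blast
  qed (use b in auto)
qed

section \<open>Homology and quasiisomorphisms\<close>

lemma additive_zero_minus:
  assumes "abelian_group G" "abelian_group H" "\<And>x. x \<in> carrier G \<Longrightarrow> f x \<in> carrier H"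
    "\<And>x y. x \<in> carrier G \<Longrightarrow> y \<in> carrier G \<Longrightarrow> f (x \<oplus>\<^bsub>G\<^esub> y) = f x \<oplus>\<^bsub>H\<^esub> f y"
  shows "f \<zero>\<^bsub>G\<^esub> = \<zero>\<^bsub>H\<^esub>"
    and "x \<in> carrier G \<Longrightarrow> y \<in> carrier G \<Longrightarrow> f (x \<ominus>\<^bsub>G\<^esub> y) = f x \<ominus>\<^bsub>H\<^esub> f y"
proof -
  interpret abelian_group_hom G H f
    by (rule abelian_group_homI) (use assms in \<open>auto intro!: group_hom.intro group_hom_axioms.intro
      abelian_group.a_group simp: hom_def\<close>)
  show "f \<zero>\<^bsub>G\<^esub> = \<zero>\<^bsub>H\<^esub>" by (rule hom_zero)
  show "x \<in> carrier G \<Longrightarrow> y \<in> carrier G \<Longrightarrow> f (x \<ominus>\<^bsub>G\<^esub> y) = f x \<ominus>\<^bsub>H\<^esub> f y"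
    by (simp add: a_minus_def)
qed

text \<open>
  The description of homology by cycles and boundaries rests on the additive structure.  In this
  generality it covers Hom complexes as soon as they are known to be complexes of abelian groups.
\<close>

definition additive_complex :: "('a, 'm) cpx \<Rightarrow> bool" where
  "additive_complex C \<longleftrightarrow> (\<forall>i. abelian_group (obj C i) \<and>
     (\<forall>x \<in> carrier (obj C i). diff C i x \<in> carrier (obj C (i - 1))) \<and>
     (\<forall>x \<in> carrier (obj C i). \<forall>y \<in> carrier (obj C i).
        diff C i (x \<oplus>\<^bsub>obj C i\<^esub> y) = diff C i x \<oplus>\<^bsub>obj C (i - 1)\<^esub> diff C i y) \<and>
     (\<forall>x \<in> carrier (obj C i). diff C (i - 1) (diff C i x) = \<zero>\<^bsub>obj C (i - 2)\<^esub>))"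

lemma is_complexD:
  assumes "is_complex R C"
  shows "module R (obj C i)" "diff C i \<in> module_hom R (obj C i) (obj C (i - 1))"
    "x \<in> carrier (obj C i) \<Longrightarrow> diff C (i - 1) (diff C i x) = \<zero>\<^bsub>obj C (i - 2)\<^esub>"
    "x \<in> carrier (obj C i) \<Longrightarrow> diff C i x \<in> carrier (obj C (i - 1))"
    "abelian_group (obj C i)"
  using assms unfolding is_complex_def by (blast intro: hom_closed module_abelian_group)+

lemma diff_diff:
  assumes "is_complex R C" "x \<in> carrier (obj C (i + 1))"
  shows "diff C i (diff C (i + 1) x) = \<zero>\<^bsub>obj C (i - 1)\<^esub>" "diff C (i + 1) x \<in> carrier (obj C i)"
  using is_complexD(3,4)[OF assms] by simp_all

lemma diff_hom: "is_complex R C \<Longrightarrow> diff C (i + 1) \<in> module_hom R (obj C (i + 1)) (obj C i)"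
  using is_complexD(2)[of R C "i + 1"] by simp

lemma is_complex_additive: "is_complex R C \<Longrightarrow> additive_complex C"
  unfolding additive_complex_def using is_complexD(2-5)[of R C]
  by (auto intro: hom_add)

context
  fixes C :: "('a, 'm) cpx" and i :: int
  assumes C: "additive_complex C"
begin

lemma boundaries_subset_cycles: "boundaries C i \<subseteq> cycles C i"
proof
  fix x assume "x \<in> boundaries C i"
  then obtain y where y: "y \<in> carrier (obj C (i + 1))" "x = diff C (i + 1) y"
    by (auto simp: boundaries_def)
  have "diff C (i + 1) y \<in> carrier (obj C (i + 1 - 1))"
    "diff C (i + 1 - 1) (diff C (i + 1) y) = \<zero>\<^bsub>obj C (i + 1 - 2)\<^esub>"
    using C y(1) unfolding additive_complex_def by blast+
  then show "x \<in> cycles C i" using y(2) by (simp add: cycles_def)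
qed

lemma cycles_carrier: "x \<in> cycles C i \<Longrightarrow> x \<in> carrier (obj C i)"
  by (simp add: cycles_def)

lemma boundaries_carrier: "x \<in> boundaries C i \<Longrightarrow> x \<in> carrier (obj C i)"
  using boundaries_subset_cycles cycles_carrier by blast

lemma obj_abelian_group: "abelian_group (obj C i)"
  using C by (simp add: additive_complex_def)

lemma boundaries_zero: "\<zero>\<^bsub>obj C i\<^esub> \<in> boundaries C i"
  and boundaries_minus: "x \<in> boundaries C i \<Longrightarrow> y \<in> boundaries C i \<Longrightarrow> x \<ominus>\<^bsub>obj C i\<^esub> y \<in> boundaries C i"
  and boundaries_add: "x \<in> boundaries C i \<Longrightarrow> y \<in> boundaries C i \<Longrightarrow> x \<oplus>\<^bsub>obj C i\<^esub> y \<in> boundaries C i"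
  and cycles_zero: "\<zero>\<^bsub>obj C i\<^esub> \<in> cycles C i"
  and cycles_minus: "x \<in> cycles C i \<Longrightarrow> y \<in> cycles C i \<Longrightarrow> x \<ominus>\<^bsub>obj C i\<^esub> y \<in> cycles C i"
  and cycles_add: "x \<in> cycles C i \<Longrightarrow> y \<in> cycles C i \<Longrightarrow> x \<oplus>\<^bsub>obj C i\<^esub> y \<in> cycles C i"
proof -
  have ag: "abelian_group (obj C j)" for j using C by (simp add: additive_complex_def)
  interpret A: abelian_group "obj C (i + 1)" by (rule ag)
  interpret B: abelian_group "obj C i" by (rule ag)
  interpret D: abelian_group "obj C (i - 1)" by (rule ag)
  have cl: "diff C (i + 1) u \<in> carrier (obj C i)" if "u \<in> carrier (obj C (i + 1))" for u
  proof -
    have "diff C (i + 1) u \<in> carrier (obj C (i + 1 - 1))"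
      using C that unfolding additive_complex_def by blast
    then show ?thesis by simp
  qed
  have ad: "diff C (i + 1) (u \<oplus>\<^bsub>obj C (i + 1)\<^esub> v) = diff C (i + 1) u \<oplus>\<^bsub>obj C i\<^esub> diff C (i + 1) v"
    if "u \<in> carrier (obj C (i + 1))" "v \<in> carrier (obj C (i + 1))" for u v
  proof -
    have "diff C (i + 1) (u \<oplus>\<^bsub>obj C (i + 1)\<^esub> v) =
        diff C (i + 1) u \<oplus>\<^bsub>obj C (i + 1 - 1)\<^esub> diff C (i + 1) v"
      using C that unfolding additive_complex_def by blast
    then show ?thesis by simp
  qed
  note m = additive_zero_minus[OF ag ag, of "i + 1" "diff C (i + 1)" i, OF cl ad]
  show bz: "\<zero>\<^bsub>obj C i\<^esub> \<in> boundaries C i"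
    using m(1) A.zero_closed unfolding boundaries_def by (metis imageI)
  show "x \<in> boundaries C i \<Longrightarrow> y \<in> boundaries C i \<Longrightarrow> x \<ominus>\<^bsub>obj C i\<^esub> y \<in> boundaries C i"
    unfolding boundaries_def using m(2)[symmetric] by auto
  show "x \<in> boundaries C i \<Longrightarrow> y \<in> boundaries C i \<Longrightarrow> x \<oplus>\<^bsub>obj C i\<^esub> y \<in> boundaries C i"
    unfolding boundaries_def using ad[symmetric] by auto
  show "\<zero>\<^bsub>obj C i\<^esub> \<in> cycles C i" using bz boundaries_subset_cycles by auto
  have cl': "diff C i u \<in> carrier (obj C (i - 1))" if "u \<in> carrier (obj C i)" for u
    using C that unfolding additive_complex_def by blast
  have ad': "diff C i (u \<oplus>\<^bsub>obj C i\<^esub> v) = diff C i u \<oplus>\<^bsub>obj C (i - 1)\<^esub> diff C i v"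
    if "u \<in> carrier (obj C i)" "v \<in> carrier (obj C i)" for u v
    using C that unfolding additive_complex_def by blast
  note m' = additive_zero_minus[OF ag ag, of i "diff C i" "i - 1", OF cl' ad']
  show "x \<in> cycles C i \<Longrightarrow> y \<in> cycles C i \<Longrightarrow> x \<ominus>\<^bsub>obj C i\<^esub> y \<in> cycles C i"
    by (simp add: cycles_def m' D.r_neg a_minus_def[of "obj C (i - 1)"])
  show "x \<in> cycles C i \<Longrightarrow> y \<in> cycles C i \<Longrightarrow> x \<oplus>\<^bsub>obj C i\<^esub> y \<in> cycles C i"
    by (simp add: cycles_def ad')
qed

end

definition homology_class :: "('a, 'm) cpx \<Rightarrow> int \<Rightarrow> 'm \<Rightarrow> 'm set" where
  "homology_class C i x = (\<lambda>b. b \<oplus>\<^bsub>obj C i\<^esub> x) ` boundaries C i"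

lemma a_r_coset_homology_class: "boundaries C i +>\<^bsub>(obj C i)\<lparr>carrier := Z\<rparr>\<^esub> x = homology_class C i x"
  by (auto simp: a_r_coset_def r_coset_def homology_class_def)

lemma homology_carrier: "carrier (homology C i) = homology_class C i ` cycles C i"
  by (auto simp: homology_def quotient_module_def a_r_coset_homology_class)

lemma homology_class_eq_iff:
  assumes C: "additive_complex C" and xy: "x \<in> carrier (obj C i)" "y \<in> carrier (obj C i)"
  shows "homology_class C i x = homology_class C i y \<longleftrightarrow> x \<ominus>\<^bsub>obj C i\<^esub> y \<in> boundaries C i"
proof -
  interpret A: abelian_group "obj C i" by (rule obj_abelian_group[OF C])
  note bc = boundaries_carrier[OF C]
  have sub: "homology_class C i x \<subseteq> homology_class C i y"
    if xy: "x \<in> carrier (obj C i)" "y \<in> carrier (obj C i)" and b: "x \<ominus>\<^bsub>obj C i\<^esub> y \<in> boundaries C i"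
      for x y
  proof (clarsimp simp: homology_class_def)
    fix c assume c: "c \<in> boundaries C i"
    have "c \<oplus>\<^bsub>obj C i\<^esub> x = (c \<oplus>\<^bsub>obj C i\<^esub> (x \<ominus>\<^bsub>obj C i\<^esub> y)) \<oplus>\<^bsub>obj C i\<^esub> y"
      using xy bc[OF c] by (simp add: A.ag_normalize)
    moreover have "c \<oplus>\<^bsub>obj C i\<^esub> (x \<ominus>\<^bsub>obj C i\<^esub> y) \<in> boundaries C i" by (rule boundaries_add[OF C c b])
    ultimately show "c \<oplus>\<^bsub>obj C i\<^esub> x \<in> (\<lambda>b. b \<oplus>\<^bsub>obj C i\<^esub> y) ` boundaries C i" by blast
  qed
  show ?thesis
  proof
    assume "homology_class C i x = homology_class C i y"
    moreover have "x \<in> homology_class C i x"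
      using boundaries_zero[OF C, of i] xy unfolding homology_class_def
        by (auto intro!: image_eqI[of _ _ "\<zero>\<^bsub>obj C i\<^esub>"])
    ultimately obtain b where b: "b \<in> boundaries C i" "x = b \<oplus>\<^bsub>obj C i\<^esub> y"
      by (auto simp: homology_class_def)
    then have "x \<ominus>\<^bsub>obj C i\<^esub> y = b" using xy bc[OF b(1)] by (simp add: A.ag_normalize)
    with b show "x \<ominus>\<^bsub>obj C i\<^esub> y \<in> boundaries C i" by simp
  next
    assume b: "x \<ominus>\<^bsub>obj C i\<^esub> y \<in> boundaries C i"
    have "\<zero>\<^bsub>obj C i\<^esub> \<ominus>\<^bsub>obj C i\<^esub> (x \<ominus>\<^bsub>obj C i\<^esub> y) \<in> boundaries C i"
      by (rule boundaries_minus[OF C boundaries_zero[OF C] b])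
    then have "y \<ominus>\<^bsub>obj C i\<^esub> x \<in> boundaries C i" using xy by (simp add: A.ag_normalize)
    with sub b xy show "homology_class C i x = homology_class C i y" by blast
  qed
qed

lemma homology_class_zero:
  assumes C: "additive_complex C" shows "homology_class C i \<zero>\<^bsub>obj C i\<^esub> = boundaries C i"
proof -
  interpret A: abelian_group "obj C i" by (rule obj_abelian_group[OF C])
  show ?thesis using boundaries_carrier[OF C, of _ i] by (auto simp: homology_class_def image_iff)
qed

lemma zero_module_homology:
  assumes C: "additive_complex C"
  shows "zero_module (homology C i) \<longleftrightarrow> cycles C i \<subseteq> boundaries C i"
proof -
  interpret A: abelian_group "obj C i" by (rule obj_abelian_group[OF C])
  have "zero (homology C i) = boundaries C i" by (simp add: homology_def quotient_module_def)
  then have "zero_module (homology C i) \<longleftrightarrow>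
      homology_class C i ` cycles C i = {homology_class C i \<zero>\<^bsub>obj C i\<^esub>}"
    by (simp add: zero_module_def homology_carrier homology_class_zero[OF C])
  also have "\<dots> \<longleftrightarrow> (\<forall>x\<in>cycles C i. homology_class C i x = homology_class C i \<zero>\<^bsub>obj C i\<^esub>)"
    using cycles_zero[OF C, of i] by blast
  also have "\<dots> \<longleftrightarrow> (\<forall>x\<in>cycles C i. x \<in> boundaries C i)"
    by (intro ball_cong refl) (simp add: homology_class_eq_iff[OF C] cycles_carrier[OF C]
      ag_minus_zero[OF obj_abelian_group[OF C]])
  finally show ?thesis by auto
qed

lemma chain_mapD:
  assumes "chain_map R C D \<alpha>"
  shows "\<alpha> i \<in> module_hom R (obj C i) (obj D i)"
    "x \<in> carrier (obj C i) \<Longrightarrow> \<alpha> i x \<in> carrier (obj D i)"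
    "x \<in> carrier (obj C i) \<Longrightarrow> diff D i (\<alpha> i x) = \<alpha> (i - 1) (diff C i x)"
  using assms unfolding chain_map_def by (blast intro: hom_closed)+

lemma chain_map_zero_minus:
  assumes C: "additive_complex C" and D: "additive_complex D" and ch: "chain_map R C D \<alpha>"
  shows "\<alpha> i \<zero>\<^bsub>obj C i\<^esub> = \<zero>\<^bsub>obj D i\<^esub>"
    and "x \<in> carrier (obj C i) \<Longrightarrow> y \<in> carrier (obj C i) \<Longrightarrow> \<alpha> i (x \<ominus>\<^bsub>obj C i\<^esub> y) = \<alpha> i x \<ominus>\<^bsub>obj D i\<^esub> \<alpha> i y"
  using additive_zero_minus[OF obj_abelian_group[OF C, of i] obj_abelian_group[OF D, of i],
    of "\<alpha> i"] chain_mapD(2)[OF ch]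
    hom_add[OF chain_mapD(1)[OF ch]] by blast+

lemma chain_map_cycles:
  assumes C: "additive_complex C" and D: "additive_complex D" and ch: "chain_map R C D \<alpha>"
  shows "z \<in> cycles C i \<Longrightarrow> \<alpha> i z \<in> cycles D i"
  using chain_mapD(2,3)[OF ch] chain_map_zero_minus(1)[OF assms] by (auto simp: cycles_def)

lemma chain_map_boundaries:
  assumes ch: "chain_map R C D \<alpha>" and b: "b \<in> boundaries C i"
  shows "\<alpha> i b \<in> boundaries D i"
proof -
  obtain y where y: "y \<in> carrier (obj C (i + 1))" "b = diff C (i + 1) y"
    using b by (auto simp: boundaries_def)
  have "\<alpha> i b = diff D (i + 1) (\<alpha> (i + 1) y)" using chain_mapD(3)[OF ch y(1)] y(2) by simp
  then show ?thesis using chain_mapD(2)[OF ch y(1)] by (auto simp: boundaries_def)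
qed

lemma homology_map_class:
  assumes C: "additive_complex C" and D: "additive_complex D" and ch: "chain_map R C D \<alpha>"
    and z: "z \<in> carrier (obj C i)"
  shows "homology_map D \<alpha> i (homology_class C i z) = homology_class D i (\<alpha> i z)"
proof -
  interpret A: abelian_group "obj C i" by (rule obj_abelian_group[OF C])
  interpret B: abelian_group "obj D i" by (rule obj_abelian_group[OF D])
  note ad = hom_add[OF chain_mapD(1)[OF ch]]
  note cl = chain_mapD(2)[OF ch]
  have 1: "homology_map D \<alpha> i (homology_class C i z) =
      {b' \<oplus>\<^bsub>obj D i\<^esub> \<alpha> i (b \<oplus>\<^bsub>obj C i\<^esub> z) | b' b. b' \<in> boundaries D i \<and> b \<in> boundaries C i}"
    by (auto simp: homology_map_def homology_class_def set_add_def set_mult_def)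
  show ?thesis
  proof (intro equalityI subsetI)
    fix w assume "w \<in> homology_map D \<alpha> i (homology_class C i z)"
    then obtain b' b where w: "w = b' \<oplus>\<^bsub>obj D i\<^esub> \<alpha> i (b \<oplus>\<^bsub>obj C i\<^esub> z)" "b' \<in> boundaries D i"
      "b \<in> boundaries C i"
      unfolding 1 by blast
    have "w = (b' \<oplus>\<^bsub>obj D i\<^esub> \<alpha> i b) \<oplus>\<^bsub>obj D i\<^esub> \<alpha> i z"
      using w z boundaries_carrier[OF C w(3)] boundaries_carrier[OF D w(2)] cl
        by (simp add: ad B.a_assoc)
    moreover have "b' \<oplus>\<^bsub>obj D i\<^esub> \<alpha> i b \<in> boundaries D i"
      by (rule boundaries_add[OF D w(2) chain_map_boundaries[OF ch w(3)]])
    ultimately show "w \<in> homology_class D i (\<alpha> i z)" by (auto simp: homology_class_def)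
  next
    fix w assume "w \<in> homology_class D i (\<alpha> i z)"
    then obtain b' where w: "w = b' \<oplus>\<^bsub>obj D i\<^esub> \<alpha> i z" "b' \<in> boundaries D i"
      by (auto simp: homology_class_def)
    then have "w = b' \<oplus>\<^bsub>obj D i\<^esub> \<alpha> i (\<zero>\<^bsub>obj C i\<^esub> \<oplus>\<^bsub>obj C i\<^esub> z)" using z by simp
    then show "w \<in> homology_map D \<alpha> i (homology_class C i z)" unfolding 1
      using w(2) boundaries_zero[OF C] by blast
  qed
qed

text \<open>
  Since \<open>\<alpha>\<close> is additive, injectivity on homology amounts to a trivial kernel; both conditions are
  then read off from representatives.
\<close>

lemma quasi_iso_iff:
  assumes C: "additive_complex C" and D: "additive_complex D" and ch: "chain_map R C D \<alpha>"
  shows "quasi_iso R C D \<alpha> \<longleftrightarrow>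
    (\<forall>i. (\<forall>z\<in>cycles C i. \<alpha> i z \<in> boundaries D i \<longrightarrow> z \<in> boundaries C i) \<and>
         (\<forall>w\<in>cycles D i. \<exists>z\<in>cycles C i. \<alpha> i z \<ominus>\<^bsub>obj D i\<^esub> w \<in> boundaries D i))"
proof -
  note cl = chain_mapD(2)[OF ch]
  note hm = homology_map_class[OF C D ch]
  have inj: "inj_on (homology_map D \<alpha> i) (homology_class C i ` cycles C i) \<longleftrightarrow>
      (\<forall>z\<in>cycles C i. \<alpha> i z \<in> boundaries D i \<longrightarrow> z \<in> boundaries C i)" (is "?l \<longleftrightarrow> ?r") for i
  proof -
    interpret A: abelian_group "obj C i" by (rule obj_abelian_group[OF C])
    interpret B: abelian_group "obj D i" by (rule obj_abelian_group[OF D])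
    have "?l \<longleftrightarrow> (\<forall>x\<in>cycles C i. \<forall>y\<in>cycles C i.
        \<alpha> i x \<ominus>\<^bsub>obj D i\<^esub> \<alpha> i y \<in> boundaries D i \<longrightarrow> x \<ominus>\<^bsub>obj C i\<^esub> y \<in> boundaries C i)"
      unfolding inj_on_def
      by (simp add: hm cycles_carrier[OF C] homology_class_eq_iff[OF C] homology_class_eq_iff[OF D]
        cl)
    also have "\<dots> \<longleftrightarrow> (\<forall>x\<in>cycles C i. \<forall>y\<in>cycles C i.
        \<alpha> i (x \<ominus>\<^bsub>obj C i\<^esub> y) \<in> boundaries D i \<longrightarrow> x \<ominus>\<^bsub>obj C i\<^esub> y \<in> boundaries C i)"
      by (simp add: chain_map_zero_minus[OF C D ch] cycles_carrier[OF C])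
    also have "\<dots> \<longleftrightarrow> ?r"
    proof
      assume *: "\<forall>x\<in>cycles C i. \<forall>y\<in>cycles C i.
        \<alpha> i (x \<ominus>\<^bsub>obj C i\<^esub> y) \<in> boundaries D i \<longrightarrow> x \<ominus>\<^bsub>obj C i\<^esub> y \<in> boundaries C i"
      show ?r
      proof (intro ballI impI)
        fix z assume z: "z \<in> cycles C i" "\<alpha> i z \<in> boundaries D i"
        then show "z \<in> boundaries C i"
          using *[rule_format, OF z(1) cycles_zero[OF C]] cycles_carrier[OF C z(1)]
          by (simp add: ag_minus_zero[OF obj_abelian_group[OF C]])
      qed
    qed (use cycles_minus[OF C] in blast)
    finally show ?thesis .
  qed
  have into: "homology_map D \<alpha> i ` (homology_class C i ` cycles C i) \<subseteq>
      homology_class D i ` cycles D i" for i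
    using chain_map_cycles[OF C D ch] cycles_carrier[OF C] by (auto simp: hm)
  have surj: "homology_class D i ` cycles D i \<subseteq>
      homology_map D \<alpha> i ` (homology_class C i ` cycles C i) \<longleftrightarrow>
      (\<forall>w\<in>cycles D i. \<exists>z\<in>cycles C i. \<alpha> i z \<ominus>\<^bsub>obj D i\<^esub> w \<in> boundaries D i)" for i
  proof -
    have "homology_class D i ` cycles D i \<subseteq> homology_map D \<alpha> i ` (homology_class C i ` cycles C i) \<longleftrightarrow>
      (\<forall>w\<in>cycles D i. \<exists>z\<in>cycles C i. homology_class D i (\<alpha> i z) = homology_class D i w)"
      by (simp add: image_subset_iff image_iff hm cycles_carrier[OF C] eq_commute cong: bex_cong)
    then show ?thesis
      by (simp add: homology_class_eq_iff[OF D] cl cycles_carrier[OF C] cycles_carrier[OF D]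
        cong: bex_cong)
  qed
  show ?thesis
    unfolding quasi_iso_def bij_betw_def homology_carrier inj
    using ch into surj by (simp add: set_eq_subset)
qed

lemma quasi_isoD:
  assumes C: "is_complex R C" and D: "is_complex R D" and q: "quasi_iso R C D \<alpha>"
  shows "chain_map R C D \<alpha>"
    "z \<in> cycles C i \<Longrightarrow> \<alpha> i z \<in> boundaries D i \<Longrightarrow> z \<in> boundaries C i"
    "w \<in> cycles D i \<Longrightarrow> \<exists>z\<in>cycles C i. \<alpha> i z \<ominus>\<^bsub>obj D i\<^esub> w \<in> boundaries D i"
proof -
  show ch: "chain_map R C D \<alpha>" using q by (simp add: quasi_iso_def)
  note * = q[unfolded quasi_iso_iff[OF is_complex_additive[OF C] is_complex_additive[OF D] ch]]
  show "z \<in> cycles C i \<Longrightarrow> \<alpha> i z \<in> boundaries D i \<Longrightarrow> z \<in> boundaries C i"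
    "w \<in> cycles D i \<Longrightarrow> \<exists>z\<in>cycles C i. \<alpha> i z \<ominus>\<^bsub>obj D i\<^esub> w \<in> boundaries D i"
    using * by blast+
qed

lemma quasi_isoI:
  assumes C: "is_complex R C" and D: "is_complex R D" and ch: "chain_map R C D \<alpha>"
    and "\<And>i z. z \<in> cycles C i \<Longrightarrow> \<alpha> i z \<in> boundaries D i \<Longrightarrow> z \<in> boundaries C i"
    and "\<And>i w. w \<in> cycles D i \<Longrightarrow> \<exists>z\<in>cycles C i. \<alpha> i z \<ominus>\<^bsub>obj D i\<^esub> w \<in> boundaries D i"
  shows "quasi_iso R C D \<alpha>"
  using assms(4,5) quasi_iso_iff[OF is_complex_additive[OF C] is_complex_additive[OF D] ch] by blast

lemma chain_map_comp:
  assumes f: "chain_map R X Y f" and g: "chain_map R Y Z g"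
  shows "chain_map R X Z (\<lambda>i x. g i (f i x))"
  unfolding chain_map_def
  using chain_mapD(2,3)[OF f] chain_mapD(2,3)[OF g]
  by (auto intro: module_hom_comp[OF chain_mapD(1)[OF f] chain_mapD(1)[OF g]])

lemma quasi_iso_comp:
  assumes X: "is_complex R X" and Y: "is_complex R Y" and Z: "is_complex R Z"
    and f: "quasi_iso R X Y f" and g: "quasi_iso R Y Z g"
  shows "quasi_iso R X Z (\<lambda>i x. g i (f i x))"
proof (rule quasi_isoI[OF X Z chain_map_comp[OF quasi_isoD(1)[OF X Y f] quasi_isoD(1)[OF Y Z g]]])
  note aX = is_complex_additive[OF X] and aY = is_complex_additive[OF Y]
    and aZ = is_complex_additive[OF Z]
  note F = quasi_isoD[OF X Y f] and G = quasi_isoD[OF Y Z g]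
  show "z \<in> boundaries X i" if "z \<in> cycles X i" "g i (f i z) \<in> boundaries Z i" for i z
    using F(2) G(2) chain_map_cycles[OF aX aY F(1)] that by blast
  fix i w assume w: "w \<in> cycles Z i"
  then obtain y where y: "y \<in> cycles Y i" "g i y \<ominus>\<^bsub>obj Z i\<^esub> w \<in> boundaries Z i" using G(3) by blast
  obtain x where x: "x \<in> cycles X i" "f i x \<ominus>\<^bsub>obj Y i\<^esub> y \<in> boundaries Y i" using F(3) y by blast
  interpret Z: abelian_group "obj Z i" by (rule is_complexD(5)[OF Z])
  have c: "f i x \<in> carrier (obj Y i)" "y \<in> carrier (obj Y i)" "w \<in> carrier (obj Z i)"
    using chain_mapD(2)[OF F(1)] cycles_carrier[OF aX x(1)] cycles_carrier[OF aY y(1)]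
      cycles_carrier[OF aZ w] by auto
  have "g i (f i x) \<ominus>\<^bsub>obj Z i\<^esub> w = g i (f i x \<ominus>\<^bsub>obj Y i\<^esub> y) \<oplus>\<^bsub>obj Z i\<^esub> (g i y \<ominus>\<^bsub>obj Z i\<^esub> w)"
    using c chain_mapD(2)[OF G(1)] by (simp add: chain_map_zero_minus[OF aY aZ G(1)] Z.ag_normalize)
  moreover have "g i (f i x \<ominus>\<^bsub>obj Y i\<^esub> y) \<oplus>\<^bsub>obj Z i\<^esub> (g i y \<ominus>\<^bsub>obj Z i\<^esub> w) \<in> boundaries Z i"
    by (rule boundaries_add[OF aZ chain_map_boundaries[OF G(1) x(2)] y(2)])
  ultimately show "\<exists>z\<in>cycles X i. g i (f i z) \<ominus>\<^bsub>obj Z i\<^esub> w \<in> boundaries Z i"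
    using x(1) by (auto intro!: bexI[of _ x])
qed

lemma zero_moduleD: "zero_module M \<Longrightarrow> x \<in> carrier M \<Longrightarrow> x = \<zero>\<^bsub>M\<^esub>"
  by (auto simp: zero_module_def)

lemma quasi_iso_acyclic_iff:
  assumes C: "is_complex R C" and D: "is_complex R D" and q: "quasi_iso R C D \<alpha>"
  shows "cycles C i \<subseteq> boundaries C i \<longleftrightarrow> cycles D i \<subseteq> boundaries D i"
proof
  note aC = is_complex_additive[OF C] and aD = is_complex_additive[OF D]
    and Q = quasi_isoD[OF C D q]
  show "cycles C i \<subseteq> boundaries C i" if "cycles D i \<subseteq> boundaries D i"
    using Q(2) chain_map_cycles[OF aC aD Q(1)] that by blast
  show "cycles D i \<subseteq> boundaries D i" if ac: "cycles C i \<subseteq> boundaries C i"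
  proof
    fix w assume w: "w \<in> cycles D i"
    then obtain z where z: "z \<in> cycles C i" "\<alpha> i z \<ominus>\<^bsub>obj D i\<^esub> w \<in> boundaries D i" using Q(3) by blast
    have b: "\<alpha> i z \<in> boundaries D i" using chain_map_boundaries[OF Q(1)] z ac by blast
    interpret A: abelian_group "obj D i" by (rule obj_abelian_group[OF aD])
    have "\<alpha> i z \<ominus>\<^bsub>obj D i\<^esub> (\<alpha> i z \<ominus>\<^bsub>obj D i\<^esub> w) \<in> boundaries D i"
      by (rule boundaries_minus[OF aD b z(2)])
    then show "w \<in> boundaries D i"
      using boundaries_carrier[OF aD b] cycles_carrier[OF aD w] by (simp add: A.ag_normalize)
  qed
qed

text \<open>
  The roof of quasiisomorphisms carries the vanishing of homology from the bounded complex to \<open>M\<close>.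
\<close>

lemma in_Dbf_bounded:
  assumes M: "in_Dbf R (M :: ('a, 'm) cpx)"
  shows "\<exists>a b. \<forall>i. i < a \<or> b < i \<longrightarrow> cycles M i \<subseteq> boundaries M i"
proof -
  obtain N :: "('a, ('a, 'm) univ) cpx" where N: "is_complex R N" "bounded_complex N"
    "derived_iso R M N"
    using M unfolding in_Dbf_def by blast
  obtain X :: "('a, ('a, 'm + ('a, 'm) univ) univ) cpx" and \<alpha> \<beta>
    where X: "is_complex R X" "quasi_iso R X M \<alpha>" "quasi_iso R X N \<beta>"
    using N(3) unfolding derived_iso_def by blast
  obtain a b where ab: "\<And>i. i < a \<or> b < i \<Longrightarrow> zero_module (obj N i)"
    using N(2) unfolding bounded_complex_def by blast
  have MC: "is_complex R M" using M by (simp add: in_Dbf_def)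
  have "cycles M i \<subseteq> boundaries M i" if "i < a \<or> b < i" for i
  proof -
    have "cycles N i \<subseteq> boundaries N i"
      using zero_moduleD[OF ab[OF that]] boundaries_zero[OF is_complex_additive[OF N(1)], of i]
        by (auto simp: cycles_def)
    then show ?thesis
      using quasi_iso_acyclic_iff[OF X(1) N(1) X(3)] quasi_iso_acyclic_iff[OF X(1) MC X(2)] by blast
  qed
  then show ?thesis by blast
qed

lemma homology_class_add:
  assumes C: "additive_complex C" and x: "x \<in> carrier (obj C i)" and y: "y \<in> carrier (obj C i)"
  shows "homology_class C i x <+>\<^bsub>obj C i\<^esub> homology_class C i y = homology_class C i (x \<oplus>\<^bsub>obj C i\<^esub> y)"
proof -
  interpret A: abelian_group "obj C i" by (rule obj_abelian_group[OF C])
  note bc = boundaries_carrier[OF C, of _ i]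
  have 1: "homology_class C i x <+>\<^bsub>obj C i\<^esub> homology_class C i y =
      {(b \<oplus>\<^bsub>obj C i\<^esub> x) \<oplus>\<^bsub>obj C i\<^esub> (b' \<oplus>\<^bsub>obj C i\<^esub> y) | b b'. b \<in> boundaries C i \<and> b' \<in> boundaries C i}"
    by (auto simp: homology_class_def set_add_def set_mult_def)
  have 2: "(b \<oplus>\<^bsub>obj C i\<^esub> x) \<oplus>\<^bsub>obj C i\<^esub> (b' \<oplus>\<^bsub>obj C i\<^esub> y) =
      (b \<oplus>\<^bsub>obj C i\<^esub> b') \<oplus>\<^bsub>obj C i\<^esub> (x \<oplus>\<^bsub>obj C i\<^esub> y)"
    if "b \<in> boundaries C i" "b' \<in> boundaries C i" for b b'
    using bc[OF that(1)] bc[OF that(2)] x y by (simp add: A.a_ac)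
  show ?thesis
  proof (intro equalityI subsetI)
    fix w assume "w \<in> homology_class C i x <+>\<^bsub>obj C i\<^esub> homology_class C i y"
    then obtain b b' where b: "b \<in> boundaries C i" "b' \<in> boundaries C i"
      "w = (b \<oplus>\<^bsub>obj C i\<^esub> x) \<oplus>\<^bsub>obj C i\<^esub> (b' \<oplus>\<^bsub>obj C i\<^esub> y)" unfolding 1 by blast
    then show "w \<in> homology_class C i (x \<oplus>\<^bsub>obj C i\<^esub> y)"
      using 2[OF b(1,2)] boundaries_add[OF C b(1,2)] by (simp add: homology_class_def)
  next
    fix w assume "w \<in> homology_class C i (x \<oplus>\<^bsub>obj C i\<^esub> y)"
    then obtain b where b: "b \<in> boundaries C i" "w = b \<oplus>\<^bsub>obj C i\<^esub> (x \<oplus>\<^bsub>obj C i\<^esub> y)"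
      by (auto simp: homology_class_def)
    then have "w = (b \<oplus>\<^bsub>obj C i\<^esub> x) \<oplus>\<^bsub>obj C i\<^esub> (\<zero>\<^bsub>obj C i\<^esub> \<oplus>\<^bsub>obj C i\<^esub> y)"
      using 2[OF b(1) boundaries_zero[OF C]] bc[OF b(1)] by simp
    then show "w \<in> homology_class C i x <+>\<^bsub>obj C i\<^esub> homology_class C i y" unfolding 1
      using b(1) boundaries_zero[OF C] by blast
  qed
qed

lemma boundaries_smult:
  assumes C: "is_complex R C" and r: "r \<in> carrier R" and b: "b \<in> boundaries C i"
  shows "r \<odot>\<^bsub>obj C i\<^esub> b \<in> boundaries C i"
proof -
  interpret A: module R "obj C (i + 1)" by (rule is_complexD[OF C])
  obtain y where y: "y \<in> carrier (obj C (i + 1))" "b = diff C (i + 1) y" using b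
    by (auto simp: boundaries_def)
  then have "r \<odot>\<^bsub>obj C i\<^esub> b = diff C (i + 1) (r \<odot>\<^bsub>obj C (i + 1)\<^esub> y)"
    using r by (simp add: hom_smult[OF diff_hom[OF C]])
  then show ?thesis using r y by (simp add: boundaries_def)
qed

lemma cycles_smult:
  assumes C: "is_complex R C" and r: "r \<in> carrier R" and z: "z \<in> cycles C i"
  shows "r \<odot>\<^bsub>obj C i\<^esub> z \<in> cycles C i"
proof -
  interpret A: module R "obj C i" by (rule is_complexD[OF C])
  interpret B: module R "obj C (i - 1)" by (rule is_complexD[OF C])
  show ?thesis using r z by (simp add: cycles_def hom_smult[OF is_complexD(2)[OF C]])
qed

lemma homology_class_smult:
  assumes C: "is_complex R C" and r: "r \<in> carrier R" and x: "x \<in> carrier (obj C i)"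
  shows "(\<Union>z\<in>homology_class C i x. homology_class C i (r \<odot>\<^bsub>obj C i\<^esub> z)) =
      homology_class C i (r \<odot>\<^bsub>obj C i\<^esub> x)"
proof -
  note aC = is_complex_additive[OF C]
  interpret A: module R "obj C i" by (rule is_complexD[OF C])
  have "homology_class C i (r \<odot>\<^bsub>obj C i\<^esub> z) = homology_class C i (r \<odot>\<^bsub>obj C i\<^esub> x)"
    if "z \<in> homology_class C i x" for z
  proof -
    obtain b where b: "b \<in> boundaries C i" "z = b \<oplus>\<^bsub>obj C i\<^esub> x" using \<open>z \<in> homology_class C i x\<close>
      by (auto simp: homology_class_def)
    have bc: "b \<in> carrier (obj C i)" by (rule boundaries_carrier[OF aC b(1)])
    have "r \<odot>\<^bsub>obj C i\<^esub> z \<ominus>\<^bsub>obj C i\<^esub> r \<odot>\<^bsub>obj C i\<^esub> x = r \<odot>\<^bsub>obj C i\<^esub> b"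
      using b(2) bc x r by (simp add: A.smult_r_distr A.ag_normalize)
    then show ?thesis using boundaries_smult[OF C r b(1)] bc x r b(2)
      by (simp add: homology_class_eq_iff[OF aC])
  qed
  moreover have "x \<in> homology_class C i x"
    using boundaries_zero[OF aC, of i] x unfolding homology_class_def
      by (auto intro!: image_eqI[of _ _ "\<zero>\<^bsub>obj C i\<^esub>"])
  ultimately show ?thesis by blast
qed

lemma homology_ops:
  assumes C: "is_complex R C"
  shows "\<zero>\<^bsub>homology C i\<^esub> = homology_class C i \<zero>\<^bsub>obj C i\<^esub>"
    and "x \<in> cycles C i \<Longrightarrow> y \<in> cycles C i \<Longrightarrow>
      homology_class C i x \<oplus>\<^bsub>homology C i\<^esub> homology_class C i y = homology_class C i (x \<oplus>\<^bsub>obj C i\<^esub> y)"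
    and "r \<in> carrier R \<Longrightarrow> x \<in> cycles C i \<Longrightarrow>
        r \<odot>\<^bsub>homology C i\<^esub> homology_class C i x = homology_class C i (r \<odot>\<^bsub>obj C i\<^esub> x)"
proof -
  note aC = is_complex_additive[OF C]
  show "\<zero>\<^bsub>homology C i\<^esub> = homology_class C i \<zero>\<^bsub>obj C i\<^esub>"
    by (simp add: homology_def quotient_module_def homology_class_zero[OF aC])
  have "X \<oplus>\<^bsub>homology C i\<^esub> Y = X <+>\<^bsub>obj C i\<^esub> Y" for X Y
    by (simp add: homology_def quotient_module_def set_add_def set_mult_def)
  then show "x \<in> cycles C i \<Longrightarrow> y \<in> cycles C i \<Longrightarrow>
      homology_class C i x \<oplus>\<^bsub>homology C i\<^esub> homology_class C i y = homology_class C i (x \<oplus>\<^bsub>obj C i\<^esub> y)"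
    by (simp add: homology_class_add[OF aC] cycles_carrier[OF aC])
  have "r \<odot>\<^bsub>homology C i\<^esub> X = (\<Union>z\<in>X. homology_class C i (r \<odot>\<^bsub>obj C i\<^esub> z))" for r X
    by (simp add: homology_def quotient_module_def a_r_coset_homology_class)
  then show "r \<in> carrier R \<Longrightarrow> x \<in> cycles C i \<Longrightarrow>
      r \<odot>\<^bsub>homology C i\<^esub> homology_class C i x = homology_class C i (r \<odot>\<^bsub>obj C i\<^esub> x)"
    by (simp add: homology_class_smult[OF C] cycles_carrier[OF aC])
qed

lemma homology_module:
  assumes C: "is_complex R C" shows "module R (homology C i)"
proof -
  note aC = is_complex_additive[OF C] and ops = homology_ops[OF C]
  interpret A: module R "obj C i" by (rule is_complexD[OF C])
  note [simp] = ops homology_carrier cycles_zero[OF aC] cycles_add[OF aC] cycles_smult[OF C]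
    and c = cycles_carrier[OF aC]
  show ?thesis
  proof (rule moduleI)
    show "cring R" by (rule A.R.is_cring)
    show "abelian_group (homology C i)"
    proof (rule abelian_groupI)
      fix X assume "X \<in> carrier (homology C i)"
      then obtain x where x: "x \<in> cycles C i" "X = homology_class C i x" by auto
      have "\<ominus>\<^bsub>obj C i\<^esub> x \<in> cycles C i"
        using cycles_minus[OF aC cycles_zero[OF aC] x(1)] c[OF x(1)] by (simp add: a_minus_def)
      then show "\<exists>Y\<in>carrier (homology C i). Y \<oplus>\<^bsub>homology C i\<^esub> X = \<zero>\<^bsub>homology C i\<^esub>"
        using x c[OF x(1)] by (auto intro!: bexI[of _ "\<ominus>\<^bsub>obj C i\<^esub> x"] simp: A.l_neg)
    qed (auto simp: c A.a_ac)
  qed (auto simp: c A.smult_l_distr A.smult_r_distr A.smult_assoc1)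
qed

lemma submodule_cycles:
  assumes C: "is_complex R C" shows "submodule (cycles C i) R (obj C i)"
proof -
  note aC = is_complex_additive[OF C]
  interpret A: module R "obj C i" by (rule is_complexD[OF C])
  have "\<ominus>\<^bsub>obj C i\<^esub> x \<in> cycles C i" if "x \<in> cycles C i" for x
    using cycles_minus[OF aC cycles_zero[OF aC] that] cycles_carrier[OF aC that]
      by (simp add: a_minus_def)
  then show ?thesis
    by (intro A.submoduleI) (auto simp: cycles_carrier[OF aC] cycles_zero[OF aC] cycles_add[OF aC]
      cycles_smult[OF C])
qed

text \<open>
  Generating cosets are traded for generating cycles: the classes of the linear combinations of \<open>A\<close>
  form a submodule of the homology, and every submodule that contains the classes of \<open>A\<close> contains
  it.
\<close>

lemma fin_gen_homology_iff:
  assumes C: "is_complex R C"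
  shows "fin_gen_module R (homology C i) \<longleftrightarrow> (\<exists>A\<subseteq>cycles C i. finite A \<and>
    (\<forall>z\<in>cycles C i. \<exists>s\<in>linear_span R (obj C i) A. s \<ominus>\<^bsub>obj C i\<^esub> z \<in> boundaries C i))"
proof -
  note aC = is_complex_additive[OF C] and ops = homology_ops[OF C] and CM = is_complexD(1)[OF C]
  interpret A: module R "obj C i" by (rule CM)
  interpret H: module R "homology C i" by (rule homology_module[OF C])
  note cc = cycles_carrier[OF aC]
  have span: "linear_span R (obj C i) A \<subseteq> cycles C i" if "A \<subseteq> cycles C i" for A
    by (rule linear_span_minimal[OF CM submodule_cycles[OF C] that])
  show ?thesis
  proof
    assume "fin_gen_module R (homology C i)"
    then obtain A' where A0: "A' \<subseteq> carrier (homology C i)" "finite A'"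
      "\<forall>H. submodule H R (homology C i) \<and> A' \<subseteq> H \<longrightarrow> H = carrier (homology C i)"
      unfolding fin_gen_module_def by (elim exE conjE) (rule that)
    have A': "A' \<subseteq> homology_class C i ` cycles C i" "finite A'"
      "submodule H R (homology C i) \<Longrightarrow> A' \<subseteq> H \<Longrightarrow> H = homology_class C i ` cycles C i" for H
      using A0(1,2) A0(3)[rule_format, of H] by (simp_all add: homology_carrier)
    obtain A where A: "A \<subseteq> cycles C i" "finite A" "A' = homology_class C i ` A"
      using finite_subset_image[OF A'(2,1)] by blast
    have Ac: "A \<subseteq> carrier (obj C i)" using A cc by blast
    let ?L = "linear_span R (obj C i) A"
    note L = submoduleD[OF CM submodule_linear_span[OF CM Ac]] and sp = span[OF A(1)]
    have "submodule (homology_class C i ` ?L) R (homology C i)"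
    proof (rule H.submoduleI)
      show "homology_class C i ` ?L \<subseteq> carrier (homology C i)" using sp
        by (auto simp: homology_carrier)
      show "\<zero>\<^bsub>homology C i\<^esub> \<in> homology_class C i ` ?L" using L(2) by (simp add: ops)
      show add: "X \<oplus>\<^bsub>homology C i\<^esub> Y \<in> homology_class C i ` ?L"
        if "X \<in> homology_class C i ` ?L" "Y \<in> homology_class C i ` ?L" for X Y
        using that L(3) sp by (auto simp: ops subset_iff)
      show sm: "r \<odot>\<^bsub>homology C i\<^esub> X \<in> homology_class C i ` ?L"
        if "r \<in> carrier R" "X \<in> homology_class C i ` ?L" for r X
        using that L(5) sp by (auto simp: ops subset_iff)
      fix X assume X: "X \<in> homology_class C i ` ?L"
      then have "X \<in> carrier (homology C i)" using sp by (auto simp: homology_carrier)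
      then have "\<ominus>\<^bsub>homology C i\<^esub> X = (\<ominus>\<^bsub>R\<^esub> \<one>\<^bsub>R\<^esub>) \<odot>\<^bsub>homology C i\<^esub> X" by (simp add: H.smult_l_minus)
      then show "\<ominus>\<^bsub>homology C i\<^esub> X \<in> homology_class C i ` ?L" using sm[OF _ X] by simp
    qed
    moreover have "A' \<subseteq> homology_class C i ` ?L" unfolding A(3) using linear_span_base[OF CM Ac]
      by blast
    ultimately have eq: "homology_class C i ` ?L = homology_class C i ` cycles C i" by (rule A'(3))
    have "\<exists>s\<in>?L. s \<ominus>\<^bsub>obj C i\<^esub> z \<in> boundaries C i" if z: "z \<in> cycles C i" for z
    proof -
      have "homology_class C i z \<in> homology_class C i ` ?L" unfolding eq using z by blast
      then obtain s where s: "s \<in> ?L" "homology_class C i s = homology_class C i z"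
        by (metis imageE)
      then show ?thesis using homology_class_eq_iff[OF aC cc cc, of s i z] sp z by blast
    qed
    then show "\<exists>A\<subseteq>cycles C i. finite A \<and>
      (\<forall>z\<in>cycles C i. \<exists>s\<in>linear_span R (obj C i) A. s \<ominus>\<^bsub>obj C i\<^esub> z \<in> boundaries C i)"
      using A by blast
  next
    assume "\<exists>A\<subseteq>cycles C i. finite A \<and>
      (\<forall>z\<in>cycles C i. \<exists>s\<in>linear_span R (obj C i) A. s \<ominus>\<^bsub>obj C i\<^esub> z \<in> boundaries C i)"
    then obtain A where A: "A \<subseteq> cycles C i" "finite A"
      "\<And>z. z \<in> cycles C i \<Longrightarrow> \<exists>s\<in>linear_span R (obj C i) A. s \<ominus>\<^bsub>obj C i\<^esub> z \<in> boundaries C i" by blast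
    show "fin_gen_module R (homology C i)"
      unfolding fin_gen_module_def
    proof (intro exI[of _ "homology_class C i ` A"] conjI allI impI)
      show "homology_class C i ` A \<subseteq> carrier (homology C i)" "finite (homology_class C i ` A)"
        using A by (auto simp: homology_carrier)
      fix H assume H: "submodule H R (homology C i) \<and> homology_class C i ` A \<subseteq> H"
      note HD = submoduleD[OF H.module_axioms conjunct1[OF H]]
      have "s \<in> cycles C i \<and> homology_class C i s \<in> H" if "s \<in> linear_span R (obj C i) A" for s
        using that
      proof induction
        case zero then show ?case using HD(2) by (simp add: ops cycles_zero[OF aC])
      next
        case (step r a x)
        then have a: "a \<in> cycles C i" "homology_class C i a \<in> H" using A(1) H by auto
        have ra: "r \<odot>\<^bsub>obj C i\<^esub> a \<in> cycles C i" by (rule cycles_smult[OF C step(1) a(1)])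
        have "homology_class C i (r \<odot>\<^bsub>obj C i\<^esub> a) \<in> H" using HD(5)[OF step(1) a(2)]
          by (simp add: ops step a)
        then show ?case using HD(3)[of "homology_class C i (r \<odot>\<^bsub>obj C i\<^esub> a)" "homology_class C i x"]
          step ra
          by (simp add: ops cycles_add[OF aC])
      qed
      then have "homology_class C i z \<in> H" if "z \<in> cycles C i" for z
        using A(3)[OF that] homology_class_eq_iff[OF aC cc cc[OF that]] by (metis)
      then show "H = carrier (homology C i)" using HD(1) by (auto simp: homology_carrier)
    qed
  qed
qed

section \<open>Shifts, null homotopies and the Hom complex\<close>

text \<open>
  This is the shift \<open>\<Sigma>\<^sup>-\<^sup>n X\<close>.  With the sign \<open>(-1)\<^sup>n\<close> in its differential, the elements of degree \<open>n\<close>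
  of \<open>Hom(P, X)\<close> become families of degree \<open>0\<close>, cycles become chain maps and boundaries become null
  homotopic maps, without further signs.
\<close>

definition shift :: "int \<Rightarrow> ('a, 'm) cpx \<Rightarrow> ('a, 'm) cpx" where
  "shift n X = \<lparr>obj = (\<lambda>i. obj X (i + n)),
     diff = (\<lambda>i x. if even n then diff X (i + n) x else \<ominus>\<^bsub>obj X (i - 1 + n)\<^esub> diff X (i + n) x)\<rparr>"

lemma obj_shift [simp]: "obj (shift n X) i = obj X (i + n)"
  by (simp add: shift_def)

lemma shift_zero [simp]: "shift 0 X = X"
  by (simp add: shift_def)

lemma is_complexI:
  assumes "\<And>i. module R (obj C i)" "\<And>i. diff C i \<in> module_hom R (obj C i) (obj C (i - 1))"
    "\<And>i x. x \<in> carrier (obj C i) \<Longrightarrow> diff C (i - 1) (diff C i x) = \<zero>\<^bsub>obj C (i - 2)\<^esub>"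
  shows "is_complex R C"
  using assms by (simp add: is_complex_def)

lemma is_complex_shift:
  assumes X: "is_complex R X" shows "is_complex R (shift n X)"
proof (rule is_complexI)
  note D = is_complexD[OF X]
  fix i
  have e1: "i - 1 + n = i + n - 1" "i - 2 + n = i + n - 2" "i - 1 - 1 + n = i + n - 2" by simp_all
  show "module R (obj (shift n X) i)" by (simp add: D)
  show "diff (shift n X) i \<in> module_hom R (obj (shift n X) i) (obj (shift n X) (i - 1))"
    using D(2)[of "i + n"] module_hom_uminus[OF D(1) D(2)[of "i + n"]]
    by (cases "even n") (simp_all add: shift_def e1)
  fix x assume "x \<in> carrier (obj (shift n X) i)"
  then have x: "x \<in> carrier (obj X (i + n))" by simp
  interpret B: module R "obj X (i + n - 1)" by (rule D)
  interpret C: module R "obj X (i + n - 2)" by (rule D)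
  have "diff X (i + n - 1) \<in> module_hom R (obj X (i + n - 1)) (obj X (i + n - 2))"
    using D(2)[of "i + n - 1"] by simp
  then show "diff (shift n X) (i - 1) (diff (shift n X) i x) = \<zero>\<^bsub>obj (shift n X) (i - 2)\<^esub>"
    using D(3)[OF x] D(4)[OF x] ag_uminus_eq_zero[OF D(5), of "\<zero>\<^bsub>obj X (i + n - 2)\<^esub>" "i + n - 2"]
    by (simp add: shift_def e1 hom_uminus[OF D(1) D(1)])
qed

lemma cycles_shift:
  assumes X: "is_complex R X" shows "cycles (shift n X) i = cycles X (i + n)"
proof -
  have e1: "i - 1 + n = i + n - 1" by simp
  show ?thesis
    using is_complexD(4)[OF X, of _ "i + n"]
    by (auto simp: cycles_def shift_def e1 ag_uminus_eq_zero[OF is_complexD(5)[OF X]]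
        ag_uminus_zero[OF is_complexD(5)[OF X]])
qed

lemma boundaries_shift:
  assumes X: "is_complex R X" shows "boundaries (shift n X) i = boundaries X (i + n)"
proof -
  have e1: "i + 1 + n = i + n + 1" "i + n + 1 - 1 = i + n" by simp_all
  interpret A: module R "obj X (i + n + 1)" by (rule is_complexD[OF X])
  have u: "\<ominus>\<^bsub>obj X (i + n)\<^esub> diff X (i + n + 1) x = diff X (i + n + 1) (\<ominus>\<^bsub>obj X (i + n + 1)\<^esub> x)"
    if "x \<in> carrier (obj X (i + n + 1))" for x
    using hom_uminus[OF is_complexD(1)[OF X] is_complexD(1)[OF X] diff_hom[OF X] that] by simp
  show ?thesis
  proof (cases "even n")
    case True then show ?thesis by (simp add: boundaries_def shift_def e1)
  next
    case False
    have "boundaries (shift n X) i =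
        (\<lambda>x. diff X (i + n + 1) (\<ominus>\<^bsub>obj X (i + n + 1)\<^esub> x)) ` carrier (obj X (i + n + 1))"
      using False u by (auto simp: boundaries_def shift_def e1 intro!: image_cong)
    also have "\<dots> = diff X (i + n + 1) ` (\<lambda>x. \<ominus>\<^bsub>obj X (i + n + 1)\<^esub> x) ` carrier (obj X (i + n + 1))"
      by (simp add: image_image)
    also have "(\<lambda>x. \<ominus>\<^bsub>obj X (i + n + 1)\<^esub> x) ` carrier (obj X (i + n + 1)) =
        carrier (obj X (i + n + 1))"
    proof (intro equalityI subsetI)
      fix x assume "x \<in> carrier (obj X (i + n + 1))"
      then show "x \<in> (\<lambda>x. \<ominus>\<^bsub>obj X (i + n + 1)\<^esub> x) ` carrier (obj X (i + n + 1))"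
        by (intro image_eqI[of _ _ "\<ominus>\<^bsub>obj X (i + n + 1)\<^esub> x"]) auto
    qed auto
    finally show ?thesis by (simp add: boundaries_def)
  qed
qed

lemma chain_map_shift:
  assumes X: "is_complex R X" and Y: "is_complex R Y" and ch: "chain_map R X Y \<alpha>"
  shows "chain_map R (shift n X) (shift n Y) (\<lambda>i. \<alpha> (i + n))"
proof -
  have e1: "i - 1 + n = i + n - 1" for i :: int by simp
  show ?thesis
    using chain_mapD[OF ch] is_complexD(4)[OF X]
      hom_uminus[OF is_complexD(1)[OF X] is_complexD(1)[OF Y] chain_mapD(1)[OF ch]]
    by (auto simp: chain_map_def shift_def e1)
qed

definition null_homotopic ::
  "('a, 'r) ring_scheme \<Rightarrow> ('a, 'p) cpx \<Rightarrow> ('a, 'x) cpx \<Rightarrow> (int \<Rightarrow> 'p \<Rightarrow> 'x) \<Rightarrow> bool" where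
  "null_homotopic R P X f \<longleftrightarrow> (\<exists>h. \<forall>i. h i \<in> module_hom R (obj P i) (obj X (i + 1)) \<and>
     (\<forall>x\<in>carrier (obj P i). f i x = diff X (i + 1) (h i x) \<oplus>\<^bsub>obj X i\<^esub> h (i - 1) (diff P i x)))"

text \<open>
  For \<open>X = shift n N\<close> this expresses that \<open>H\<^sub>n(Hom(P, N)) = 0\<close>.
\<close>

definition homs_null :: "('a, 'r) ring_scheme \<Rightarrow> ('a, 'p) cpx \<Rightarrow> ('a, 'x) cpx \<Rightarrow> bool" where
  "homs_null R P X \<longleftrightarrow> (\<forall>f. chain_map R P X f \<longrightarrow> null_homotopic R P X f)"

text \<open>
  Composition with \<open>\<alpha>\<close> is injective and surjective on homotopy classes of chain maps from \<open>P\<close>.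
\<close>

definition lifts_along :: "('a, 'r) ring_scheme \<Rightarrow> ('a, 'p) cpx \<Rightarrow> ('a, 'x) cpx \<Rightarrow> ('a, 'y) cpx \<Rightarrow>
    (int \<Rightarrow> 'x \<Rightarrow> 'y) \<Rightarrow> bool" where
  "lifts_along R P X Y \<alpha> \<longleftrightarrow>
     (\<forall>g. chain_map R P X g \<and> null_homotopic R P Y (\<lambda>i x. \<alpha> i (g i x)) \<longrightarrow> null_homotopic R P X g) \<and>
     (\<forall>h. chain_map R P Y h \<longrightarrow>
        (\<exists>k. chain_map R P X k \<and> null_homotopic R P Y (\<lambda>i x. \<alpha> i (k i x) \<ominus>\<^bsub>obj Y i\<^esub> h i x)))"

lemma null_homotopic_cong:
  assumes "\<And>i x. x \<in> carrier (obj P i) \<Longrightarrow> f i x = g i x"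
  shows "null_homotopic R P X f \<longleftrightarrow> null_homotopic R P X g"
  unfolding null_homotopic_def using assms by simp

lemma module_hom_cong:
  assumes "module R M" "\<And>x. x \<in> carrier M \<Longrightarrow> f x = g x"
  shows "f \<in> module_hom R M N \<longleftrightarrow> g \<in> module_hom R M N"
proof -
  interpret module R M by fact
  show ?thesis using assms(2) by (simp add: module_hom_def Pi_def)
qed

lemma chain_map_cong:
  assumes P: "is_complex R P" and eq: "\<And>i x. x \<in> carrier (obj P i) \<Longrightarrow> f i x = g i x"
  shows "chain_map R P X f \<longleftrightarrow> chain_map R P X g"
proof -
  have "f i \<in> module_hom R (obj P i) (obj X i) \<longleftrightarrow> g i \<in> module_hom R (obj P i) (obj X i)" for i
    by (rule module_hom_cong) (auto simp: is_complexD[OF P] eq)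
  then show ?thesis unfolding chain_map_def by (simp add: eq is_complexD(4)[OF P])
qed

lemma null_homotopic_chain_map:
  assumes P: "is_complex R P" and X: "is_complex R X" and null: "null_homotopic R P X f"
  shows "chain_map R P X f"
proof -
  obtain h where h: "\<And>i. h i \<in> module_hom R (obj P i) (obj X (i + 1))"
    and f: "\<And>i x. x \<in> carrier (obj P i) \<Longrightarrow>
      f i x = diff X (i + 1) (h i x) \<oplus>\<^bsub>obj X i\<^esub> h (i - 1) (diff P i x)"
    using null unfolding null_homotopic_def by blast
  let ?f = "\<lambda>i x. diff X (i + 1) (h i x) \<oplus>\<^bsub>obj X i\<^esub> h (i - 1) (diff P i x)"
  have h1: "h (i - 1) \<in> module_hom R (obj P (i - 1)) (obj X i)" for i using h[of "i - 1"] by simp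
  have "chain_map R P X ?f"
    unfolding chain_map_def
  proof (intro allI conjI ballI)
    fix i
    show "?f i \<in> module_hom R (obj P i) (obj X i)"
      by (intro module_hom_add is_complexD(1)[OF X] module_hom_comp[OF h diff_hom[OF X]]
          module_hom_comp[OF is_complexD(2)[OF P] h1])
    fix x assume x: "x \<in> carrier (obj P i)"
    interpret A: abelian_group "obj X (i - 1)" by (rule is_complexD(5)[OF X])
    have dx: "diff P i x \<in> carrier (obj P (i - 1))" by (rule is_complexD(4)[OF P x])
    have hx: "h i x \<in> carrier (obj X (i + 1))" by (rule hom_closed[OF h x])
    have hdx: "h (i - 1) (diff P i x) \<in> carrier (obj X i)" by (rule hom_closed[OF h1 dx])
    have ddx: "diff P (i - 1) (diff P i x) = \<zero>\<^bsub>obj P (i - 2)\<^esub>" by (rule is_complexD(3)[OF P x])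
    have "h (i - 1 - 1) \<zero>\<^bsub>obj P (i - 2)\<^esub> = \<zero>\<^bsub>obj X (i - 1)\<^esub>"
      using hom_zero[OF is_complexD(1)[OF P] is_complexD(1)[OF X] h[of "i - 2"]] by simp
    then show "diff X i (?f i x) = ?f (i - 1) (diff P i x)"
      using is_complexD(4)[OF X hdx] diff_diff[OF X hx] hdx
      by (simp add: hom_add[OF is_complexD(2)[OF X]] ddx)
  qed
  then show ?thesis by (subst chain_map_cong[OF P, where g="?f"]) (simp_all add: f)
qed

context
  fixes R :: "('a, 'r) ring_scheme" and P :: "('a, 'p) cpx" and X :: "('a, 'x) cpx"
  assumes P: "is_complex R P" and X: "is_complex R X"
begin

lemma hom_obj_eqI:
  assumes "f \<in> carrier (obj (hom_complex R P X) n)" "g \<in> carrier (obj (hom_complex R P X) n)"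
    "\<And>i p. p \<in> carrier (obj P i) \<Longrightarrow> f i p = g i p"
  shows "f = g"
proof
  fix i
  show "f i = g i" using assms
    by (intro extensionalityI[of _ "carrier (obj P i)"]) (auto simp: hom_complex_def)
qed

lemma restr_hom:
  "f \<in> module_hom R (obj P i) N \<Longrightarrow> restrict f (carrier (obj P i)) \<in> module_hom R (obj P i) N"
  using module_hom_cong[OF is_complexD(1)[OF P], of i "restrict f (carrier (obj P i))" f] by simp

lemma restr_hom_carrier:
  assumes "\<And>i. f i \<in> module_hom R (obj P i) (obj X (i + n))"
  shows "(\<lambda>i. restrict (f i) (carrier (obj P i))) \<in> carrier (obj (hom_complex R P X) n)"
  using assms by (simp add: hom_complex_def restr_hom)

lemma hom_carrierD:
  assumes "f \<in> carrier (obj (hom_complex R P X) n)"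
  shows "f i \<in> module_hom R (obj P i) (obj X (i + n))" "f i \<in> extensional (carrier (obj P i))"
    "p \<in> carrier (obj P i) \<Longrightarrow> f i p \<in> carrier (obj X (i + n))"
  using assms by (auto simp: hom_complex_def intro: hom_closed)

lemma hom_obj_ops:
  assumes "p \<in> carrier (obj P i)"
  shows "(f \<oplus>\<^bsub>obj (hom_complex R P X) n\<^esub> g) i p = f i p \<oplus>\<^bsub>obj X (i + n)\<^esub> g i p"
    "\<zero>\<^bsub>obj (hom_complex R P X) n\<^esub> i p = \<zero>\<^bsub>obj X (i + n)\<^esub>"
    "diff (hom_complex R P X) n f i p =
      (if even n then diff X (i + n) (f i p) \<ominus>\<^bsub>obj X (i + n - 1)\<^esub> f (i - 1) (diff P i p)
       else diff X (i + n) (f i p) \<oplus>\<^bsub>obj X (i + n - 1)\<^esub> f (i - 1) (diff P i p))"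
  using assms by (simp_all add: hom_complex_def)

lemma hom_obj_abelian: "abelian_group (obj (hom_complex R P X) n)"
proof (rule abelian_groupI)
  let ?H = "obj (hom_complex R P X) n"
  have ag: "abelian_group (obj X j)" for j by (rule is_complexD(5)[OF X])
  have add: "f \<oplus>\<^bsub>?H\<^esub> g \<in> carrier ?H" if "f \<in> carrier ?H" "g \<in> carrier ?H" for f g
  proof -
    have "f \<oplus>\<^bsub>?H\<^esub> g = (\<lambda>i. restrict (\<lambda>p. f i p \<oplus>\<^bsub>obj X (i + n)\<^esub> g i p) (carrier (obj P i)))"
      by (simp add: hom_complex_def)
    then show ?thesis
      using that by (simp only:, intro restr_hom_carrier module_hom_add is_complexD(1)[OF X]
        hom_carrierD(1))
  qed
  have zero: "\<zero>\<^bsub>?H\<^esub> \<in> carrier ?H"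
    using restr_hom[OF module_hom_zero[OF is_complexD(1)[OF X]]] by (simp add: hom_complex_def)
  show "\<zero>\<^bsub>?H\<^esub> \<in> carrier ?H" by (rule zero)
  fix f assume f: "f \<in> carrier ?H"
  show "\<zero>\<^bsub>?H\<^esub> \<oplus>\<^bsub>?H\<^esub> f = f"
  proof (rule hom_obj_eqI[OF add[OF zero f] f])
    fix i p assume p: "p \<in> carrier (obj P i)"
    interpret A: abelian_group "obj X (i + n)" by (rule ag)
    show "(\<zero>\<^bsub>?H\<^esub> \<oplus>\<^bsub>?H\<^esub> f) i p = f i p" using hom_carrierD(3)[OF f p] by (simp add: hom_obj_ops[OF p])
  qed
  let ?g = "\<lambda>i. restrict (\<lambda>p. \<ominus>\<^bsub>obj X (i + n)\<^esub> f i p) (carrier (obj P i))"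
  have g: "?g \<in> carrier ?H" using f
    by (intro restr_hom_carrier module_hom_uminus is_complexD(1)[OF X] hom_carrierD(1))
  have "?g \<oplus>\<^bsub>?H\<^esub> f = \<zero>\<^bsub>?H\<^esub>"
  proof (rule hom_obj_eqI[OF add[OF g f] zero])
    fix i p assume p: "p \<in> carrier (obj P i)"
    interpret A: abelian_group "obj X (i + n)" by (rule ag)
    show "(?g \<oplus>\<^bsub>?H\<^esub> f) i p = \<zero>\<^bsub>?H\<^esub> i p" using hom_carrierD(3)[OF f p] p
      by (simp add: hom_obj_ops[OF p] A.l_neg)
  qed
  with g show "\<exists>g\<in>carrier ?H. g \<oplus>\<^bsub>?H\<^esub> f = \<zero>\<^bsub>?H\<^esub>" by blast
  fix g assume g: "g \<in> carrier ?H"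
  show "f \<oplus>\<^bsub>?H\<^esub> g \<in> carrier ?H" by (rule add[OF f g])
  show "f \<oplus>\<^bsub>?H\<^esub> g = g \<oplus>\<^bsub>?H\<^esub> f"
  proof (rule hom_obj_eqI[OF add[OF f g] add[OF g f]])
    fix i p assume p: "p \<in> carrier (obj P i)"
    interpret A: abelian_group "obj X (i + n)" by (rule ag)
    show "(f \<oplus>\<^bsub>?H\<^esub> g) i p = (g \<oplus>\<^bsub>?H\<^esub> f) i p"
      using hom_carrierD(3)[OF f p] hom_carrierD(3)[OF g p]
        by (simp add: hom_obj_ops[OF p] A.a_comm)
  qed
  fix h assume h: "h \<in> carrier ?H"
  show "f \<oplus>\<^bsub>?H\<^esub> g \<oplus>\<^bsub>?H\<^esub> h = f \<oplus>\<^bsub>?H\<^esub> (g \<oplus>\<^bsub>?H\<^esub> h)"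
  proof (rule hom_obj_eqI[OF add[OF add[OF f g] h] add[OF f add[OF g h]]])
    fix i p assume p: "p \<in> carrier (obj P i)"
    interpret A: abelian_group "obj X (i + n)" by (rule ag)
    show "(f \<oplus>\<^bsub>?H\<^esub> g \<oplus>\<^bsub>?H\<^esub> h) i p = (f \<oplus>\<^bsub>?H\<^esub> (g \<oplus>\<^bsub>?H\<^esub> h)) i p"
      using hom_carrierD(3)[OF f p] hom_carrierD(3)[OF g p] hom_carrierD(3)[OF h p]
      by (simp add: hom_obj_ops[OF p] A.a_assoc)
  qed
qed

lemma hom_diff_carrier:
  assumes f: "f \<in> carrier (obj (hom_complex R P X) n)"
  shows "diff (hom_complex R P X) n f \<in> carrier (obj (hom_complex R P X) (n - 1))"
proof -
  have e: "i - 1 + n = i + n - 1" "i + (n - 1) = i + n - 1" for i :: int by simp_all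
  have 1: "(\<lambda>p. diff X (i + n) (f i p)) \<in> module_hom R (obj P i) (obj X (i + n - 1))" for i
    by (rule module_hom_comp[OF hom_carrierD(1)[OF f] is_complexD(2)[OF X]])
  have 2: "(\<lambda>p. f (i - 1) (diff P i p)) \<in> module_hom R (obj P i) (obj X (i + n - 1))" for i
    using module_hom_comp[OF is_complexD(2)[OF P] hom_carrierD(1)[OF f]] by (simp only: e)
  have "diff (hom_complex R P X) n f = (\<lambda>i. restrict (\<lambda>p. if even n
      then diff X (i + n) (f i p) \<ominus>\<^bsub>obj X (i + n - 1)\<^esub> f (i - 1) (diff P i p)
      else diff X (i + n) (f i p) \<oplus>\<^bsub>obj X (i + n - 1)\<^esub> f (i - 1) (diff P i p)) (carrier (obj P i)))"
    by (simp add: hom_complex_def)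
  moreover have "\<dots> \<in> carrier (obj (hom_complex R P X) (n - 1))"
    by (rule restr_hom_carrier, unfold e)
      (use module_hom_add[OF is_complexD(1)[OF X] 1 2]
        module_hom_diff[OF is_complexD(1)[OF X] 1 2] in
        \<open>cases "even n"; simp\<close>)
  ultimately show ?thesis by simp
qed

lemma hom_cycles_iff:
  "f \<in> cycles (hom_complex R P X) n \<longleftrightarrow>
     (\<forall>i. f i \<in> extensional (carrier (obj P i))) \<and> chain_map R P (shift n X) f"
proof -
  have e: "i - 1 + n = i + n - 1" "i + (n - 1) = i + n - 1" for i :: int by simp_all
  have "f \<in> cycles (hom_complex R P X) n \<longleftrightarrow> f \<in> carrier (obj (hom_complex R P X) n) \<and>
      (\<forall>i. \<forall>p\<in>carrier (obj P i). diff (hom_complex R P X) n f i p = \<zero>\<^bsub>obj (hom_complex R P X) (n - 1)\<^esub>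
      i p)"
    unfolding cycles_def
    using hom_obj_eqI[OF hom_diff_carrier
      abelian_group.axioms(1)[OF hom_obj_abelian, THEN abelian_monoid.zero_closed]]
    by auto
  also have "\<dots> \<longleftrightarrow> f \<in> carrier (obj (hom_complex R P X) n) \<and>
      (\<forall>i. \<forall>p\<in>carrier (obj P i). diff (shift n X) i (f i p) = f (i - 1) (diff P i p))"
  proof (intro conj_cong refl iff_allI ball_cong)
    fix i p assume f: "f \<in> carrier (obj (hom_complex R P X) n)" and p: "p \<in> carrier (obj P i)"
    have 1: "diff X (i + n) (f i p) \<in> carrier (obj X (i + n - 1))"
      by (rule is_complexD(4)[OF X hom_carrierD(3)[OF f p]])
    have 2: "f (i - 1) (diff P i p) \<in> carrier (obj X (i + n - 1))"
      using hom_carrierD(3)[OF f is_complexD(4)[OF P p]] by (simp only: e)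
    show "diff (hom_complex R P X) n f i p = \<zero>\<^bsub>obj (hom_complex R P X) (n - 1)\<^esub> i p \<longleftrightarrow>
       diff (shift n X) i (f i p) = f (i - 1) (diff P i p)"
      by (simp add: hom_obj_ops[OF p] e shift_def ag_minus_eq_zero[OF is_complexD(5)[OF X] 1 2]
          ag_add_eq_zero[OF is_complexD(5)[OF X] 1 2])
  qed
  also have "\<dots> \<longleftrightarrow> (\<forall>i. f i \<in> extensional (carrier (obj P i))) \<and> chain_map R P (shift n X) f"
    by (auto simp: hom_complex_def chain_map_def)
  finally show ?thesis .
qed

text \<open>
  In odd degree the sign of the shifted differential is absorbed by negating the homotopy.
\<close>

lemma hom_boundaries_iff:
  "f \<in> boundaries (hom_complex R P X) n \<longleftrightarrow>
     (\<forall>i. f i \<in> extensional (carrier (obj P i))) \<and> null_homotopic R P (shift n X) f"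
proof -
  have e: "i - 1 + n = i + n - 1" "i + (n + 1) = i + n + 1" "i + 1 + n = i + n + 1"
    "i - 1 + (n + 1) = i + n" "i + 1 - 1 + n = i + n" "i + n + 1 - 1 = i + n" for i :: int
      by simp_all
  note Xm = is_complexD(1)[OF X]
  show ?thesis
  proof
    assume "f \<in> boundaries (hom_complex R P X) n"
    then obtain g where g: "g \<in> carrier (obj (hom_complex R P X) (n + 1))"
      and f: "f = diff (hom_complex R P X) (n + 1) g" by (auto simp: boundaries_def)
    have g1: "g i \<in> module_hom R (obj P i) (obj X (i + n + 1))" for i
      using hom_carrierD(1)[OF g, of i] by (simp only: e)
    have ext: "f i \<in> extensional (carrier (obj P i))" for i
      unfolding f by (simp add: hom_complex_def)
    let ?h = "\<lambda>i x. if even n then g i x else \<ominus>\<^bsub>obj X (i + n + 1)\<^esub> g i x"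
    have "null_homotopic R P (shift n X) f"
      unfolding null_homotopic_def
    proof (intro exI[of _ ?h] allI conjI ballI)
      fix i
      show "?h i \<in> module_hom R (obj P i) (obj (shift n X) (i + 1))"
        using g1[of i] module_hom_uminus[OF Xm g1[of i]] by (cases "even n") (simp_all add: e)
      fix x assume x: "x \<in> carrier (obj P i)"
      have gx: "g i x \<in> carrier (obj X (i + n + 1))" by (rule hom_closed[OF g1 x])
      interpret A: abelian_group "obj X (i + n)" by (rule is_complexD(5)[OF X])
      show "f i x = diff (shift n X) (i + 1) (?h i x) \<oplus>\<^bsub>obj (shift n X) i\<^esub> ?h (i - 1) (diff P i x)"
        using gx diff_diff(2)[OF X gx] hom_uminus[OF Xm Xm diff_hom[OF X, of "i + n"] gx]
        unfolding f by (simp add: hom_obj_ops[OF x] shift_def e a_minus_def)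
    qed
    with ext show "(\<forall>i. f i \<in> extensional (carrier (obj P i))) \<and> null_homotopic R P (shift n X) f"
      by blast
  next
    assume *: "(\<forall>i. f i \<in> extensional (carrier (obj P i))) \<and> null_homotopic R P (shift n X) f"
    obtain h where h: "\<And>i. h i \<in> module_hom R (obj P i) (obj (shift n X) (i + 1))"
      and f: "\<And>i x. x \<in> carrier (obj P i) \<Longrightarrow>
        f i x = diff (shift n X) (i + 1) (h i x) \<oplus>\<^bsub>obj (shift n X) i\<^esub> h (i - 1) (diff P i x)"
      using * unfolding null_homotopic_def by blast
    have h1: "h i \<in> module_hom R (obj P i) (obj X (i + n + 1))" for i
      using h[of i] by (simp only: obj_shift e)
    let ?g = "\<lambda>i. restrict (\<lambda>x. if even n then h i x else \<ominus>\<^bsub>obj X (i + n + 1)\<^esub> h i x)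
        (carrier (obj P i))"
    have g: "?g \<in> carrier (obj (hom_complex R P X) (n + 1))"
      by (rule restr_hom_carrier)
        (use h1 module_hom_uminus[OF Xm h1] in \<open>cases "even n"; simp add: e\<close>)
    have "f = diff (hom_complex R P X) (n + 1) ?g"
    proof
      fix i
      show "f i = diff (hom_complex R P X) (n + 1) ?g i"
      proof (rule extensionalityI)
        show "f i \<in> extensional (carrier (obj P i))" using * by blast
        show "diff (hom_complex R P X) (n + 1) ?g i \<in> extensional (carrier (obj P i))"
          by (simp add: hom_complex_def)
        fix x assume x: "x \<in> carrier (obj P i)"
        have hx: "h i x \<in> carrier (obj X (i + n + 1))" by (rule hom_closed[OF h1 x])
        have dx: "diff P i x \<in> carrier (obj P (i - 1))" by (rule is_complexD(4)[OF P x])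
        have hdx: "h (i - 1) (diff P i x) \<in> carrier (obj X (i + n))"
          using hom_closed[OF h1 dx] by (simp add: algebra_simps)
        interpret A: abelian_group "obj X (i + n)" by (rule is_complexD(5)[OF X])
        show "f i x = diff (hom_complex R P X) (n + 1) ?g i x"
          using x dx hx hdx diff_diff(2)[OF X hx] hom_uminus[OF Xm Xm diff_hom[OF X, of "i + n"] hx]
          by (simp add: f[OF x] hom_obj_ops[OF x] shift_def e a_minus_def)
      qed
    qed
    with g show "f \<in> boundaries (hom_complex R P X) n" by (simp add: boundaries_def)
  qed
qed

lemma hom_complex_additive: "additive_complex (hom_complex R P X)"
  unfolding additive_complex_def
proof (intro allI conjI ballI)
  let ?H = "hom_complex R P X"
  fix n
  show "abelian_group (obj ?H n)" by (rule hom_obj_abelian)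
  fix f assume f: "f \<in> carrier (obj ?H n)"
  show df: "diff ?H n f \<in> carrier (obj ?H (n - 1))" by (rule hom_diff_carrier[OF f])
  have "diff ?H n f \<in> boundaries ?H (n - 1)" using f by (simp add: boundaries_def)
  then have "diff ?H n f \<in> cycles ?H (n - 1)"
    unfolding hom_boundaries_iff hom_cycles_iff
      using null_homotopic_chain_map[OF P is_complex_shift[OF X]] by blast
  then show "diff ?H (n - 1) (diff ?H n f) = \<zero>\<^bsub>obj ?H (n - 2)\<^esub>" by (simp add: cycles_def)
  fix g assume g: "g \<in> carrier (obj ?H n)"
  interpret H: abelian_group "obj ?H n" by (rule hom_obj_abelian)
  interpret H1: abelian_group "obj ?H (n - 1)" by (rule hom_obj_abelian)
  show "diff ?H n (f \<oplus>\<^bsub>obj ?H n\<^esub> g) = diff ?H n f \<oplus>\<^bsub>obj ?H (n - 1)\<^esub> diff ?H n g"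
  proof (rule hom_obj_eqI)
    show "diff ?H n (f \<oplus>\<^bsub>obj ?H n\<^esub> g) \<in> carrier (obj ?H (n - 1))"
      "diff ?H n f \<oplus>\<^bsub>obj ?H (n - 1)\<^esub> diff ?H n g \<in> carrier (obj ?H (n - 1))"
      using f g by (simp_all add: hom_diff_carrier)
    fix i p assume p: "p \<in> carrier (obj P i)"
    have e: "i + (n - 1) = i + n - 1" "i - 1 + n = i + n - 1" by simp_all
    interpret A: abelian_group "obj X (i + n - 1)" by (rule is_complexD(5)[OF X])
    have dp: "diff P i p \<in> carrier (obj P (i - 1))" by (rule is_complexD(4)[OF P p])
    have c: "f i p \<in> carrier (obj X (i + n))" "g i p \<in> carrier (obj X (i + n))"
      using hom_carrierD(3)[OF f p] hom_carrierD(3)[OF g p] by simp_all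
    have c': "f (i - 1) (diff P i p) \<in> carrier (obj X (i + n - 1))"
       "g (i - 1) (diff P i p) \<in> carrier (obj X (i + n - 1))"
      using hom_carrierD(3)[OF f dp] hom_carrierD(3)[OF g dp] by (simp_all only: e)
    show "diff ?H n (f \<oplus>\<^bsub>obj ?H n\<^esub> g) i p = (diff ?H n f \<oplus>\<^bsub>obj ?H (n - 1)\<^esub> diff ?H n g) i p"
      using c c' is_complexD(4)[OF X c(1)] is_complexD(4)[OF X c(2)]
      by (simp add: hom_obj_ops[OF p] hom_obj_ops[OF dp] e hom_add[OF is_complexD(2)[OF X]]
        A.ag_normalize)
  qed
qed

lemma homology_hom_zero_iff:
  "zero_module (homology (hom_complex R P X) n) \<longleftrightarrow> homs_null R P (shift n X)"
proof -
  have "(\<forall>f. f \<in> cycles (hom_complex R P X) n \<longrightarrow> f \<in> boundaries (hom_complex R P X) n) \<longleftrightarrow>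
     homs_null R P (shift n X)"
  proof
    assume *: "\<forall>f. f \<in> cycles (hom_complex R P X) n \<longrightarrow> f \<in> boundaries (hom_complex R P X) n"
    show "homs_null R P (shift n X)"
      unfolding homs_null_def
    proof (intro allI impI)
      fix f assume f: "chain_map R P (shift n X) f"
      let ?f = "\<lambda>i. restrict (f i) (carrier (obj P i))"
      have "chain_map R P (shift n X) ?f" using f chain_map_cong[OF P, of f ?f] by simp
      then have "null_homotopic R P (shift n X) ?f"
        using *[rule_format, of ?f] unfolding hom_cycles_iff hom_boundaries_iff by simp
      then show "null_homotopic R P (shift n X) f"
        using null_homotopic_cong[of P f ?f R "shift n X"] by simp
    qed
  qed (auto simp: hom_cycles_iff hom_boundaries_iff homs_null_def)
  then show ?thesis unfolding zero_module_homology[OF hom_complex_additive] by blast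
qed

end

text \<open>
  Chain maps are families of arbitrary functions, whereas the elements of the Hom complex are
  \<open>undefined\<close> outside the carriers; restriction to the carriers mediates between the two.
\<close>

lemma hom_complex_map_quasi_iso_iff:
  assumes P: "is_complex R P" and X: "is_complex R X" and Y: "is_complex R Y"
      and ch: "chain_map R X Y \<alpha>"
  shows "quasi_iso R (hom_complex R P X) (hom_complex R P Y) (hom_complex_map P \<alpha>) \<longleftrightarrow>
    (\<forall>n. lifts_along R P (shift n X) (shift n Y) (\<lambda>i. \<alpha> (i + n)))"
proof -
  let ?HX = "hom_complex R P X" and ?HY = "hom_complex R P Y"
  let ?r = "\<lambda>f i. restrict (f i) (carrier (obj P i))"
  note AX = hom_complex_additive[OF P X] note AY = hom_complex_additive[OF P Y]
  have e: "i + (n - 1) = i + n - 1" "i - 1 + n = i + n - 1" for i n :: int by simp_all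
  note a = hom_add[OF chain_mapD(1)[OF ch]]
  have map_in: "hom_complex_map P \<alpha> n f \<in> carrier (obj ?HY n)" if "f \<in> carrier (obj ?HX n)" for n f
    unfolding hom_complex_map_def
    by (rule restr_hom_carrier[OF P Y]
      module_hom_comp[OF hom_carrierD(1)[OF P X that] chain_mapD(1)[OF ch]])+
  have cm: "chain_map R ?HX ?HY (hom_complex_map P \<alpha>)"
    unfolding chain_map_def
  proof (intro allI conjI ballI)
    fix n
    interpret HX: abelian_group "obj ?HX n" by (rule hom_obj_abelian[OF P X])
    interpret HY: abelian_group "obj ?HY n" by (rule hom_obj_abelian[OF P Y])
    show "hom_complex_map P \<alpha> n \<in> module_hom R (obj ?HX n) (obj ?HY n)"
    proof (rule module_homI)
      fix f g assume f: "f \<in> carrier (obj ?HX n)" and g: "g \<in> carrier (obj ?HX n)"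
      show "hom_complex_map P \<alpha> n (f \<oplus>\<^bsub>obj ?HX n\<^esub> g) =
        hom_complex_map P \<alpha> n f \<oplus>\<^bsub>obj ?HY n\<^esub> hom_complex_map P \<alpha> n g"
        using hom_carrierD(3)[OF P X f] hom_carrierD(3)[OF P X g]
        by (auto simp: hom_complex_map_def hom_complex_def a intro!: ext restrict_ext)
    next
      fix r f assume r: "r \<in> carrier R" and f: "f \<in> carrier (obj ?HX n)"
      show "hom_complex_map P \<alpha> n (r \<odot>\<^bsub>obj ?HX n\<^esub> f) = r \<odot>\<^bsub>obj ?HY n\<^esub> hom_complex_map P \<alpha> n f"
        using r hom_carrierD(3)[OF P X f]
        by (auto simp: hom_complex_map_def hom_complex_def hom_smult[OF chain_mapD(1)[OF ch]]
            intro!: ext restrict_ext)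
    qed (rule map_in)
    fix f assume f: "f \<in> carrier (obj ?HX n)"
    show "diff ?HY n (hom_complex_map P \<alpha> n f) = hom_complex_map P \<alpha> (n - 1) (diff ?HX n f)"
    proof (rule hom_obj_eqI[OF P Y hom_diff_carrier[OF P Y map_in[OF f]]
      map_in[OF hom_diff_carrier[OF P X f]]])
      fix i p assume p: "p \<in> carrier (obj P i)"
      have dp: "diff P i p \<in> carrier (obj P (i - 1))" by (rule is_complexD(4)[OF P p])
      have c: "f i p \<in> carrier (obj X (i + n))"
        "f (i - 1) (diff P i p) \<in> carrier (obj X (i + n - 1))"
        using hom_carrierD(3)[OF P X f p] hom_carrierD(3)[OF P X f dp]
          by (simp_all add: algebra_simps)
      show "diff ?HY n (hom_complex_map P \<alpha> n f) i p =
          hom_complex_map P \<alpha> (n - 1) (diff ?HX n f) i p"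
        using p dp chain_mapD(3)[OF ch c(1)] c is_complexD(4)[OF X c(1)]
        by (simp add: hom_obj_ops[OF P X p] hom_obj_ops[OF P Y p] hom_complex_map_def e a
            hom_minus[OF is_complexD(1)[OF X] is_complexD(1)[OF Y] chain_mapD(1)[OF ch]])
    qed
  qed
  have "((\<forall>f\<in>cycles ?HX n. hom_complex_map P \<alpha> n f \<in> boundaries ?HY n \<longrightarrow> f \<in> boundaries ?HX n) \<and>
         (\<forall>h\<in>cycles ?HY n. \<exists>f\<in>cycles ?HX n. hom_complex_map P \<alpha> n f \<ominus>\<^bsub>obj ?HY n\<^esub> h \<in> boundaries ?HY
         n)) \<longleftrightarrow>
        lifts_along R P (shift n X) (shift n Y) (\<lambda>i. \<alpha> (i + n))" (is "?l1 \<and> ?l2 \<longleftrightarrow> _") for n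
  proof -
    have mapr: "hom_complex_map P \<alpha> n f = ?r (\<lambda>i x. \<alpha> (i + n) (f i x))" for f
      by (simp add: hom_complex_map_def)
    have rn': "null_homotopic R P (shift n X) (?r f) = null_homotopic R P (shift n X) f" for f
      by (rule null_homotopic_cong) simp
    have rc': "chain_map R P (shift n X) (?r f) = chain_map R P (shift n X) f" for f
      by (rule chain_map_cong[OF P]) simp
    have rn'': "null_homotopic R P (shift n Y) (?r f) = null_homotopic R P (shift n Y) f" for f
      by (rule null_homotopic_cong) simp
    have rc'': "chain_map R P (shift n Y) (?r f) = chain_map R P (shift n Y) f" for f
      by (rule chain_map_cong[OF P]) simp
    have l1: "?l1 \<longleftrightarrow> (\<forall>g. chain_map R P (shift n X) g \<and>
        null_homotopic R P (shift n Y) (\<lambda>i x. \<alpha> (i + n) (g i x)) \<longrightarrow>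
        null_homotopic R P (shift n X) g)"
      (is "_ \<longleftrightarrow> ?r1")
    proof
      assume l: ?l1
      show ?r1
      proof (intro allI impI)
        fix g assume g: "chain_map R P (shift n X) g \<and>
            null_homotopic R P (shift n Y) (\<lambda>i x. \<alpha> (i + n) (g i x))"
        have "null_homotopic R P (shift n Y) (?r (\<lambda>i x. \<alpha> (i + n) (?r g i x)))"
          using g null_homotopic_cong[of P "?r (\<lambda>i x. \<alpha> (i + n) (?r g i x))"
            "\<lambda>i x. \<alpha> (i + n) (g i x)"
              R "shift n Y"] by simp
        then have "?r g \<in> boundaries ?HX n"
          using g l[rule_format, of "?r g"]
          unfolding hom_cycles_iff[OF P X] hom_boundaries_iff[OF P X] hom_boundaries_iff[OF P Y]
            mapr rn' rc' by simp
        then show "null_homotopic R P (shift n X) g" unfolding hom_boundaries_iff[OF P X] rn'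
          by simp
      qed
    next
      assume ?r1
      then show ?l1
        unfolding hom_boundaries_iff[OF P X] hom_boundaries_iff[OF P Y] mapr rn''
        by (auto simp: hom_cycles_iff[OF P X])
    qed
    have minus: "(f \<ominus>\<^bsub>obj ?HY n\<^esub> h) = ?r (\<lambda>i x. f i x \<ominus>\<^bsub>obj Y (i + n)\<^esub> h i x)"
      if f: "f \<in> carrier (obj ?HY n)" and h: "h \<in> carrier (obj ?HY n)" for f h
    proof -
      interpret HY: abelian_group "obj ?HY n" by (rule hom_obj_abelian[OF P Y])
      have d: "?r (\<lambda>i x. f i x \<ominus>\<^bsub>obj Y (i + n)\<^esub> h i x) \<in> carrier (obj ?HY n)"
        by (intro restr_hom_carrier[OF P Y] module_hom_diff is_complexD(1)[OF Y]
          hom_carrierD(1)[OF P Y] f h)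
      have "f = ?r (\<lambda>i x. f i x \<ominus>\<^bsub>obj Y (i + n)\<^esub> h i x) \<oplus>\<^bsub>obj ?HY n\<^esub> h"
      proof (rule hom_obj_eqI[OF P Y f HY.a_closed[OF d h]])
        fix i p assume p: "p \<in> carrier (obj P i)"
        interpret A: abelian_group "obj Y (i + n)" by (rule is_complexD(5)[OF Y])
        show "f i p = (?r (\<lambda>i x. f i x \<ominus>\<^bsub>obj Y (i + n)\<^esub> h i x) \<oplus>\<^bsub>obj ?HY n\<^esub> h) i p"
          using p hom_carrierD(3)[OF P Y f p] hom_carrierD(3)[OF P Y h p]
          by (simp add: hom_obj_ops[OF P Y p] A.ag_normalize)
      qed
      then have "f \<ominus>\<^bsub>obj ?HY n\<^esub> h = (?r (\<lambda>i x. f i x \<ominus>\<^bsub>obj Y (i + n)\<^esub> h i x) \<oplus>\<^bsub>obj ?HY n\<^esub> h) \<ominus>\<^bsub>obj ?HY n\<^esub> h"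
        by simp
      then show ?thesis using d h by (simp add: HY.ag_normalize)
    qed
    have l2: "?l2 \<longleftrightarrow> (\<forall>h. chain_map R P (shift n Y) h \<longrightarrow> (\<exists>k. chain_map R P (shift n X) k \<and>
        null_homotopic R P (shift n Y) (\<lambda>i x. \<alpha> (i + n) (k i x) \<ominus>\<^bsub>obj (shift n Y) i\<^esub> h i x)))"
      (is "_ \<longleftrightarrow> ?r2")
    proof
      assume l: ?l2
      show ?r2
      proof (intro allI impI)
        fix h assume h: "chain_map R P (shift n Y) h"
        then have hc: "?r h \<in> cycles ?HY n" by (simp add: hom_cycles_iff[OF P Y] rc'')
        then obtain f where f: "f \<in> cycles ?HX n"
          "hom_complex_map P \<alpha> n f \<ominus>\<^bsub>obj ?HY n\<^esub> ?r h \<in> boundaries ?HY n"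
          using l by blast
        have "null_homotopic R P (shift n Y)
            (?r (\<lambda>i x. hom_complex_map P \<alpha> n f i x \<ominus>\<^bsub>obj Y (i + n)\<^esub> ?r h i x))"
          using f(2) minus[OF map_in[OF cycles_carrier[OF AX f(1)]] cycles_carrier[OF AY hc]]
          by (simp add: hom_boundaries_iff[OF P Y])
        then have "null_homotopic R P (shift n Y)
            (\<lambda>i x. \<alpha> (i + n) (f i x) \<ominus>\<^bsub>obj (shift n Y) i\<^esub> h i x)"
          by (rule null_homotopic_cong[THEN iffD1, rotated]) (simp add: hom_complex_map_def)
        then show "\<exists>k. chain_map R P (shift n X) k \<and>
          null_homotopic R P (shift n Y) (\<lambda>i x. \<alpha> (i + n) (k i x) \<ominus>\<^bsub>obj (shift n Y) i\<^esub> h i x)"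
          using f(1) unfolding hom_cycles_iff[OF P X] by blast
      qed
    next
      assume r: ?r2
      show ?l2
      proof
        fix h assume h: "h \<in> cycles ?HY n"
        then obtain k where k: "chain_map R P (shift n X) k"
          "null_homotopic R P (shift n Y) (\<lambda>i x. \<alpha> (i + n) (k i x) \<ominus>\<^bsub>obj (shift n Y) i\<^esub> h i x)"
          using r unfolding hom_cycles_iff[OF P Y] by blast
        have kc: "?r k \<in> cycles ?HX n" using k by (simp add: hom_cycles_iff[OF P X] rc')
        have "null_homotopic R P (shift n Y)
            (?r (\<lambda>i x. hom_complex_map P \<alpha> n (?r k) i x \<ominus>\<^bsub>obj Y (i + n)\<^esub> h i x))"
          using k(2) by (rule null_homotopic_cong[THEN iffD1, rotated])
            (simp add: hom_complex_map_def)
        then have "hom_complex_map P \<alpha> n (?r k) \<ominus>\<^bsub>obj ?HY n\<^esub> h \<in> boundaries ?HY n"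
          using minus[OF map_in[OF cycles_carrier[OF AX kc]] cycles_carrier[OF AY h]]
          by (simp add: hom_boundaries_iff[OF P Y])
        with kc show "\<exists>f\<in>cycles ?HX n. hom_complex_map P \<alpha> n f \<ominus>\<^bsub>obj ?HY n\<^esub> h \<in> boundaries ?HY n"
          by blast
      qed
    qed
    show ?thesis unfolding lifts_along_def l1 l2 ..
  qed
  then show ?thesis unfolding quasi_iso_iff[OF AX AY cm] by simp
qed

lemma quasi_iso_shift:
  assumes X: "is_complex R X" and Y: "is_complex R Y" and q: "quasi_iso R X Y \<alpha>"
  shows "quasi_iso R (shift n X) (shift n Y) (\<lambda>i. \<alpha> (i + n))"
  by (rule quasi_isoI) (use X Y quasi_isoD[OF X Y q] in
    \<open>auto simp: cycles_shift boundaries_shift intro!: is_complex_shift chain_map_shift\<close>)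

section \<open>Comparison of resolutions\<close>

lemma null_homotopic_post:
  assumes X: "is_complex R X" and Y: "is_complex R Y"
    and P: "is_complex R P" and null: "null_homotopic R P X f" and a: "chain_map R X Y \<alpha>"
  shows "null_homotopic R P Y (\<lambda>i x. \<alpha> i (f i x))"
proof -
  obtain h where h: "\<And>i. h i \<in> module_hom R (obj P i) (obj X (i + 1))"
    and f: "\<And>i x. x \<in> carrier (obj P i) \<Longrightarrow>
      f i x = diff X (i + 1) (h i x) \<oplus>\<^bsub>obj X i\<^esub> h (i - 1) (diff P i x)"
    using null unfolding null_homotopic_def by blast
  show ?thesis unfolding null_homotopic_def
  proof (intro exI[of _ "\<lambda>i x. \<alpha> (i + 1) (h i x)"] allI conjI ballI)
    fix i
    show "(\<lambda>x. \<alpha> (i + 1) (h i x)) \<in> module_hom R (obj P i) (obj Y (i + 1))"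
      by (rule module_hom_comp[OF h chain_mapD(1)[OF a]])
    fix x assume x: "x \<in> carrier (obj P i)"
    have hx: "h i x \<in> carrier (obj X (i + 1))" by (rule hom_closed[OF h x])
    have hd: "h (i - 1) (diff P i x) \<in> carrier (obj X i)"
      using hom_closed[OF h is_complexD(4)[OF P x]] by simp
    show "\<alpha> i (f i x) = diff Y (i + 1) (\<alpha> (i + 1) (h i x)) \<oplus>\<^bsub>obj Y i\<^esub> \<alpha> (i - 1 + 1)
        (h (i - 1) (diff P i x))"
      using hd diff_diff(2)[OF X hx] chain_mapD(3)[OF a hx]
      by (simp add: f[OF x] hom_add[OF chain_mapD(1)[OF a]])
  qed
qed

lemma null_homotopic_pre:
  assumes P: "is_complex R P" and u: "chain_map R P' P u" and P': "is_complex R P'"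
    and X: "is_complex R X" and null: "null_homotopic R P X f"
  shows "null_homotopic R P' X (\<lambda>i x. f i (u i x))"
proof -
  obtain h where h: "\<And>i. h i \<in> module_hom R (obj P i) (obj X (i + 1))"
    and f: "\<And>i x. x \<in> carrier (obj P i) \<Longrightarrow>
      f i x = diff X (i + 1) (h i x) \<oplus>\<^bsub>obj X i\<^esub> h (i - 1) (diff P i x)"
    using null unfolding null_homotopic_def by blast
  show ?thesis unfolding null_homotopic_def
    by (intro exI[of _ "\<lambda>i x. h i (u i x)"] allI conjI ballI
      module_hom_comp[OF chain_mapD(1)[OF u] h])
      (simp add: f chain_mapD(2,3)[OF u])
qed

lemma null_homotopic_diff:
  assumes X: "is_complex R X" and P: "is_complex R P"
    and f: "null_homotopic R P X f" and g: "null_homotopic R P X g"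
  shows "null_homotopic R P X (\<lambda>i x. f i x \<ominus>\<^bsub>obj X i\<^esub> g i x)"
proof -
  obtain h where h: "\<And>i. h i \<in> module_hom R (obj P i) (obj X (i + 1))"
    and f: "\<And>i x. x \<in> carrier (obj P i) \<Longrightarrow>
      f i x = diff X (i + 1) (h i x) \<oplus>\<^bsub>obj X i\<^esub> h (i - 1) (diff P i x)"
    using f unfolding null_homotopic_def by blast
  obtain k where k: "\<And>i. k i \<in> module_hom R (obj P i) (obj X (i + 1))"
    and g: "\<And>i x. x \<in> carrier (obj P i) \<Longrightarrow>
      g i x = diff X (i + 1) (k i x) \<oplus>\<^bsub>obj X i\<^esub> k (i - 1) (diff P i x)"
    using g unfolding null_homotopic_def by blast
  show ?thesis unfolding null_homotopic_def
  proof (intro exI[of _ "\<lambda>i x. h i x \<ominus>\<^bsub>obj X (i + 1)\<^esub> k i x"] allI conjI ballI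
      module_hom_diff is_complexD(1)[OF X] h k)
    fix i x assume x: "x \<in> carrier (obj P i)"
    interpret A: abelian_group "obj X i" by (rule is_complexD(5)[OF X])
    have hx: "h i x \<in> carrier (obj X (i + 1))" "k i x \<in> carrier (obj X (i + 1))"
      by (rule hom_closed[OF h x] hom_closed[OF k x])+
    have hd: "h (i - 1) (diff P i x) \<in> carrier (obj X i)"
      "k (i - 1) (diff P i x) \<in> carrier (obj X i)"
      using hom_closed[OF h is_complexD(4)[OF P x]] hom_closed[OF k is_complexD(4)[OF P x]]
        by simp_all
    show "f i x \<ominus>\<^bsub>obj X i\<^esub> g i x = diff X (i + 1) (h i x \<ominus>\<^bsub>obj X (i + 1)\<^esub> k i x) \<oplus>\<^bsub>obj X i\<^esub>
        (h (i - 1) (diff P i x) \<ominus>\<^bsub>obj X (i - 1 + 1)\<^esub> k (i - 1) (diff P i x))"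
      using hx hd diff_diff(2)[OF X hx(1)] diff_diff(2)[OF X hx(2)]
      by (simp add: f[OF x] g[OF x]
        hom_minus[OF is_complexD(1)[OF X] is_complexD(1)[OF X] diff_hom[OF X]] A.ag_normalize)
  qed
qed

lemma chain_map_diff:
  assumes X: "is_complex R X" and P: "is_complex R P" and f: "chain_map R P X f"
      and g: "chain_map R P X g"
  shows "chain_map R P X (\<lambda>i x. f i x \<ominus>\<^bsub>obj X i\<^esub> g i x)"
  unfolding chain_map_def
  by (intro allI conjI ballI module_hom_diff is_complexD(1)[OF X] chain_mapD(1)[OF f]
    chain_mapD(1)[OF g])
    (simp add: hom_minus[OF is_complexD(1)[OF X] is_complexD(1)[OF X] is_complexD(2)[OF X]]
      chain_mapD(2,3)[OF f] chain_mapD(2,3)[OF g])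

lemma chain_map_id: "chain_map R X X (\<lambda>i x. x)"
  by (simp add: chain_map_def module_hom_id)

text \<open>
  Lifting gives comparison maps \<open>v : P \<rightarrow> P'\<close> and \<open>u : P' \<rightarrow> P\<close> over \<open>M\<close>, up to homotopy.  Then
  \<open>\<pi> (1 - u v)\<close> is null homotopic, and so is \<open>1 - u v\<close>, since lifts along \<open>\<pi>\<close> are unique up to
  homotopy.  Hence a map \<open>f\<close> on \<open>P\<close> is homotopic to \<open>f u v\<close>, and \<open>f u\<close> is null homotopic by assumption.
\<close>

lemma homs_null_transfer:
  assumes P: "is_complex R P" and P': "is_complex R P'" and M: "is_complex R M"
      and X: "is_complex R X"
    and pi: "chain_map R P M \<pi>" and pi': "chain_map R P' M \<pi>'"
    and l1: "lifts_along R P P M \<pi>" and l2: "lifts_along R P P' M \<pi>'"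
        and l3: "lifts_along R P' P M \<pi>"
    and null: "homs_null R P' X"
  shows "homs_null R P X"
proof -
  obtain v where v: "chain_map R P P' v"
    and vn: "null_homotopic R P M (\<lambda>i x. \<pi>' i (v i x) \<ominus>\<^bsub>obj M i\<^esub> \<pi> i x)"
    using l2 pi unfolding lifts_along_def by blast
  obtain u where u: "chain_map R P' P u"
    and un: "null_homotopic R P' M (\<lambda>i x. \<pi> i (u i x) \<ominus>\<^bsub>obj M i\<^esub> \<pi>' i x)"
    using l3 pi' unfolding lifts_along_def by blast
  let ?w = "\<lambda>i x. x \<ominus>\<^bsub>obj P i\<^esub> u i (v i x)"
  have uv: "chain_map R P P (\<lambda>i x. u i (v i x))" by (rule chain_map_comp[OF v u])
  have w: "chain_map R P P ?w" by (rule chain_map_diff[OF P P chain_map_id uv])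
  have mzero: "null_homotopic R P M (\<lambda>i x. \<zero>\<^bsub>obj M i\<^esub>)"
    unfolding null_homotopic_def
  proof (intro exI[of _ "\<lambda>i x. \<zero>\<^bsub>obj M (i + 1)\<^esub>"] allI conjI ballI module_hom_zero
    is_complexD(1)[OF M])
    fix i x
    interpret A: abelian_group "obj M i" by (rule is_complexD(5)[OF M])
    show "\<zero>\<^bsub>obj M i\<^esub> = diff M (i + 1) \<zero>\<^bsub>obj M (i + 1)\<^esub> \<oplus>\<^bsub>obj M i\<^esub> \<zero>\<^bsub>obj M (i - 1 + 1)\<^esub>"
      using hom_zero[OF is_complexD(1)[OF M] is_complexD(1)[OF M] diff_hom[OF M]] by simp
  qed
  have n1: "null_homotopic R P M (\<lambda>i x. \<pi> i (u i (v i x)) \<ominus>\<^bsub>obj M i\<^esub> \<pi>' i (v i x))"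
    by (rule null_homotopic_pre[OF P' v P M un])
  have n2: "null_homotopic R P M (\<lambda>i x. (\<zero>\<^bsub>obj M i\<^esub> \<ominus>\<^bsub>obj M i\<^esub> (\<pi>' i (v i x) \<ominus>\<^bsub>obj M i\<^esub> \<pi> i x))
      \<ominus>\<^bsub>obj M i\<^esub> (\<pi> i (u i (v i x)) \<ominus>\<^bsub>obj M i\<^esub> \<pi>' i (v i x)))"
    by (rule null_homotopic_diff[OF M P null_homotopic_diff[OF M P mzero vn] n1])
  have "null_homotopic R P M (\<lambda>i x. \<pi> i (?w i x))"
  proof (rule null_homotopic_cong[THEN iffD1, OF _ n2])
    fix i x assume x: "x \<in> carrier (obj P i)"
    interpret A: abelian_group "obj M i" by (rule is_complexD(5)[OF M])
    have c: "\<pi> i (u i (v i x)) \<in> carrier (obj M i)" "\<pi>' i (v i x) \<in> carrier (obj M i)"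
      "\<pi> i x \<in> carrier (obj M i)"
      using x chain_mapD(2)[OF pi] chain_mapD(2)[OF pi'] chain_mapD(2)[OF u] chain_mapD(2)[OF v]
        by simp_all
    have e: "\<pi> i (?w i x) = \<pi> i x \<ominus>\<^bsub>obj M i\<^esub> \<pi> i (u i (v i x))"
      using x chain_mapD(2)[OF uv]
      by (simp add: chain_map_zero_minus[OF is_complex_additive[OF P] is_complex_additive[OF M] pi])
    show "(\<zero>\<^bsub>obj M i\<^esub> \<ominus>\<^bsub>obj M i\<^esub> (\<pi>' i (v i x) \<ominus>\<^bsub>obj M i\<^esub> \<pi> i x))
      \<ominus>\<^bsub>obj M i\<^esub> (\<pi> i (u i (v i x)) \<ominus>\<^bsub>obj M i\<^esub> \<pi>' i (v i x)) = \<pi> i (?w i x)"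
      using c by (simp add: e A.ag_normalize)
  qed
  then have wn: "null_homotopic R P P ?w" using w l1 unfolding lifts_along_def by blast
  show ?thesis unfolding homs_null_def
  proof (intro allI impI)
    fix f assume f: "chain_map R P X f"
    have "null_homotopic R P' X (\<lambda>i x. f i (u i x))"
      using null chain_map_comp[OF u f] unfolding homs_null_def by blast
    then have a: "null_homotopic R P X (\<lambda>i x. f i (u i (v i x)))"
      by (rule null_homotopic_pre[OF P' v P X])
    have b: "null_homotopic R P X (\<lambda>i x. f i (?w i x))" by (rule null_homotopic_post[OF P X P wn f])
    \<comment> \<open>the sum of \<open>f (1 - u v)\<close> and \<open>f u v\<close>, written with differences as \<open>x - ((y - y) - y)\<close>\<close>
    have z: "null_homotopic R P X (\<lambda>i x. f i (u i (v i x)) \<ominus>\<^bsub>obj X i\<^esub> f i (u i (v i x)))"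
      by (rule null_homotopic_diff[OF X P a a])
    have "null_homotopic R P X (\<lambda>i x. f i (?w i x) \<ominus>\<^bsub>obj X i\<^esub>
        ((f i (u i (v i x)) \<ominus>\<^bsub>obj X i\<^esub> f i (u i (v i x))) \<ominus>\<^bsub>obj X i\<^esub> f i (u i (v i x))))"
      by (rule null_homotopic_diff[OF X P b null_homotopic_diff[OF X P z a]])
    then show "null_homotopic R P X f"
    proof (rule null_homotopic_cong[THEN iffD1, rotated])
      fix i x assume x: "x \<in> carrier (obj P i)"
      interpret A: abelian_group "obj X i" by (rule is_complexD(5)[OF X])
      have c: "f i x \<in> carrier (obj X i)" "f i (u i (v i x)) \<in> carrier (obj X i)"
        using x chain_mapD(2)[OF f] chain_mapD(2)[OF uv] by simp_all
      show "f i (?w i x) \<ominus>\<^bsub>obj X i\<^esub>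
        ((f i (u i (v i x)) \<ominus>\<^bsub>obj X i\<^esub> f i (u i (v i x))) \<ominus>\<^bsub>obj X i\<^esub> f i (u i (v i x))) = f i x"
        using c x chain_mapD(2)[OF uv]
        by (simp add: chain_map_zero_minus[OF is_complex_additive[OF P] is_complex_additive[OF X] f]
          A.ag_normalize)
    qed
  qed
qed

section \<open>Mapping cones and lifting along quasiisomorphisms\<close>

definition bounded_below_fp :: "('a, 'r) ring_scheme \<Rightarrow> ('a, 'p) cpx \<Rightarrow> int \<Rightarrow> bool" where
  "bounded_below_fp R F a \<longleftrightarrow> is_complex R F \<and> (\<forall>i. finite_projective R (obj F i)) \<and>
     (\<forall>i<a. zero_module (obj F i))"

text \<open>
  The null homotopy \<open>k\<close> is constructed degree by degree, starting where \<open>F\<close> vanishes: \<open>f - k d\<close> takes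
  values in cycles, which are boundaries, and thus lifts through the differential of \<open>X\<close>.
\<close>

lemma acyclic_homs_null:
  assumes bb: "bounded_below_fp R F a" and X: "is_complex R X"
      and acyclic: "\<And>i. cycles X i \<subseteq> boundaries X i"
  shows "homs_null R F X"
  unfolding homs_null_def
proof (intro allI impI)
  have F: "is_complex R F" and fp: "\<And>i. finite_projective R (obj F i)"
    and zF: "\<And>i. i < a \<Longrightarrow> zero_module (obj F i)" using bb by (auto simp: bounded_below_fp_def)
  note FM = is_complexD(1)[OF F] and XM = is_complexD(1)[OF X]
  fix f assume f: "chain_map R F X f"
  note fz = hom_zero[OF FM XM chain_mapD(1)[OF f]]
  define deg where "deg = (\<lambda>m::nat. a - 1 + int m)"
  let ?P = "\<lambda>i k. k \<in> module_hom R (obj F i) (obj X (i + 1)) \<and>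
      (\<forall>y\<in>cycles F i. f i y = diff X (i + 1) (k y))"
  let ?Q = "\<lambda>i k' k. \<forall>x\<in>carrier (obj F i). f i x = diff X (i + 1) (k x) \<oplus>\<^bsub>obj X i\<^esub> k' (diff F i x)"
  have "\<exists>s. \<forall>m. ?P (deg m) (s m) \<and> ?Q (deg m + 1) (s m) (s (Suc m))"
  proof (rule dependent_nat_choice)
    have "f i y = diff X (i + 1) \<zero>\<^bsub>obj X (i + 1)\<^esub>" if "i < a" "y \<in> cycles F i" for i y
    proof -
      have y: "y = \<zero>\<^bsub>obj F i\<^esub>" by (rule zero_moduleD[OF zF]) (use that in \<open>simp_all add: cycles_def\<close>)
      show ?thesis unfolding y fz hom_zero[OF XM XM diff_hom[OF X]] ..
    qed
    moreover have "deg 0 < a" by (simp add: deg_def)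
    ultimately show "\<exists>k. ?P (deg 0) k" using module_hom_zero[OF XM] by blast
  next
    fix k' m assume k': "?P (deg m) k'"
    let ?i = "deg m + 1"
    have Suc: "deg (Suc m) = ?i" by (simp add: deg_def)
    interpret A: abelian_group "obj X ?i" by (rule is_complexD(5)[OF X])
    have kd: "(\<lambda>x. k' (diff F ?i x)) \<in> module_hom R (obj F ?i) (obj X ?i)"
      by (rule module_hom_comp[OF diff_hom[OF F] conjunct1[OF k']])
    have "\<exists>k\<in>module_hom R (obj F ?i) (obj X (?i + 1)).
        \<forall>x\<in>carrier (obj F ?i). diff X (?i + 1) (k x) = f ?i x \<ominus>\<^bsub>obj X ?i\<^esub> k' (diff F ?i x)"
    proof (rule finite_projective_lift[OF fp XM XM diff_hom[OF X]
      module_hom_diff[OF XM chain_mapD(1)[OF f] kd]])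
      fix x assume x: "x \<in> carrier (obj F ?i)"
      have dx: "diff F ?i x \<in> cycles F (deg m)" using diff_diff[OF F x] by (simp add: cycles_def)
      have c: "f ?i x \<in> carrier (obj X ?i)" "k' (diff F ?i x) \<in> carrier (obj X ?i)"
        using chain_mapD(2)[OF f x] hom_closed[OF kd x] by auto
      have "diff X ?i (f ?i x) = f (deg m) (diff F ?i x)" using chain_mapD(3)[OF f x] by simp
      also have "\<dots> = diff X ?i (k' (diff F ?i x))" using k' dx by blast
      finally have "f ?i x \<ominus>\<^bsub>obj X ?i\<^esub> k' (diff F ?i x) \<in> cycles X ?i"
        using c is_complexD(4)[OF X c(2)]
        by (simp add: cycles_def hom_minus[OF XM XM is_complexD(2)[OF X]]
          ag_minus_eq_zero[OF is_complexD(5)[OF X]])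
      then obtain u where "u \<in> carrier (obj X (?i + 1))"
        "f ?i x \<ominus>\<^bsub>obj X ?i\<^esub> k' (diff F ?i x) = diff X (?i + 1) u"
        using acyclic[of ?i] unfolding boundaries_def by blast
      then show "\<exists>u\<in>carrier (obj X (?i + 1)). diff X (?i + 1) u = f ?i x \<ominus>\<^bsub>obj X ?i\<^esub> k' (diff F ?i x)"
        by (intro bexI[of _ u]) simp_all
    qed
    then obtain k where k: "k \<in> module_hom R (obj F ?i) (obj X (?i + 1))"
      "\<And>x. x \<in> carrier (obj F ?i) \<Longrightarrow> diff X (?i + 1) (k x) = f ?i x \<ominus>\<^bsub>obj X ?i\<^esub> k' (diff F ?i x)"
        by blast
    have Q: "f ?i x = diff X (?i + 1) (k x) \<oplus>\<^bsub>obj X ?i\<^esub> k' (diff F ?i x)" if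
      x: "x \<in> carrier (obj F ?i)" for x
      unfolding k(2)[OF x] using chain_mapD(2)[OF f x] hom_closed[OF kd x]
        by (simp add: A.ag_normalize)
    have "f ?i y = diff X (?i + 1) (k y)" if y: "y \<in> cycles F ?i" for y
    proof -
      have yF: "y \<in> carrier (obj F ?i)" and "diff F ?i y = \<zero>\<^bsub>obj F (deg m)\<^esub>" using y
        by (auto simp: cycles_def)
      then show ?thesis using Q[OF yF] hom_zero[OF FM XM conjunct1[OF k']]
        diff_diff(2)[OF X hom_closed[OF k(1) yF]]
        by simp
    qed
    with k(1) Q show "\<exists>k. ?P (deg (Suc m)) k \<and> ?Q ?i k' k" unfolding Suc by blast
  qed
  then obtain s where s: "\<forall>m. ?P (deg m) (s m) \<and> ?Q (deg m + 1) (s m) (s (Suc m))" by (rule exE)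
  define k where "k = (\<lambda>i. if a - 1 \<le> i then s (nat (i - a + 1)) else (\<lambda>x. \<zero>\<^bsub>obj X (i + 1)\<^esub>))"
  have k: "k i \<in> module_hom R (obj F i) (obj X (i + 1))" for i
  proof (cases "a - 1 \<le> i")
    case True
    then have d: "deg (nat (i - a + 1)) = i" by (simp add: deg_def)
    show ?thesis using s[rule_format, of "nat (i - a + 1)"] True unfolding d by (simp add: k_def)
  qed (simp add: k_def module_hom_zero[OF XM])
  have "?Q i (k (i - 1)) (k i)" for i
  proof (cases "a \<le> i")
    case True
    then have "nat (i - a + 1) = Suc (nat (i - a))" by simp
    with True have d: "deg (nat (i - a)) + 1 = i" "k (i - 1) = s (nat (i - a))"
      "k i = s (Suc (nat (i - a)))"
      by (simp_all add: deg_def k_def)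
    show ?thesis using s[rule_format, of "nat (i - a)"] unfolding d by blast
  next
    case False
    have k': "k (i - 1) \<in> module_hom R (obj F (i - 1)) (obj X i)" using k[of "i - 1"] by simp
    interpret A: abelian_group "obj X i" by (rule is_complexD(5)[OF X])
    show ?thesis
    proof
      fix x assume "x \<in> carrier (obj F i)"
      then have x: "x = \<zero>\<^bsub>obj F i\<^esub>" using zero_moduleD[OF zF] False by simp
      show "f i x = diff X (i + 1) (k i x) \<oplus>\<^bsub>obj X i\<^esub> k (i - 1) (diff F i x)"
        unfolding x by (simp add: fz hom_zero[OF FM XM k] hom_zero[OF FM XM k']
            hom_zero[OF FM FM is_complexD(2)[OF F]] hom_zero[OF XM XM diff_hom[OF X]])
    qed
  qed
  with k show "null_homotopic R F X f" unfolding null_homotopic_def by blast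
qed

definition prod_module :: "('a, 'm) module \<Rightarrow> ('a, 'n) module \<Rightarrow> ('a, 'm \<times> 'n) module" where
  "prod_module A B = \<lparr>carrier = carrier A \<times> carrier B, mult = undefined, one = undefined,
     zero = (\<zero>\<^bsub>A\<^esub>, \<zero>\<^bsub>B\<^esub>), add = (\<lambda>p q. (fst p \<oplus>\<^bsub>A\<^esub> fst q, snd p \<oplus>\<^bsub>B\<^esub> snd q)),
     smult = (\<lambda>r p. (r \<odot>\<^bsub>A\<^esub> fst p, r \<odot>\<^bsub>B\<^esub> snd p))\<rparr>"

lemma prod_module:
  assumes A: "module R A" and B: "module R B" shows "module R (prod_module A B)"
proof -
  interpret A: module R A by fact
  interpret B: module R B by fact
  show ?thesis
  proof (rule moduleI)
    show "cring R" by (rule A.R.is_cring)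
    show "abelian_group (prod_module A B)"
    proof (rule abelian_groupI)
      fix p assume "p \<in> carrier (prod_module A B)"
      then show "\<exists>q\<in>carrier (prod_module A B). q \<oplus>\<^bsub>prod_module A B\<^esub> p = \<zero>\<^bsub>prod_module A B\<^esub>"
        by (intro bexI[of _ "(\<ominus>\<^bsub>A\<^esub> fst p, \<ominus>\<^bsub>B\<^esub> snd p)"]) (auto simp: prod_module_def A.l_neg B.l_neg)
    qed (auto simp: prod_module_def A.a_ac B.a_ac)
  qed (auto simp: prod_module_def A.smult_l_distr A.smult_r_distr A.smult_assoc1
      B.smult_l_distr B.smult_r_distr B.smult_assoc1)
qed

lemma module_hom_prod_iff:
  "f \<in> module_hom R P (prod_module A B) \<longleftrightarrow>
     (\<lambda>x. fst (f x)) \<in> module_hom R P A \<and> (\<lambda>x. snd (f x)) \<in> module_hom R P B"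
  by (auto simp: module_hom_def prod_module_def Pi_def mem_Times_iff prod_eq_iff)

definition cone :: "('a, 'm) cpx \<Rightarrow> ('a, 'n) cpx \<Rightarrow> (int \<Rightarrow> 'm \<Rightarrow> 'n) \<Rightarrow> ('a, 'm \<times> 'n) cpx" where
  "cone X Y \<alpha> = \<lparr>obj = (\<lambda>i. prod_module (obj X (i - 1)) (obj Y i)),
     diff = (\<lambda>i p. (\<ominus>\<^bsub>obj X (i - 2)\<^esub> diff X (i - 1) (fst p),
                    \<alpha> (i - 1) (fst p) \<oplus>\<^bsub>obj Y (i - 1)\<^esub> diff Y i (snd p)))\<rparr>"

context
  fixes R :: "('a, 'r) ring_scheme" and X :: "('a, 'm) cpx" and Y :: "('a, 'n) cpx"
      and \<alpha> :: "int \<Rightarrow> 'm \<Rightarrow> 'n"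
  assumes X: "is_complex R X" and Y: "is_complex R Y"
begin

lemma cone_complex:
  assumes ch: "chain_map R X Y \<alpha>" shows "is_complex R (cone X Y \<alpha>)"
proof (rule is_complexI)
  note XM = is_complexD(1)[OF X] and YM = is_complexD(1)[OF Y]
  fix i
  show "module R (obj (cone X Y \<alpha>) i)" by (simp add: cone_def prod_module XM YM)
  have fst: "fst \<in> module_hom R (obj (cone X Y \<alpha>) i) (obj X (i - 1))"
    and snd: "snd \<in> module_hom R (obj (cone X Y \<alpha>) i) (obj Y i)"
    by (auto simp: cone_def prod_module_def intro!: module_homI)
  have dX: "diff X (i - 1) \<in> module_hom R (obj X (i - 1)) (obj X (i - 2))"
    using is_complexD(2)[OF X, of "i - 1"] by simp
  have c: "obj (cone X Y \<alpha>) (i - 1) = prod_module (obj X (i - 2)) (obj Y (i - 1))"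
    by (simp add: cone_def)
  have d: "diff (cone X Y \<alpha>) i = (\<lambda>p. (\<ominus>\<^bsub>obj X (i - 2)\<^esub> diff X (i - 1) (fst p),
      \<alpha> (i - 1) (fst p) \<oplus>\<^bsub>obj Y (i - 1)\<^esub> diff Y i (snd p)))" by (simp add: cone_def)
  show "diff (cone X Y \<alpha>) i \<in> module_hom R (obj (cone X Y \<alpha>) i) (obj (cone X Y \<alpha>) (i - 1))"
    unfolding c d module_hom_prod_iff fst_conv snd_conv
    by (intro conjI module_hom_uminus module_hom_add XM YM module_hom_comp[OF fst dX]
        module_hom_comp[OF fst chain_mapD(1)[OF ch]] module_hom_comp[OF snd is_complexD(2)[OF Y]])
  fix p assume "p \<in> carrier (obj (cone X Y \<alpha>) i)"
  then have x: "fst p \<in> carrier (obj X (i - 1))" and y: "snd p \<in> carrier (obj Y i)"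
    by (auto simp: cone_def prod_module_def)
  have dx: "diff X (i - 1) (fst p) \<in> carrier (obj X (i - 2))"
    and ddx: "diff X (i - 2) (diff X (i - 1) (fst p)) = \<zero>\<^bsub>obj X (i - 3)\<^esub>"
    using is_complexD(3,4)[OF X x] by simp_all
  interpret A: abelian_group "obj Y (i - 2)" by (rule is_complexD(5)[OF Y])
  have dX': "diff X (i - 2) \<in> module_hom R (obj X (i - 2)) (obj X (i - 3))"
    and dY': "diff Y (i - 1) \<in> module_hom R (obj Y (i - 1)) (obj Y (i - 2))"
    using is_complexD(2)[OF X, of "i - 2"] is_complexD(2)[OF Y, of "i - 1"] by simp_all
  have cX: "\<alpha> (i - 2) (diff X (i - 1) (fst p)) \<in> carrier (obj Y (i - 2))"
    by (rule chain_mapD(2)[OF ch dx])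
  have "diff Y (i - 1) (\<alpha> (i - 1) (fst p)) = \<alpha> (i - 2) (diff X (i - 1) (fst p))"
    using chain_mapD(3)[OF ch x] by simp
  moreover have "\<ominus>\<^bsub>obj X (i - 3)\<^esub> \<zero>\<^bsub>obj X (i - 3)\<^esub> = \<zero>\<^bsub>obj X (i - 3)\<^esub>"
    by (rule ag_uminus_zero[OF is_complexD(5)[OF X]])
  ultimately show "diff (cone X Y \<alpha>) (i - 1) (diff (cone X Y \<alpha>) i p) = \<zero>\<^bsub>obj (cone X Y \<alpha>) (i - 2)\<^esub>"
    using dx ddx cX is_complexD(3)[OF Y y] is_complexD(4)[OF Y y] chain_mapD(2)[OF ch x]
    by (simp add: cone_def prod_module_def hom_uminus[OF XM XM dX']
      hom_uminus[OF XM YM chain_mapD(1)[OF ch]]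
        hom_add[OF dY'] A.l_neg)
qed

text \<open>
  For a cycle \<open>(x, y)\<close> we have \<open>d x = 0\<close> and \<open>\<alpha> x = - d y\<close>, so \<open>x = d u\<close> because \<open>\<alpha>\<close> is injective on
  homology.  Now \<open>\<alpha> u + y\<close> is a cycle; as \<open>\<alpha>\<close> is surjective on homology, it is \<open>\<alpha> z - d v\<close> for some
  cycle \<open>z\<close>.  Then \<open>(x, y)\<close> is the boundary of \<open>(z - u, - v)\<close>.
\<close>

lemma cone_acyclic:
  assumes q: "quasi_iso R X Y \<alpha>"
  shows "cycles (cone X Y \<alpha>) i \<subseteq> boundaries (cone X Y \<alpha>) i"
proof
  note XM = is_complexD(1)[OF X] and YM = is_complexD(1)[OF Y] and ch = quasi_isoD(1)[OF X Y q]
  interpret A: module R "obj Y i" by (rule YM)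
  interpret B: module R "obj X (i - 1)" by (rule XM)
  fix p assume p: "p \<in> cycles (cone X Y \<alpha>) i"
  define x y where "x = fst p" and "y = snd p"
  have x: "x \<in> carrier (obj X (i - 1))" and y: "y \<in> carrier (obj Y i)"
    and ux: "\<ominus>\<^bsub>obj X (i - 2)\<^esub> diff X (i - 1) x = \<zero>\<^bsub>obj X (i - 2)\<^esub>"
    and axy: "\<alpha> (i - 1) x \<oplus>\<^bsub>obj Y (i - 1)\<^esub> diff Y i y = \<zero>\<^bsub>obj Y (i - 1)\<^esub>"
    using p by (auto simp: cycles_def cone_def prod_module_def x_def y_def)
  have dx: "diff X (i - 1) x \<in> carrier (obj X (i - 2))" using is_complexD(4)[OF X x] by simp
  have xc: "x \<in> cycles X (i - 1)"
    using ux x ag_uminus_eq_zero[OF is_complexD(5)[OF X] dx] by (simp add: cycles_def)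
  have ax: "\<alpha> (i - 1) x \<in> carrier (obj Y (i - 1))" by (rule chain_mapD(2)[OF ch x])
  have dy: "diff Y i y \<in> carrier (obj Y (i - 1))" by (rule is_complexD(4)[OF Y y])
  have "\<ominus>\<^bsub>obj Y (i - 1)\<^esub> diff Y i y = \<alpha> (i - 1) x"
    using axy ag_add_eq_zero[OF is_complexD(5)[OF Y] dy ax]
      abelian_group.axioms(1)[OF is_complexD(5)[OF Y]]
    by (simp add: abelian_monoid.a_comm[OF _ dy ax])
  then have "\<alpha> (i - 1) x = diff Y i (\<ominus>\<^bsub>obj Y i\<^esub> y)" using hom_uminus[OF YM YM is_complexD(2)[OF Y] y]
    by simp
  then have "\<alpha> (i - 1) x \<in> boundaries Y (i - 1)" using y by (simp add: boundaries_def)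
  then have "x \<in> boundaries X (i - 1)" by (rule quasi_isoD(2)[OF X Y q xc])
  then obtain u where u: "u \<in> carrier (obj X i)" "x = diff X i u" by (auto simp: boundaries_def)
  have au: "\<alpha> i u \<in> carrier (obj Y i)" by (rule chain_mapD(2)[OF ch u(1)])
  have "diff Y i (\<alpha> i u \<oplus>\<^bsub>obj Y i\<^esub> y) = \<zero>\<^bsub>obj Y (i - 1)\<^esub>"
    using axy chain_mapD(3)[OF ch u(1)] u(2) by (simp add: hom_add[OF is_complexD(2)[OF Y] au y])
  then have "\<alpha> i u \<oplus>\<^bsub>obj Y i\<^esub> y \<in> cycles Y i" using au y by (simp add: cycles_def)
  from quasi_isoD(3)[OF X Y q this] obtain z v where z: "z \<in> cycles X i"
    and v: "v \<in> carrier (obj Y (i + 1))" "\<alpha> i z \<ominus>\<^bsub>obj Y i\<^esub> (\<alpha> i u \<oplus>\<^bsub>obj Y i\<^esub> y) = diff Y (i + 1) v"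
    by (auto simp: boundaries_def)
  have zc: "z \<in> carrier (obj X i)" "diff X i z = \<zero>\<^bsub>obj X (i - 1)\<^esub>" using z by (auto simp: cycles_def)
  have az: "\<alpha> i z \<in> carrier (obj Y i)" by (rule chain_mapD(2)[OF ch zc(1)])
  interpret X1: module R "obj X i" by (rule XM)
  interpret Y1: module R "obj Y (i + 1)" by (rule YM)
  have 1: "\<ominus>\<^bsub>obj X (i - 1)\<^esub> diff X i (z \<ominus>\<^bsub>obj X i\<^esub> u) = x"
    using x zc u by (simp add: hom_minus[OF XM XM is_complexD(2)[OF X]] B.ag_normalize)
  have "\<alpha> i (z \<ominus>\<^bsub>obj X i\<^esub> u) \<oplus>\<^bsub>obj Y i\<^esub> diff Y (i + 1) (\<ominus>\<^bsub>obj Y (i + 1)\<^esub> v) =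
      (\<alpha> i z \<ominus>\<^bsub>obj Y i\<^esub> \<alpha> i u) \<oplus>\<^bsub>obj Y i\<^esub> \<ominus>\<^bsub>obj Y i\<^esub> (\<alpha> i z \<ominus>\<^bsub>obj Y i\<^esub> (\<alpha> i u \<oplus>\<^bsub>obj Y i\<^esub> y))"
    by (simp add: hom_minus[OF XM YM chain_mapD(1)[OF ch] zc(1) u(1)]
      hom_uminus[OF YM YM diff_hom[OF Y] v(1)] v(2))
  also have "\<dots> = y" using az au y by (simp add: A.ag_normalize)
  finally have "p = diff (cone X Y \<alpha>) (i + 1) (z \<ominus>\<^bsub>obj X i\<^esub> u, \<ominus>\<^bsub>obj Y (i + 1)\<^esub> v)"
    using 1 by (simp add: cone_def x_def y_def prod_eq_iff)
  then show "p \<in> boundaries (cone X Y \<alpha>) i"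
    unfolding boundaries_def by (rule image_eqI)
      (use zc u v in \<open>simp add: cone_def prod_module_def\<close>)
qed

end

text \<open>
  Both halves are null homotopies of maps into a cone.  A map \<open>g\<close> together with a null homotopy \<open>h\<close>
  of \<open>\<alpha> g\<close> is a chain map \<open>(g, h)\<close> into the cone of the shifted map, and the first component of its null
  homotopy is one for \<open>g\<close>.  A map \<open>h\<close> to \<open>Y\<close> is a chain map \<open>(0, h)\<close> into the cone of \<open>\<alpha>\<close>; the two
  components of its null homotopy are a lift of \<open>h\<close> and the homotopy that relates the lift to \<open>h\<close>.
\<close>

lemma lifts_bounded_below:
  assumes bb: "bounded_below_fp R F a"
    and X: "is_complex R X" and Y: "is_complex R Y" and q: "quasi_iso R X Y \<alpha>"
  shows "lifts_along R F X Y \<alpha>"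
  unfolding lifts_along_def
proof (intro conjI allI impI)
  have F: "is_complex R F" using bb by (simp add: bounded_below_fp_def)
  note XM = is_complexD(1)[OF X] and YM = is_complexD(1)[OF Y]
  let ?X = "shift 1 X" and ?Y = "shift 1 Y"
  let ?C = "cone ?X ?Y (\<lambda>i. \<alpha> (i + 1))"
  note X' = is_complex_shift[OF X, of 1] and Y' = is_complex_shift[OF Y, of 1]
    and q' = quasi_iso_shift[OF X Y q, of 1]
  have C: "is_complex R ?C" by (rule cone_complex[OF X' Y' quasi_isoD(1)[OF X' Y' q']])
  fix g assume g: "chain_map R F X g \<and> null_homotopic R F Y (\<lambda>i x. \<alpha> i (g i x))"
  then obtain h where h: "\<And>i. h i \<in> module_hom R (obj F i) (obj Y (i + 1))"
    and rel: "\<And>i x. x \<in> carrier (obj F i) \<Longrightarrow>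
       \<alpha> i (g i x) = diff Y (i + 1) (h i x) \<oplus>\<^bsub>obj Y i\<^esub> h (i - 1) (diff F i x)"
    unfolding null_homotopic_def by blast
  note gh = chain_mapD[OF conjunct1[OF g]]
  have objC: "obj ?C i = prod_module (obj X i) (obj Y (i + 1))" for i by (simp add: cone_def)
  have diffC: "diff ?C i p = (diff X i (fst p), \<alpha> i (fst p) \<ominus>\<^bsub>obj Y i\<^esub> diff Y (i + 1) (snd p))"
    if "fst p \<in> carrier (obj X i)" for i p
  proof -
    interpret A: abelian_group "obj X (i - 1)" by (rule is_complexD(5)[OF X])
    have "i - 2 + 1 = i - 1" by simp
    then show ?thesis using is_complexD(4)[OF X that] by (simp add: cone_def shift_def a_minus_def)
  qed
  have "chain_map R F ?C (\<lambda>i x. (g i x, h i x))"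
    unfolding chain_map_def
  proof (intro allI conjI ballI)
    fix i
    show "(\<lambda>x. (g i x, h i x)) \<in> module_hom R (obj F i) (obj ?C i)"
      unfolding objC module_hom_prod_iff using gh(1)[of i] h[of i] by simp
    fix x assume x: "x \<in> carrier (obj F i)"
    interpret A: abelian_group "obj Y i" by (rule is_complexD(5)[OF Y])
    have "h (i - 1) (diff F i x) \<in> carrier (obj Y i)" using hom_closed[OF h is_complexD(4)[OF F x]]
      by simp
    then show "diff ?C i (g i x, h i x) = (g (i - 1) (diff F i x), h (i - 1) (diff F i x))"
      using gh(2,3)[OF x] rel[OF x] diff_diff(2)[OF Y hom_closed[OF h x]]
        by (simp add: diffC A.ag_normalize)
  qed
  then obtain k where k: "\<And>i. k i \<in> module_hom R (obj F i) (obj ?C (i + 1))"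
    "\<And>i x. x \<in> carrier (obj F i) \<Longrightarrow>
       (g i x, h i x) = diff ?C (i + 1) (k i x) \<oplus>\<^bsub>obj ?C i\<^esub> k (i - 1) (diff F i x)"
    using acyclic_homs_null[OF bb C cone_acyclic[OF X' Y' q']]
      unfolding homs_null_def null_homotopic_def by blast
  have k1: "(\<lambda>x. fst (k i x)) \<in> module_hom R (obj F i) (obj X (i + 1))" for i
    using k(1)[of i] unfolding objC module_hom_prod_iff by blast
  have "g i x = diff X (i + 1) (fst (k i x)) \<oplus>\<^bsub>obj X i\<^esub> fst (k (i - 1) (diff F i x))"
    if x: "x \<in> carrier (obj F i)" for i x
    using arg_cong[OF k(2)[OF x], of fst] hom_closed[OF k1 x] unfolding objC
    by (simp add: diffC prod_module_def)
  with k1 show "null_homotopic R F X g"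
    unfolding null_homotopic_def by (intro exI[of _ "\<lambda>i x. fst (k i x)"]) simp
next
  have F: "is_complex R F" using bb by (simp add: bounded_below_fp_def)
  note XM = is_complexD(1)[OF X] and YM = is_complexD(1)[OF Y] and ch = quasi_isoD(1)[OF X Y q]
  let ?C = "cone X Y \<alpha>"
  have C: "is_complex R ?C" by (rule cone_complex[OF X Y ch])
  fix h assume h: "chain_map R F Y h"
  have "chain_map R F ?C (\<lambda>i x. (\<zero>\<^bsub>obj X (i - 1)\<^esub>, h i x))"
    unfolding chain_map_def
  proof (intro allI conjI ballI)
    fix i
    show "(\<lambda>x. (\<zero>\<^bsub>obj X (i - 1)\<^esub>, h i x)) \<in> module_hom R (obj F i) (obj ?C i)"
      using module_hom_zero[OF XM] chain_mapD(1)[OF h] by (simp add: cone_def module_hom_prod_iff)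
    fix x assume x: "x \<in> carrier (obj F i)"
    interpret A: abelian_group "obj Y (i - 1)" by (rule is_complexD(5)[OF Y])
    have "diff X (i - 1) \<zero>\<^bsub>obj X (i - 1)\<^esub> = \<zero>\<^bsub>obj X (i - 2)\<^esub>"
      using hom_zero[OF XM XM is_complexD(2)[OF X, of "i - 1"]] by simp
    then show "diff ?C i (\<zero>\<^bsub>obj X (i - 1)\<^esub>, h i x) = (\<zero>\<^bsub>obj X (i - 1 - 1)\<^esub>, h (i - 1) (diff F i x))"
      using chain_mapD(3)[OF h x] is_complexD(4)[OF Y chain_mapD(2)[OF h x]]
      by (simp add: cone_def hom_zero[OF XM YM chain_mapD(1)[OF ch]]
        ag_uminus_zero[OF is_complexD(5)[OF X]])
  qed
  then obtain k where k: "\<And>i. k i \<in> module_hom R (obj F i) (obj ?C (i + 1))"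
    "\<And>i x. x \<in> carrier (obj F i) \<Longrightarrow> (\<zero>\<^bsub>obj X (i - 1)\<^esub>, h i x) =
       diff ?C (i + 1) (k i x) \<oplus>\<^bsub>obj ?C i\<^esub> k (i - 1) (diff F i x)"
    using acyclic_homs_null[OF bb C cone_acyclic[OF X Y q]]
      unfolding homs_null_def null_homotopic_def by blast
  define u where "u i x = fst (k i x)" for i x
  define l where "l i x = snd (k i x)" for i x
  have u: "u i \<in> module_hom R (obj F i) (obj X i)"
    and l: "l i \<in> module_hom R (obj F i) (obj Y (i + 1))" for i
    using k(1)[of i] unfolding u_def l_def by (simp_all add: cone_def module_hom_prod_iff)
  have l': "l (i - 1) \<in> module_hom R (obj F (i - 1)) (obj Y i)" for i using l[of "i - 1"] by simp
  have eq: "\<zero>\<^bsub>obj X (i - 1)\<^esub> = \<ominus>\<^bsub>obj X (i - 1)\<^esub> diff X i (u i x) \<oplus>\<^bsub>obj X (i - 1)\<^esub> u (i - 1) (diff F i x)"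
    "h i x = \<alpha> i (u i x) \<oplus>\<^bsub>obj Y i\<^esub> diff Y (i + 1) (l i x) \<oplus>\<^bsub>obj Y i\<^esub> l (i - 1) (diff F i x)"
    if "x \<in> carrier (obj F i)" for i x
    using k(2)[OF that] by (simp_all add: cone_def prod_module_def u_def l_def)
  have uc: "chain_map R F X u"
    unfolding chain_map_def
  proof (intro allI conjI ballI u)
    fix i x assume x: "x \<in> carrier (obj F i)"
    interpret A: abelian_group "obj X (i - 1)" by (rule is_complexD(5)[OF X])
    show "diff X i (u i x) = u (i - 1) (diff F i x)"
      using ag_add_eq_zero[OF A.abelian_group_axioms, of "\<ominus>\<^bsub>obj X (i - 1)\<^esub> diff X i (u i x)"]
        eq(1)[OF x, symmetric]
        is_complexD(4)[OF X hom_closed[OF u x]] hom_closed[OF u is_complexD(4)[OF F x]] by simp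
  qed
  have "null_homotopic R F Y (\<lambda>i x. \<alpha> i (u i x) \<ominus>\<^bsub>obj Y i\<^esub> h i x)"
    unfolding null_homotopic_def
  proof (intro exI[of _ "\<lambda>i x. \<ominus>\<^bsub>obj Y (i + 1)\<^esub> l i x"] allI conjI ballI module_hom_uminus YM l)
    fix i x assume x: "x \<in> carrier (obj F i)"
    interpret A: abelian_group "obj Y i" by (rule is_complexD(5)[OF Y])
    have lx: "l i x \<in> carrier (obj Y (i + 1))" by (rule hom_closed[OF l x])
    show "\<alpha> i (u i x) \<ominus>\<^bsub>obj Y i\<^esub> h i x = diff Y (i + 1) (\<ominus>\<^bsub>obj Y (i + 1)\<^esub> l i x) \<oplus>\<^bsub>obj Y i\<^esub>
        \<ominus>\<^bsub>obj Y (i - 1 + 1)\<^esub> l (i - 1) (diff F i x)"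
      using chain_mapD(2)[OF ch hom_closed[OF u x]] diff_diff(2)[OF Y lx]
        hom_closed[OF l' is_complexD(4)[OF F x]]
      by (simp add: eq(2)[OF x] hom_uminus[OF YM YM diff_hom[OF Y] lx] A.ag_normalize)
  qed
  with uc show "\<exists>k. chain_map R F X k \<and> null_homotopic R F Y (\<lambda>i x. \<alpha> i (k i x) \<ominus>\<^bsub>obj Y i\<^esub> h i x)"
    by blast
qed

lemma bounded_below_semiprojective:
  fixes F :: "('a, 'p) cpx"
  assumes bb: "bounded_below_fp R F a"
  shows "semiprojective R F"
  unfolding semiprojective_def
proof (intro conjI allI impI)
  show F: "is_complex R F" using bb by (simp add: bounded_below_fp_def)
  show "projective_module R (obj F i)" for i
    using bb by (intro finite_projective_projective_module) (simp add: bounded_below_fp_def)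
  fix X Y :: "('a, ('a, 'p) univ) cpx" and \<alpha>
  assume *: "is_complex R X \<and> is_complex R Y \<and> quasi_iso R X Y \<alpha>"
  then have X: "is_complex R X" and Y: "is_complex R Y" and q: "quasi_iso R X Y \<alpha>" by blast+
  show "quasi_iso R (hom_complex R F X) (hom_complex R F Y) (hom_complex_map F \<alpha>)"
    unfolding hom_complex_map_quasi_iso_iff[OF F X Y quasi_isoD(1)[OF X Y q]]
    by (intro allI lifts_bounded_below[OF bb] is_complex_shift X Y quasi_iso_shift q)
qed

section \<open>Copies of complexes and semiprojective resolutions\<close>

text \<open>
  The definition of semiprojectivity tests complexes in one type only, and so do the definitions of
  \<open>derived_iso\<close> and \<open>in_Dbf\<close>.  Copies along injections move complexes into these types.
\<close>

definition copy_module :: "('m \<Rightarrow> 'n) \<Rightarrow> ('a, 'm) module \<Rightarrow> ('a, 'n) module" where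
  "copy_module \<iota> M = \<lparr>carrier = \<iota> ` carrier M, mult = undefined, one = undefined, zero = \<iota> \<zero>\<^bsub>M\<^esub>,
     add = (\<lambda>x y. \<iota> (inv_into UNIV \<iota> x \<oplus>\<^bsub>M\<^esub> inv_into UNIV \<iota> y)), smult =
     (\<lambda>r x. \<iota> (r \<odot>\<^bsub>M\<^esub> inv_into UNIV \<iota> x))\<rparr>"

definition copy_cpx :: "('m \<Rightarrow> 'n) \<Rightarrow> ('a, 'm) cpx \<Rightarrow> ('a, 'n) cpx" where
  "copy_cpx \<iota> C = \<lparr>obj = (\<lambda>i. copy_module \<iota> (obj C i)), diff =
      (\<lambda>i x. \<iota> (diff C i (inv_into UNIV \<iota> x)))\<rparr>"

lemma copy_module_module:
  assumes \<iota>: "inj \<iota>" and M: "module R M"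
  shows "module R (copy_module \<iota> M)"
proof -
  interpret M: module R M by fact
  note [simp] = inv_f_f[OF \<iota>] and [simp] = copy_module_def
  show ?thesis
  proof (rule moduleI)
    show "cring R" by (rule M.R.is_cring)
    show "abelian_group (copy_module \<iota> M)"
    proof (rule abelian_groupI)
      fix x assume "x \<in> carrier (copy_module \<iota> M)"
      then obtain y where y: "y \<in> carrier M" "x = \<iota> y" by auto
      then show "\<exists>z\<in>carrier (copy_module \<iota> M). z \<oplus>\<^bsub>copy_module \<iota> M\<^esub> x = \<zero>\<^bsub>copy_module \<iota> M\<^esub>"
        by (auto simp: M.l_neg intro!: bexI[of _ "\<ominus>\<^bsub>M\<^esub> y"])
    qed (auto simp: M.a_ac)
  qed (auto simp: M.smult_l_distr M.smult_r_distr M.smult_assoc1)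
qed

context
  fixes R :: "('a, 'r) ring_scheme" and C :: "('a, 'm) cpx" and \<iota> :: "'m \<Rightarrow> 'n"
  assumes \<iota>: "inj \<iota>" and C: "is_complex R C"
begin

lemma copy_complex: "is_complex R (copy_cpx \<iota> C)"
proof (rule is_complexI)
  note [simp] = inv_f_f[OF \<iota>]
  fix i
  show "module R (obj (copy_cpx \<iota> C) i)"
    using copy_module_module[OF \<iota> is_complexD(1)[OF C]] by (simp add: copy_cpx_def)
  show "diff (copy_cpx \<iota> C) i \<in> module_hom R (obj (copy_cpx \<iota> C) i) (obj (copy_cpx \<iota> C) (i - 1))"
    by (rule module_homI) (auto simp: copy_cpx_def copy_module_def is_complexD[OF C]
       hom_add[OF is_complexD(2)[OF C]] hom_smult[OF is_complexD(2)[OF C]])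
  fix x assume "x \<in> carrier (obj (copy_cpx \<iota> C) i)"
  then show "diff (copy_cpx \<iota> C) (i - 1) (diff (copy_cpx \<iota> C) i x) = \<zero>\<^bsub>obj (copy_cpx \<iota> C) (i - 2)\<^esub>"
    by (auto simp: copy_cpx_def copy_module_def is_complexD[OF C])
qed

lemma copy_chain_maps:
  "chain_map R C (copy_cpx \<iota> C) (\<lambda>i. \<iota>)" "chain_map R (copy_cpx \<iota> C) C (\<lambda>i. inv_into UNIV \<iota>)"
  unfolding chain_map_def
  by (intro allI conjI module_homI ballI;
      force simp: copy_cpx_def copy_module_def inv_f_f[OF \<iota>])+

lemma cycles_copy: "cycles (copy_cpx \<iota> C) i = \<iota> ` cycles C i"
  by (auto simp: cycles_def copy_cpx_def copy_module_def inj_eq[OF \<iota>] inv_f_f[OF \<iota>])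

lemma boundaries_copy: "boundaries (copy_cpx \<iota> C) i = \<iota> ` boundaries C i"
  by (simp add: boundaries_def copy_cpx_def copy_module_def image_image inv_f_f[OF \<iota>])

lemma copy_quasi_isos:
  "quasi_iso R C (copy_cpx \<iota> C) (\<lambda>i. \<iota>)" "quasi_iso R (copy_cpx \<iota> C) C (\<lambda>i. inv_into UNIV \<iota>)"
proof -
  note aC = is_complex_additive[OF C] and aD = is_complex_additive[OF copy_complex]
  have z: "x \<ominus>\<^bsub>obj D i\<^esub> x \<in> boundaries D i" if "additive_complex D" "x \<in> carrier (obj D i)"
    for D :: "('b, 'x) cpx" and x i
  proof -
    have "x \<ominus>\<^bsub>obj D i\<^esub> x = \<zero>\<^bsub>obj D i\<^esub>" using ag_minus_eq_zero[OF obj_abelian_group[OF that(1)]] that(2)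
      by blast
    then show ?thesis using boundaries_zero[OF that(1)] by simp
  qed
  show "quasi_iso R C (copy_cpx \<iota> C) (\<lambda>i. \<iota>)"
  proof (rule quasi_isoI[OF C copy_complex copy_chain_maps(1)])
    fix i w assume w: "w \<in> cycles (copy_cpx \<iota> C) i"
    then obtain x where x: "x \<in> cycles C i" "w = \<iota> x" unfolding cycles_copy by blast
    show "\<exists>z\<in>cycles C i. \<iota> z \<ominus>\<^bsub>obj (copy_cpx \<iota> C) i\<^esub> w \<in> boundaries (copy_cpx \<iota> C) i"
      by (rule bexI[OF _ x(1)]) (use z[OF aD cycles_carrier[OF aD w]] x(2) in simp)
  qed (use \<iota> in \<open>auto simp: boundaries_copy inj_image_mem_iff\<close>)
  show "quasi_iso R (copy_cpx \<iota> C) C (\<lambda>i. inv_into UNIV \<iota>)"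
  proof (rule quasi_isoI[OF copy_complex C copy_chain_maps(2)])
    fix i w assume w: "w \<in> cycles C i"
    show "\<exists>z\<in>cycles (copy_cpx \<iota> C) i. inv_into UNIV \<iota> z \<ominus>\<^bsub>obj C i\<^esub> w \<in> boundaries C i"
      unfolding cycles_copy using z[OF aC cycles_carrier[OF aC w]] w \<iota>
        by (auto intro!: bexI[of _ w])
  qed (use \<iota> in \<open>auto simp: boundaries_copy cycles_copy\<close>)
qed

end

text \<open>
  After copying, \<open>\<alpha>\<close> is a quasiisomorphism against which \<open>Q\<close> is tested; the lifting property is the
  resulting statement on \<open>H\<^sub>0(Hom(Q, -))\<close>, transported back along the copies.
\<close>

lemma semiprojective_lifts:
  fixes Q :: "('a, 'q) cpx" and X :: "('a, 'x) cpx" and Y :: "('a, 'y) cpx"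
    and \<iota> :: "'x \<Rightarrow> ('a, 'q) univ" and \<kappa> :: "'y \<Rightarrow> ('a, 'q) univ"
  assumes Q: "semiprojective R Q" and X: "is_complex R X" and Y: "is_complex R Y"
    and \<iota>: "inj \<iota>" and \<kappa>: "inj \<kappa>" and q: "quasi_iso R X Y \<alpha>"
  shows "lifts_along R Q X Y \<alpha>"
proof -
  let ?X = "copy_cpx \<iota> X" and ?Y = "copy_cpx \<kappa> Y" and ?a = "\<lambda>i x. \<kappa> (\<alpha> i (inv_into UNIV \<iota> x))"
  have QC: "is_complex R Q" using Q by (simp add: semiprojective_def)
  note X' = copy_complex[OF \<iota> X] and Y' = copy_complex[OF \<kappa> Y]
  note jX = copy_chain_maps[OF \<iota> X] and jY = copy_chain_maps[OF \<kappa> Y]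
  note [simp] = inv_f_f[OF \<iota>] inv_f_f[OF \<kappa>]
  have q': "quasi_iso R ?X ?Y ?a"
    by (rule quasi_iso_comp[OF X' Y Y' quasi_iso_comp[OF X' X Y copy_quasi_isos(2)[OF \<iota> X] q]
      copy_quasi_isos(1)[OF \<kappa> Y]])
  then have "quasi_iso R (hom_complex R Q ?X) (hom_complex R Q ?Y) (hom_complex_map Q ?a)"
    using Q X' Y' unfolding semiprojective_def by blast
  then have "\<forall>n. lifts_along R Q (shift n ?X) (shift n ?Y) (\<lambda>i. ?a (i + n))"
    unfolding hom_complex_map_quasi_iso_iff[OF QC X' Y' quasi_isoD(1)[OF X' Y' q']] .
  from this[rule_format, of 0] have L: "lifts_along R Q ?X ?Y ?a" by simp
  show ?thesis unfolding lifts_along_def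
  proof (intro conjI allI impI)
    fix g assume g: "chain_map R Q X g \<and> null_homotopic R Q Y (\<lambda>i x. \<alpha> i (g i x))"
    have "chain_map R Q ?X (\<lambda>i x. \<iota> (g i x))" by (rule chain_map_comp[OF conjunct1[OF g] jX(1)])
    moreover have "null_homotopic R Q ?Y (\<lambda>i x. ?a i (\<iota> (g i x)))"
      using null_homotopic_post[OF Y Y' QC conjunct2[OF g] jY(1)] by simp
    ultimately have "null_homotopic R Q ?X (\<lambda>i x. \<iota> (g i x))" using L unfolding lifts_along_def
      by blast
    from null_homotopic_post[OF X' X QC this jX(2)] show "null_homotopic R Q X g" by simp
  next
    fix h assume h: "chain_map R Q Y h"
    have "chain_map R Q ?Y (\<lambda>i x. \<kappa> (h i x))" by (rule chain_map_comp[OF h jY(1)])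
    then obtain k where k: "chain_map R Q ?X k"
      "null_homotopic R Q ?Y (\<lambda>i x. ?a i (k i x) \<ominus>\<^bsub>obj ?Y i\<^esub> \<kappa> (h i x))"
      using L unfolding lifts_along_def by blast
    have kX: "chain_map R Q X (\<lambda>i x. inv_into UNIV \<iota> (k i x))"
      by (rule chain_map_comp[OF k(1) jX(2)])
    have "null_homotopic R Q Y (\<lambda>i x. inv_into UNIV \<kappa> (?a i (k i x) \<ominus>\<^bsub>obj ?Y i\<^esub> \<kappa> (h i x)))"
      by (rule null_homotopic_post[OF Y' Y QC k(2) jY(2)])
    then have "null_homotopic R Q Y (\<lambda>i x. \<alpha> i (inv_into UNIV \<iota> (k i x)) \<ominus>\<^bsub>obj Y i\<^esub> h i x)"
    proof (rule null_homotopic_cong[THEN iffD1, rotated])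
      fix i x assume x: "x \<in> carrier (obj Q i)"
      have "inv_into UNIV \<iota> (k i x) \<in> carrier (obj X i)" by (rule chain_mapD(2)[OF kX x])
      then have "\<kappa> (\<alpha> i (inv_into UNIV \<iota> (k i x))) \<in> carrier (obj ?Y i)"
        "\<kappa> (h i x) \<in> carrier (obj ?Y i)"
        using chain_mapD(2)[OF quasi_isoD(1)[OF X Y q]] chain_mapD(2)[OF h x]
          chain_mapD(2)[OF jY(1)] by auto
      then show "inv_into UNIV \<kappa> (?a i (k i x) \<ominus>\<^bsub>obj ?Y i\<^esub> \<kappa> (h i x)) =
          \<alpha> i (inv_into UNIV \<iota> (k i x)) \<ominus>\<^bsub>obj Y i\<^esub> h i x"
        by (simp add: chain_map_zero_minus[OF is_complex_additive[OF Y'] is_complex_additive[OF Y]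
          jY(2)])
    qed
    with kX show "\<exists>k. chain_map R Q X k \<and> null_homotopic R Q Y (\<lambda>i x. \<alpha> i (k i x) \<ominus>\<^bsub>obj Y i\<^esub> h i x)"
      by blast
  qed
qed

text \<open>
  Both complexes lift along both resolutions, so the transfer works in either direction.
\<close>

lemma homs_null_resolution_iff:
  fixes M :: "('a, 'm) cpx" and Q F :: "('a, ('a, 'm) univ) cpx"
  assumes M: "is_complex R M" and Q: "semiprojective_resolution R M Q \<pi>"
    and bb: "bounded_below_fp R F a" and qF: "quasi_iso R F M \<rho>" and X: "is_complex R X"
  shows "homs_null R Q X \<longleftrightarrow> homs_null R F X"
proof -
  have sQ: "semiprojective R Q" and qQ: "quasi_iso R Q M \<pi>" using Q
    by (auto simp: semiprojective_resolution_def)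
  have QC: "is_complex R Q" using sQ by (simp add: semiprojective_def)
  have F: "is_complex R F" using bb by (simp add: bounded_below_fp_def)
  have iu: "inj (\<lambda>x :: ('a, 'm) univ. [Inr x] :: ('a, ('a, 'm) univ) univ)" by (auto simp: inj_def)
  have im: "inj (\<lambda>x :: 'm. [Inr [Inr x]] :: ('a, ('a, 'm) univ) univ)" by (auto simp: inj_def)
  note cQ = quasi_isoD(1)[OF QC M qQ] and cF = quasi_isoD(1)[OF F M qF]
  note lQ = semiprojective_lifts[OF sQ _ M iu im]
  note lF = lifts_bounded_below[OF bb _ M]
  show ?thesis
    using homs_null_transfer[OF QC F M X cQ cF lQ[OF QC qQ] lQ[OF F qF] lF[OF QC qQ]]
      homs_null_transfer[OF F QC M X cF cQ lF[OF F qF] lF[OF QC qQ] lQ[OF F qF]] by blast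
qed

section \<open>Free resolutions\<close>

lemma linear_span_image_subset:
  assumes M: "module R M" and N: "module R N" and f: "f \<in> module_hom R M N" and A: "A \<subseteq> carrier M"
    and H: "submodule H R N" and sub: "\<And>a. a \<in> A \<Longrightarrow> f a \<in> H" and x: "x \<in> linear_span R M A"
  shows "f x \<in> H"
proof -
  interpret M: module R M by fact
  note HD = submoduleD[OF N H]
  show ?thesis using x
  proof induction
    case zero then show ?case by (simp add: hom_zero[OF M N f] HD(2))
  next
    case (step r a x)
    then show ?case
      using A HD(3)[OF HD(5)[OF step(1) sub[OF step(2)]] step(4)] linear_span_closed[OF M A step(3)]
      by (simp add: hom_add[OF f] hom_smult[OF f] subsetD)
  qed
qed

lemma hom_eq_on_linear_span:
  assumes M: "module R M" and N: "module R N" and f: "f \<in> module_hom R M N"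
      and g: "g \<in> module_hom R M N"
    and A: "A \<subseteq> carrier M" and eq: "\<And>a. a \<in> A \<Longrightarrow> f a = g a" and x: "x \<in> linear_span R M A"
  shows "f x = g x"
proof -
  interpret M: module R M by fact
  show ?thesis using x
  proof induction
    case zero then show ?case by (simp add: hom_zero[OF M N f] hom_zero[OF M N g])
  next
    case (step r a x)
    then show ?case using A linear_span_closed[OF M A step(3)] eq
      by (simp add: hom_add[OF f] hom_smult[OF f] hom_add[OF g] hom_smult[OF g] subsetD)
  qed
qed

text \<open>
  \<open>E\<close> and \<open>Z\<close> are the module and its cycles in degree \<open>i\<close> of a resolution under construction.  Two
  kinds of generators are attached in degree \<open>i + 1\<close>: generators of the kernel of \<open>Z \<rightarrow> H\<^sub>i(M)\<close>, which
  become boundaries, and generators of \<open>H\<^sub>i\<^sub>+\<^sub>1(M)\<close>, on which the differential is zero.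
\<close>

lemma resolution_step:
  fixes E :: "('a, ('a, 'm) univ) module"
  assumes R: "cring R" and M: "is_complex R (M :: ('a, 'm) cpx)"
      and fgM: "fin_gen_module R (homology M (i + 1))"
    and E: "module R E" and noeth: "\<forall>K. submodule K R E \<longrightarrow> (\<exists>A\<subseteq>K. finite A \<and> K \<subseteq> linear_span R E A)"
    and Z: "submodule Z R E" and \<pi>: "\<pi> \<in> module_hom R E (obj M i)" and \<pi>Z: "\<pi> ` Z \<subseteq> cycles M i"
  shows "\<exists>n (d :: ('a, 'm) univ \<Rightarrow> ('a, 'm) univ) (\<rho> :: ('a, 'm) univ \<Rightarrow> 'm). d \<in>
      module_hom R (free_module R n) E \<and> \<rho> \<in> module_hom R (free_module R n) (obj M (i + 1)) \<and>
     d ` carrier (free_module R n) = {z \<in> Z. \<pi> z \<in> boundaries M i} \<and>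
     (\<forall>x\<in>carrier (free_module R n). diff M (i + 1) (\<rho> x) = \<pi> (d x)) \<and>
     (\<forall>w\<in>cycles M (i + 1). \<exists>x\<in>carrier (free_module R n). d x = \<zero>\<^bsub>E\<^esub> \<and> \<rho> x \<ominus>\<^bsub>obj M (i + 1)\<^esub> w \<in>
     boundaries M (i + 1))"
proof -
  note aM = is_complex_additive[OF M] and MM = is_complexD(1)[OF M] and ZD = submoduleD[OF E Z]
  interpret E: module R E by (rule E)
  interpret M0: module R "obj M i" by (rule MM)
  interpret M1: module R "obj M (i + 1)" by (rule MM)
  let ?K = "{z \<in> Z. \<pi> z \<in> boundaries M i}"
  have K: "submodule ?K R E"
  proof (rule E.submoduleI)
    show "?K \<subseteq> carrier E" using ZD(1) by blast
    show "\<zero>\<^bsub>E\<^esub> \<in> ?K" using ZD(2) boundaries_zero[OF aM] by (simp add: hom_zero[OF E MM \<pi>])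
    fix x assume x: "x \<in> ?K"
    then have xE: "x \<in> carrier E" using ZD(1) by blast
    have "\<zero>\<^bsub>obj M i\<^esub> \<ominus>\<^bsub>obj M i\<^esub> \<pi> x \<in> boundaries M i"
      using boundaries_minus[OF aM boundaries_zero[OF aM]] x by blast
    then have "\<pi> (\<ominus>\<^bsub>E\<^esub> x) \<in> boundaries M i"
      using hom_closed[OF \<pi> xE] by (simp add: a_minus_def hom_uminus[OF E MM \<pi> xE])
    moreover have "\<ominus>\<^bsub>E\<^esub> x \<in> Z" using E.submoduleE(3)[OF Z] x by blast
    ultimately show "\<ominus>\<^bsub>E\<^esub> x \<in> ?K" by simp
  next
    fix x y assume "x \<in> ?K" "y \<in> ?K"
    then show "x \<oplus>\<^bsub>E\<^esub> y \<in> ?K" using ZD(1,3) boundaries_add[OF aM]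
      by (auto simp: hom_add[OF \<pi>] subset_iff)
  next
    fix r x assume "r \<in> carrier R" "x \<in> ?K"
    then show "r \<odot>\<^bsub>E\<^esub> x \<in> ?K" using ZD(1,5) boundaries_smult[OF M]
      by (auto simp: hom_smult[OF \<pi>] subset_iff)
  qed
  obtain A where A: "A \<subseteq> ?K" "finite A" "?K \<subseteq> linear_span R E A" using noeth[rule_format, OF K]
    by blast
  obtain B where B: "B \<subseteq> cycles M (i + 1)" "finite B"
    "\<And>z. z \<in> cycles M (i + 1) \<Longrightarrow> \<exists>s\<in>linear_span R (obj M (i + 1)) B. s \<ominus>\<^bsub>obj M (i + 1)\<^esub> z \<in>
        boundaries M (i + 1)"
    using fgM unfolding fin_gen_homology_iff[OF M] by blast
  have "\<forall>a\<in>A. \<exists>w. w \<in> carrier (obj M (i + 1)) \<and> diff M (i + 1) w = \<pi> a"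
  proof
    fix a assume "a \<in> A"
    then have "\<pi> a \<in> boundaries M i" using A(1) by blast
    then obtain v where "v \<in> carrier (obj M (i + 1))" "\<pi> a = diff M (i + 1) v"
      by (auto simp: boundaries_def)
    then show "\<exists>w. w \<in> carrier (obj M (i + 1)) \<and> diff M (i + 1) w = \<pi> a" by auto
  qed
  then obtain w where w: "\<And>a. a \<in> A \<Longrightarrow> w a \<in> carrier (obj M (i + 1))"
    "\<And>a. a \<in> A \<Longrightarrow> diff M (i + 1) (w a) = \<pi> a"
    by metis
  \<comment> \<open>the generators to attach, each as the pair of its differential in \<open>E\<close> and its image in \<open>M\<close>\<close>
  define G where "G = (\<lambda>a. (a, w a)) ` A \<union> (\<lambda>b. (\<zero>\<^bsub>E\<^esub>, b)) ` B"
  have GA: "(a, w a) \<in> G" if "a \<in> A" for a using that by (simp add: G_def)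
  have GB: "(\<zero>\<^bsub>E\<^esub>, b) \<in> G" if "b \<in> B" for b using that by (simp add: G_def)
  have "finite G" using A(2) B(2) by (simp add: G_def)
  then obtain gs where gs: "set gs = G" using finite_list by blast
  define n where "n = length gs"
  have gsn: "gs ! j \<in> G" if "j < n" for j using gs nth_mem[of j gs] that n_def by simp
  let ?F = "free_module R n :: ('a, ('a, 'm) univ) module"
  let ?U = "unit_vec R n ` {..<n} :: ('a, 'm) univ set"
  note F = free_module[OF R, of n]
  interpret F: module R ?F by (rule F)
  have Gp: "fst p \<in> ?K \<and> snd p \<in> carrier (obj M (i + 1)) \<and> diff M (i + 1) (snd p) = \<pi> (fst p)" if
    pG: "p \<in> G" for p
  proof (cases "p \<in> (\<lambda>a. (a, w a)) ` A")
    case True then show ?thesis using A(1) w by auto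
  next
    case False
    then obtain b where b: "b \<in> B" "p = (\<zero>\<^bsub>E\<^esub>, b)" using pG unfolding G_def by blast
    then have "b \<in> cycles M (i + 1)" using B(1) by blast
    then show ?thesis using b submoduleD(2)[OF E K] by (auto simp: cycles_def hom_zero[OF E MM \<pi>])
  qed
  have gE: "fst (gs ! j) \<in> carrier E" and gM: "snd (gs ! j) \<in> carrier (obj M (i + 1))" if "j < n"
    for j
    using Gp[OF gsn[OF that]] ZD(1) by auto
  obtain d where d: "d \<in> module_hom R ?F E" "\<And>j. j < n \<Longrightarrow> d (unit_vec R n j) = fst (gs ! j)"
    using free_module_hom_exists[OF R E, of n "\<lambda>j. fst (gs ! j)", OF gE] by blast
  obtain \<rho> where \<rho>: "\<rho> \<in> module_hom R ?F (obj M (i + 1))"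
    "\<And>j. j < n \<Longrightarrow> \<rho> (unit_vec R n j) = snd (gs ! j)"
    using free_module_hom_exists[OF R MM, of n "\<lambda>j. snd (gs ! j)", OF gM] by blast
  have U: "?U \<subseteq> carrier ?F" using unit_vec_carrier[OF R] by auto
  have span: "x \<in> linear_span R ?F ?U" if "x \<in> carrier ?F" for x
    using free_module_linear_span[OF R that] .
  have hit: "\<exists>j<n. gs ! j = p" if "p \<in> G" for p using that gs unfolding n_def
    by (metis in_set_conv_nth)
  have dim: "d ` carrier ?F = ?K"
  proof (intro equalityI subsetI)
    fix y assume "y \<in> d ` carrier ?F"
    then obtain x where x: "x \<in> carrier ?F" "y = d x" by blast
    show "y \<in> ?K" unfolding x(2)
      by (rule linear_span_image_subset[OF F E d(1) U K _ span[OF x(1)]])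
        (use Gp[OF gsn] d(2) in auto)
  next
    fix y assume "y \<in> ?K"
    then have "y \<in> linear_span R E A" using A(3) by blast
    then show "y \<in> d ` carrier ?F"
    proof induction
      case zero then show ?case by (intro image_eqI[where x="\<zero>\<^bsub>?F\<^esub>"])
        (simp_all add: hom_zero[OF F E d(1)])
    next
      case (step r a y)
      then obtain x where x: "x \<in> carrier ?F" "y = d x" by blast
      obtain j where j: "j < n" "gs ! j = (a, w a)" using hit[OF GA[OF step(2)]] by blast
      have u: "unit_vec R n j \<in> carrier ?F" by (rule unit_vec_carrier[OF R])
      have "r \<odot>\<^bsub>E\<^esub> a \<oplus>\<^bsub>E\<^esub> y = d (r \<odot>\<^bsub>?F\<^esub> unit_vec R n j \<oplus>\<^bsub>?F\<^esub> x)"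
        using step(1) x u d(2)[OF j(1)] j(2) by (simp add: hom_add[OF d(1)] hom_smult[OF d(1)])
      then show ?case using step(1) x(1) u by simp
    qed
  qed
  have comm: "diff M (i + 1) (\<rho> x) = \<pi> (d x)" if "x \<in> carrier ?F" for x
    by (rule hom_eq_on_linear_span[OF F MM module_hom_comp[OF \<rho>(1) diff_hom[OF M]]
      module_hom_comp[OF d(1) \<pi>] U _ span[OF that]])
      (use Gp[OF gsn] d(2) \<rho>(2) in auto)
  have Bc: "B \<subseteq> carrier (obj M (i + 1))" using B(1) cycles_carrier[OF aM] by blast
  have surj: "\<exists>x\<in>carrier ?F. d x = \<zero>\<^bsub>E\<^esub> \<and> \<rho> x = s" if "s \<in> linear_span R (obj M (i + 1)) B" for s
    using that
  proof induction
    case zero then show ?case using hom_zero[OF F E d(1)] hom_zero[OF F MM \<rho>(1)]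
      by (intro bexI[of _ "\<zero>\<^bsub>?F\<^esub>"]) auto
  next
    case (step r b s)
    then obtain x where x: "x \<in> carrier ?F" "d x = \<zero>\<^bsub>E\<^esub>" "\<rho> x = s" by blast
    obtain j where j: "j < n" "gs ! j = (\<zero>\<^bsub>E\<^esub>, b)" using hit[OF GB[OF step(2)]] by blast
    have u: "unit_vec R n j \<in> carrier ?F" by (rule unit_vec_carrier[OF R])
    have "d (r \<odot>\<^bsub>?F\<^esub> unit_vec R n j \<oplus>\<^bsub>?F\<^esub> x) = \<zero>\<^bsub>E\<^esub>"
      "\<rho> (r \<odot>\<^bsub>?F\<^esub> unit_vec R n j \<oplus>\<^bsub>?F\<^esub> x) = r \<odot>\<^bsub>obj M (i + 1)\<^esub> b \<oplus>\<^bsub>obj M (i + 1)\<^esub> s"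
      using step(1) x u d(2)[OF j(1)] \<rho>(2)[OF j(1)] j(2)
      by (simp_all add: hom_add[OF d(1)] hom_smult[OF d(1)] hom_add[OF \<rho>(1)] hom_smult[OF \<rho>(1)])
    then show ?case using step(1) x(1) u by (intro bexI[of _ "r \<odot>\<^bsub>?F\<^esub> unit_vec R n j \<oplus>\<^bsub>?F\<^esub> x"]) auto
  qed
  have onto: "\<exists>x\<in>carrier ?F. d x = \<zero>\<^bsub>E\<^esub> \<and> \<rho> x \<ominus>\<^bsub>obj M (i + 1)\<^esub> v \<in> boundaries M (i + 1)"
    if "v \<in> cycles M (i + 1)" for v
    using B(3)[OF that] surj by blast
  show ?thesis
    by (intro exI[of _ n] exI[of _ d] exI[of _ \<rho>] conjI ballI d(1) \<rho>(1) dim comm onto)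
qed

lemma free_module_zero: "carrier (free_module R 0) = {\<zero>\<^bsub>free_module R 0\<^esub>}"
  by (auto simp: free_module_def free_vec_def)

lemma kernel_submodule:
  assumes M: "module R M" and N: "module R N" and f: "f \<in> module_hom R M N"
  shows "submodule {x \<in> carrier M. f x = \<zero>\<^bsub>N\<^esub>} R M"
proof -
  interpret M: module R M by fact
  interpret N: module R N by fact
  show ?thesis
    by (rule M.submoduleI) (auto simp: hom_zero[OF M N f] hom_uminus[OF M N f] hom_add[OF f]
      hom_smult[OF f]
      ag_uminus_zero[OF module_abelian_group[OF N]])
qed

text \<open>
  The attaching step is iterated from degree \<open>a\<close> upwards, starting with the zero module.  Each stage
  records the rank, the cycles, the differential and the map to \<open>M\<close>.  Its cycles map onto the
  homology of \<open>M\<close>; the next stage turns exactly those cycles into boundaries that are boundaries in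
  \<open>M\<close>, which gives injectivity on homology.
\<close>

lemma free_resolution_exists:
  fixes M :: "('a, 'm) cpx"
  assumes R: "cring R" and noeth: "noetherian_ring R" and M: "is_complex R M"
    and fgM: "\<And>i. fin_gen_module R (homology M i)"
        and bdd: "\<And>i. i \<le> a \<Longrightarrow> cycles M i \<subseteq> boundaries M i"
  shows "\<exists>(F :: ('a, ('a, 'm) univ) cpx) \<pi>. bounded_below_fp R F (a + 1) \<and> quasi_iso R F M \<pi>"
proof -
  note aM = is_complex_additive[OF M] and MM = is_complexD(1)[OF M] and FM = free_module[OF R]
  let ?E = "\<lambda>n. free_module R n :: ('a, ('a, 'm) univ) module"
  define deg where "deg = (\<lambda>m::nat. a + int m)"
  let ?st = "\<lambda>m n Z \<pi>. submodule Z R (?E n) \<and> \<pi> \<in> module_hom R (?E n) (obj M (deg m)) \<and>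
      \<pi> ` Z \<subseteq> cycles M (deg m) \<and>
     (\<forall>w\<in>cycles M (deg m). \<exists>z\<in>Z. \<pi> z \<ominus>\<^bsub>obj M (deg m)\<^esub> w \<in> boundaries M (deg m)) \<and> (m = 0 \<longrightarrow> n = 0)"
  let ?tr = "\<lambda>m n Z \<pi> n' Z' d' \<pi>'. d' \<in> module_hom R (?E n') (?E n) \<and>
     d' ` carrier (?E n') = {z \<in> Z. \<pi> z \<in> boundaries M (deg m)} \<and>
     Z' = {x \<in> carrier (?E n'). d' x = \<zero>\<^bsub>?E n\<^esub>} \<and>
     (\<forall>x\<in>carrier (?E n'). diff M (deg m + 1) (\<pi>' x) = \<pi> (d' x))"
  have "\<exists>f. \<forall>m. (case f m of (n, Z, d, \<pi>) \<Rightarrow> ?st m n Z \<pi>) \<and>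
    (case f m of (n, Z, d, \<pi>) \<Rightarrow> case f (Suc m) of (n', Z', d', \<pi>') \<Rightarrow> ?tr m n Z \<pi> n' Z' d' \<pi>')"
    (is "\<exists>f. \<forall>m. ?A f m")
  proof (rule dependent_nat_choice[where
    P="\<lambda>m s. case s of (n, Z, d :: ('a, 'm) univ \<Rightarrow> ('a, 'm) univ, \<pi>) \<Rightarrow> ?st m n Z \<pi>"
        and Q="\<lambda>m s t. case s of (n, Z, d, \<pi>) \<Rightarrow> case t of (n', Z', d', \<pi>') \<Rightarrow> ?tr m n Z \<pi> n' Z' d'
            \<pi>'"])
    have "\<exists>z\<in>carrier (?E 0). \<zero>\<^bsub>obj M (deg 0)\<^esub> \<ominus>\<^bsub>obj M (deg 0)\<^esub> w \<in> boundaries M (deg 0)"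
      if "w \<in> cycles M (deg 0)" for w
      using that bdd[of a] boundaries_minus[OF aM boundaries_zero[OF aM]]
        by (auto simp: free_module_zero deg_def)
    then have "?st 0 0 (carrier (?E 0)) (\<lambda>x. \<zero>\<^bsub>obj M (deg 0)\<^esub>)"
      using submodule_carrier[OF FM, of 0] module_hom_zero[OF MM] cycles_zero[OF aM] by auto
    then show "\<exists>s. case s of (n, Z, d :: ('a, 'm) univ \<Rightarrow> ('a, 'm) univ, \<pi>) \<Rightarrow> ?st 0 n Z \<pi>"
      by (intro exI[of _ "(0, carrier (?E 0), \<lambda>x. x, \<lambda>x. \<zero>\<^bsub>obj M (deg 0)\<^esub>)"]) simp
  next
    fix s :: "nat \<times> ('a, 'm) univ set \<times> (('a, 'm) univ \<Rightarrow> ('a, 'm) univ) \<times> (('a, 'm) univ \<Rightarrow> 'm)"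
      and m
    assume s: "case s of (n, Z, d, \<pi>) \<Rightarrow> ?st m n Z \<pi>"
    obtain n Z d \<pi> where seq: "s = (n, Z, d, \<pi>)" by (metis prod.exhaust)
    have st: "submodule Z R (?E n)" "\<pi> \<in> module_hom R (?E n) (obj M (deg m))"
      "\<pi> ` Z \<subseteq> cycles M (deg m)"
      using s unfolding seq by simp_all
    have noe: "\<forall>K. submodule K R (?E n) \<longrightarrow> (\<exists>A\<subseteq>K. finite A \<and> K \<subseteq> linear_span R (?E n) A)"
      by (intro allI impI finite_projective_noetherian[OF R noeth finite_projective_free[OF R]])
    obtain n' d' \<pi>' where t: "d' \<in> module_hom R (?E n') (?E n)"
      "\<pi>' \<in> module_hom R (?E n') (obj M (deg m + 1))"
       "d' ` carrier (?E n') = {z \<in> Z. \<pi> z \<in> boundaries M (deg m)}"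
       "\<forall>x\<in>carrier (?E n'). diff M (deg m + 1) (\<pi>' x) = \<pi> (d' x)"
       "\<forall>w\<in>cycles M (deg m + 1). \<exists>x\<in>carrier (?E n'). d' x = \<zero>\<^bsub>?E n\<^esub> \<and>
          \<pi>' x \<ominus>\<^bsub>obj M (deg m + 1)\<^esub> w \<in> boundaries M (deg m + 1)"
      using resolution_step[OF R M fgM FM[of n] noe st]
      by (elim exE conjE) (rule that)
    let ?Z = "{x \<in> carrier (?E n'). d' x = \<zero>\<^bsub>?E n\<^esub>}"
    have dS: "deg (Suc m) = deg m + 1" by (simp add: deg_def)
    have "\<pi>' x \<in> cycles M (deg m + 1)" if "x \<in> ?Z" for x
      using that t(4) hom_closed[OF t(2)] hom_zero[OF FM MM st(2)] by (simp add: cycles_def)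
    then have "?st (Suc m) n' ?Z \<pi>'"
      unfolding dS using t(2,5) kernel_submodule[OF FM FM t(1)] by auto
    with t show "\<exists>t. (case t of (n, Z, d, \<pi>) \<Rightarrow> ?st (Suc m) n Z \<pi>) \<and>
        (case s of (n, Z, d, \<pi>) \<Rightarrow> case t of (n', Z', d', \<pi>') \<Rightarrow> ?tr m n Z \<pi> n' Z' d' \<pi>')"
      unfolding seq by (intro exI[of _ "(n', ?Z, d', \<pi>')"]) simp
  qed
  then obtain f where f: "\<forall>m. ?A f m" by (rule exE)
  define N where "N m = fst (f m)" for m
  define Z where "Z m = fst (snd (f m))" for m
  define D where "D m = fst (snd (snd (f m)))" for m
  define \<psi> where "\<psi> m = snd (snd (snd (f m)))" for m
  have fm: "f m = (N m, Z m, D m, \<psi> m)" for m by (simp add: N_def Z_def D_def \<psi>_def)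
  have st: "?st m (N m) (Z m) (\<psi> m)" for m
    using f[rule_format, of m, THEN conjunct1] unfolding fm prod.case .
  have tr: "?tr m (N m) (Z m) (\<psi> m) (N (Suc m)) (Z (Suc m)) (D (Suc m)) (\<psi> (Suc m))" for m
    using f[rule_format, of m, THEN conjunct2] unfolding fm prod.case .
  have N0 [simp]: "N 0 = 0" using st[of 0] by simp
  let ?k = "\<lambda>i. nat (i - a)"
  define F :: "('a, ('a, 'm) univ) cpx" where "F = \<lparr>obj = (\<lambda>i. ?E (N (?k i))),
      diff = (\<lambda>i. if a < i then D (?k i) else (\<lambda>x. \<zero>\<^bsub>?E 0\<^esub>))\<rparr>"
  define \<pi> where "\<pi> = (\<lambda>i. if a \<le> i then \<psi> (?k i) else (\<lambda>x. \<zero>\<^bsub>obj M i\<^esub>))"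
  have objF: "obj F i = ?E (N (?k i))" for i by (simp add: F_def)
  have low: "N (?k i) = 0" if "i \<le> a" for i using that N0 by simp
  have zlow: "x = \<zero>\<^bsub>obj F i\<^esub>" if "i \<le> a" "x \<in> carrier (obj F i)" for i x
    using that by (simp add: objF low free_module_zero)
  have up: "?k i = Suc (?k (i - 1))" "deg (?k (i - 1)) = i - 1" if "a < i" for i
    using that by (auto simp: deg_def)
  have upd: "deg (?k i) = i" if "a \<le> i" for i using that by (simp add: deg_def)
  have dF: "diff F i \<in> module_hom R (obj F i) (obj F (i - 1))" for i
  proof (cases "a < i")
    case True
    show ?thesis using tr[of "?k (i - 1)"] True unfolding objF up(1)[OF True]
      by (simp add: F_def up(1)[OF True])
  next
    case False
    then show ?thesis using module_hom_zero[OF FM[of 0]] by (simp add: F_def low)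
  qed
  have cycF: "cycles F i = Z (?k i)" if i: "a \<le> i" for i
  proof (cases "a < i")
    case True
    show ?thesis using tr[of "?k (i - 1)"] True unfolding cycles_def objF up(1)[OF True]
      by (simp add: F_def up(1)[OF True])
  next
    case False
    then have ia: "i = a" using i by simp
    note Z0 = submoduleD[OF FM conjunct1[OF st[of 0]]]
    have "Z 0 = {\<zero>\<^bsub>?E 0\<^esub>}" using Z0(1,2) by (auto simp: free_module_zero)
    then show ?thesis unfolding ia by (auto simp: cycles_def F_def N0 free_module_zero)
  qed
  have bdF: "boundaries F i = {z \<in> Z (?k i). \<pi> i z \<in> boundaries M i}" if i: "a \<le> i" for i
  proof -
    have u: "?k (i + 1) = Suc (?k i)" using i by simp
    show ?thesis using tr[of "?k i"] i unfolding boundaries_def[of F] objF u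
      by (simp add: F_def u \<pi>_def upd)
  qed
  have F: "is_complex R F"
  proof (rule is_complexI[OF _ dF])
    show "module R (obj F i)" for i unfolding objF by (rule FM)
    fix i x assume x: "x \<in> carrier (obj F i)"
    show "diff F (i - 1) (diff F i x) = \<zero>\<^bsub>obj F (i - 2)\<^esub>"
    proof (cases "a < i")
      case True
      then have "diff F i x \<in> boundaries F (i - 1)" using x by (simp add: boundaries_def)
      then have "diff F i x \<in> cycles F (i - 1)" using bdF[of "i - 1"] cycF[of "i - 1"] True by simp
      then show ?thesis by (simp add: cycles_def)
    next
      case False
      then show ?thesis by (simp add: F_def low)
    qed
  qed
  note aF = is_complex_additive[OF F]
  have ch: "chain_map R F M \<pi>"
    unfolding chain_map_def
  proof (intro allI conjI ballI)
    fix i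
    show h: "\<pi> i \<in> module_hom R (obj F i) (obj M i)"
    proof (cases "a \<le> i")
      case True
      show ?thesis using st[of "?k i"] True unfolding objF upd[OF True] by (simp add: \<pi>_def)
    qed (simp add: \<pi>_def module_hom_zero[OF MM])
    fix x assume x: "x \<in> carrier (obj F i)"
    show "diff M i (\<pi> i x) = \<pi> (i - 1) (diff F i x)"
    proof (cases "a < i")
      case True
      show ?thesis using tr[of "?k (i - 1)"] True x unfolding objF up(1)[OF True] up(2)[OF True]
        by (simp add: F_def up(1)[OF True] \<pi>_def)
    next
      case False
      have "\<pi> (i - 1) = (\<lambda>x. \<zero>\<^bsub>obj M (i - 1)\<^esub>)" using False by (simp add: \<pi>_def)
      moreover have "\<pi> i x = \<zero>\<^bsub>obj M i\<^esub>"
        using zlow[OF _ x] False hom_zero[OF is_complexD(1)[OF F] MM h] by simp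
      ultimately show ?thesis by (simp add: hom_zero[OF MM MM is_complexD(2)[OF M]])
    qed
  qed
  have q: "quasi_iso R F M \<pi>"
  proof (rule quasi_isoI[OF F M ch])
    fix i z assume z: "z \<in> cycles F i" "\<pi> i z \<in> boundaries M i"
    show "z \<in> boundaries F i"
    proof (cases "a \<le> i")
      case True then show ?thesis using z by (simp add: cycF bdF)
    next
      case False
      then show ?thesis using zlow[of i z] cycles_carrier[OF aF z(1)] boundaries_zero[OF aF] by simp
    qed
  next
    fix i w assume w: "w \<in> cycles M i"
    show "\<exists>z\<in>cycles F i. \<pi> i z \<ominus>\<^bsub>obj M i\<^esub> w \<in> boundaries M i"
    proof (cases "a \<le> i")
      case True
      show ?thesis using st[of "?k i"] w True unfolding cycF[OF True] upd[OF True]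
        by (simp add: \<pi>_def)
    next
      case False
      then have "\<zero>\<^bsub>obj M i\<^esub> \<ominus>\<^bsub>obj M i\<^esub> w \<in> boundaries M i"
        using boundaries_minus[OF aM boundaries_zero[OF aM]] bdd[of i] w by auto
      then show ?thesis using False cycles_zero[OF aF, of i]
        by (intro bexI[of _ "\<zero>\<^bsub>obj F i\<^esub>"]) (simp_all add: \<pi>_def)
    qed
  qed
  have "bounded_below_fp R F (a + 1)"
    unfolding bounded_below_fp_def
  proof (intro conjI allI impI F)
    show "finite_projective R (obj F i)" for i unfolding objF by (rule finite_projective_free[OF R])
    show "zero_module (obj F i)" if "i < a + 1" for i
      using that by (simp add: zero_module_def objF low free_module_zero)
  qed
  with q show ?thesis by blast
qed

section \<open>Truncation\<close>

lemma submodule_module: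
  assumes M: "module R M" and H: "submodule H R M"
  shows "module R (M\<lparr>carrier := H\<rparr>)"
proof -
  interpret M: module R M by fact
  note HD = submoduleD[OF M H]
  have c: "x \<in> carrier M" if "x \<in> H" for x using HD(1) that by blast
  show ?thesis
  proof (rule moduleI)
    show "cring R" by (rule M.R.is_cring)
    show "abelian_group (M\<lparr>carrier := H\<rparr>)"
    proof (rule abelian_groupI)
      fix x assume x: "x \<in> carrier (M\<lparr>carrier := H\<rparr>)"
      then have "\<ominus>\<^bsub>M\<^esub> x \<in> H" using M.submoduleE(3)[OF H] by simp
      then show "\<exists>y\<in>carrier (M\<lparr>carrier := H\<rparr>). y \<oplus>\<^bsub>M\<lparr>carrier := H\<rparr>\<^esub> x = \<zero>\<^bsub>M\<lparr>carrier := H\<rparr>\<^esub>"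
        using x c by (auto intro!: bexI[of _ "\<ominus>\<^bsub>M\<^esub> x"] simp: M.l_neg)
    qed (simp_all add: HD c M.a_ac)
  qed (simp_all add: HD c M.smult_l_distr M.smult_r_distr M.smult_assoc1)
qed

definition subcomplex :: "('a, 'm) cpx \<Rightarrow> (int \<Rightarrow> 'm set) \<Rightarrow> ('a, 'm) cpx" where
  "subcomplex C S = \<lparr>obj = (\<lambda>i. (obj C i)\<lparr>carrier := S i\<rparr>), diff = diff C\<rparr>"

lemma subcomplex:
  assumes C: "is_complex R C" and S: "\<And>i. submodule (S i) R (obj C i)"
    and d: "\<And>i x. x \<in> S i \<Longrightarrow> diff C i x \<in> S (i - 1)"
  shows "is_complex R (subcomplex C S)" "chain_map R (subcomplex C S) C (\<lambda>i x. x)"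
    "cycles (subcomplex C S) i = S i \<inter> cycles C i"
    "boundaries (subcomplex C S) i = diff C (i + 1) ` S (i + 1)"
proof -
  note CM = is_complexD(1)[OF C]
  have sub: "x \<in> carrier (obj C i)" if "x \<in> S i" for i x using submoduleD(1)[OF CM S] that by blast
  show "is_complex R (subcomplex C S)"
  proof (rule is_complexI)
    fix i
    show "module R (obj (subcomplex C S) i)" by (simp add: subcomplex_def submodule_module[OF CM S])
    show "diff (subcomplex C S) i \<in>
        module_hom R (obj (subcomplex C S) i) (obj (subcomplex C S) (i - 1))"
      by (rule module_homI)
        (simp_all add: subcomplex_def d sub hom_add[OF is_complexD(2)[OF C]]
          hom_smult[OF is_complexD(2)[OF C]])
    fix x assume "x \<in> carrier (obj (subcomplex C S) i)"
    then show "diff (subcomplex C S) (i - 1) (diff (subcomplex C S) i x) =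
        \<zero>\<^bsub>obj (subcomplex C S) (i - 2)\<^esub>"
      by (simp add: subcomplex_def sub is_complexD(3)[OF C])
  qed
  show "chain_map R (subcomplex C S) C (\<lambda>i x. x)"
    unfolding chain_map_def by (auto simp: subcomplex_def sub intro!: module_homI)
  show "cycles (subcomplex C S) i = S i \<inter> cycles C i"
    using sub by (auto simp: cycles_def subcomplex_def)
  show "boundaries (subcomplex C S) i = diff C (i + 1) ` S (i + 1)"
    by (simp add: boundaries_def subcomplex_def)
qed

lemma zero_submodule: "module R M \<Longrightarrow> submodule {\<zero>\<^bsub>M\<^esub>} R M"
proof -
  assume M: "module R M"
  then interpret M: module R M .
  show ?thesis by (rule M.submoduleI) (auto simp: ag_uminus_zero[OF module_abelian_group[OF M]])
qed

lemma image_submodule: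
  assumes M: "module R M" and N: "module R N" and f: "f \<in> module_hom R M N"
  shows "submodule (f ` carrier M) R N"
proof -
  interpret M: module R M by fact
  interpret N: module R N by fact
  show ?thesis
  proof (rule N.submoduleI)
    show "f ` carrier M \<subseteq> carrier N" by (auto simp: hom_closed[OF f])
    show "\<zero>\<^bsub>N\<^esub> \<in> f ` carrier M" using hom_zero[OF M N f] M.zero_closed by (metis imageI)
  qed (auto simp: hom_uminus[OF M N f, symmetric] hom_add[OF f, symmetric]
    hom_smult[OF f, symmetric])
qed

text \<open>
  \<open>G\<close> is a retraction of \<open>F\<^sub>m\<close> onto the boundaries, so \<open>e = 1 - G\<close> is an idempotent with these as its
  kernel and \<open>d e = d\<close>.  The subcomplex that is \<open>F\<^sub>i\<close> for \<open>i < m\<close>, the image of \<open>e\<close> in degree \<open>m\<close>, and zero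
  above has the same homology, and its modules are retracts of the \<open>F\<^sub>i\<close>.
\<close>

lemma truncate_resolution:
  fixes F :: "('a, 'p) cpx"
  assumes M: "is_complex R M" and bb: "bounded_below_fp R F a" and q: "quasi_iso R F M \<pi>"
    and acyclic: "\<And>i. i > m \<Longrightarrow> cycles F i \<subseteq> boundaries F i"
    and G: "G \<in> module_hom R (obj F m) (obj F m)"
    and G_into: "\<And>x. x \<in> carrier (obj F m) \<Longrightarrow> G x \<in> boundaries F m"
    and G_id: "\<And>b. b \<in> boundaries F m \<Longrightarrow> G b = b"
  shows "\<exists>(F' :: ('a, 'p) cpx) \<pi>'. bounded_below_fp R F' a \<and> quasi_iso R F' M \<pi>' \<and>
      (\<forall>i>m. zero_module (obj F' i))"
proof -
  have F: "is_complex R F" and fp: "\<And>i. finite_projective R (obj F i)"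
    and zF: "\<And>i. i < a \<Longrightarrow> zero_module (obj F i)" using bb by (auto simp: bounded_below_fp_def)
  note FM = is_complexD(1)[OF F] and aF = is_complex_additive[OF F]
  interpret Fm: module R "obj F m" by (rule FM)
  define e where "e = (\<lambda>x. x \<ominus>\<^bsub>obj F m\<^esub> G x)"
  have eh: "e \<in> module_hom R (obj F m) (obj F m)"
    unfolding e_def by (rule module_hom_diff[OF FM module_hom_id G])
  have e_bd: "e b = \<zero>\<^bsub>obj F m\<^esub>" if "b \<in> boundaries F m" for b
    using G_id[OF that] boundaries_carrier[OF aF that]
      ag_minus_eq_zero[OF module_abelian_group[OF FM]] by (simp add: e_def)
  have e_idem: "e (e x) = e x" if x: "x \<in> carrier (obj F m)" for x
  proof -
    have "e (e x) = e x \<ominus>\<^bsub>obj F m\<^esub> e (G x)"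
      using hom_minus[OF FM FM eh x hom_closed[OF G x]] unfolding e_def by simp
    then show ?thesis using e_bd[OF G_into[OF x]] hom_closed[OF eh x]
      by (simp add: ag_minus_zero[OF module_abelian_group[OF FM]])
  qed
  have d_bd: "diff F m b = \<zero>\<^bsub>obj F (m - 1)\<^esub>" if "b \<in> boundaries F m" for b
    using boundaries_subset_cycles[OF aF] that by (auto simp: cycles_def)
  have de: "diff F m (e x) = diff F m x" if x: "x \<in> carrier (obj F m)" for x
    using hom_minus[OF FM FM is_complexD(2)[OF F] x hom_closed[OF G x]] d_bd[OF G_into[OF x]]
      is_complexD(4)[OF F x] by (simp add: e_def ag_minus_zero[OF module_abelian_group[OF FM]])
  define S where "S = (\<lambda>i. if i < m then carrier (obj F i) else if i = m then e ` carrier (obj F m)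
      else {\<zero>\<^bsub>obj F i\<^esub>})"
  have S_sub: "submodule (S i) R (obj F i)" for i
    using submodule_carrier[OF FM] image_submodule[OF FM FM eh] zero_submodule[OF FM]
      by (simp add: S_def)
  have zd: "diff F i \<zero>\<^bsub>obj F i\<^esub> = \<zero>\<^bsub>obj F (i - 1)\<^esub>" for i
    by (rule hom_zero[OF FM FM is_complexD(2)[OF F]])
  have Sc: "x \<in> carrier (obj F i)" if "x \<in> S i" for i x using submoduleD(1)[OF FM S_sub] that
    by blast
  have S_d: "diff F i x \<in> S (i - 1)" if x: "x \<in> S i" for i x
  proof (cases "i \<le> m")
    case True
    then show ?thesis using is_complexD(4)[OF F Sc[OF x]] by (simp add: S_def)
  next
    case False
    then have "x = \<zero>\<^bsub>obj F i\<^esub>" using x by (simp add: S_def)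
    then show ?thesis using submoduleD(2)[OF FM S_sub] by (simp add: zd)
  qed
  note sc = subcomplex[OF F S_sub S_d]
  let ?F = "subcomplex F S"
  have "bounded_below_fp R ?F a"
    unfolding bounded_below_fp_def
  proof (intro conjI allI impI sc(1))
    fix i
    have inc: "(\<lambda>x. x) \<in> module_hom R (obj ?F i) (obj F i)" by (rule chain_mapD(1)[OF sc(2)])
    \<comment> \<open>each module of the subcomplex is a retract of the corresponding \<open>F\<^sub>i\<close>\<close>
    let ?r = "if i < m then (\<lambda>x. x) else if i = m then e else (\<lambda>x. \<zero>\<^bsub>obj F i\<^esub>)"
    have r: "?r \<in> module_hom R (obj F i) (obj F i)"
      using module_hom_id eh module_hom_zero[OF FM] by auto
    have "?r x \<in> S i" if "x \<in> carrier (obj F i)" for x using that by (auto simp: S_def)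
    then have r': "?r \<in> module_hom R (obj F i) (obj ?F i)"
      using hom_add[OF r] hom_smult[OF r]
        by (intro module_homI) (simp_all add: subcomplex_def del: if_split_asm)
    show "finite_projective R (obj ?F i)"
    proof (rule finite_projective_retract[OF fp is_complexD(1)[OF sc(1)] inc r'])
      fix x assume "x \<in> carrier (obj ?F i)"
      then have "x \<in> S i" by (simp add: subcomplex_def)
      then show "?r x = x" using e_idem by (auto simp: S_def split: if_splits)
    qed
    assume i: "i < a"
    have "S i = {\<zero>\<^bsub>obj F i\<^esub>}"
      using submoduleD(1,2)[OF FM S_sub, of i] zF[OF i] unfolding zero_module_def by blast
    then show "zero_module (obj ?F i)" by (simp add: zero_module_def subcomplex_def)
  qed
  moreover have "quasi_iso R ?F F (\<lambda>i x. x)"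
  proof (rule quasi_isoI[OF sc(1) F sc(2)])
    fix i z assume "z \<in> cycles ?F i" and b: "z \<in> boundaries F i"
    then have z: "z \<in> S i \<inter> cycles F i" by (simp add: sc(3))
    have zero: "\<zero>\<^bsub>obj F i\<^esub> \<in> diff F (i + 1) ` S (i + 1)"
      using zd[of "i + 1"] submoduleD(2)[OF FM S_sub, of "i + 1"]
        by (auto intro!: image_eqI[of _ _ "\<zero>\<^bsub>obj F (i + 1)\<^esub>"])
    consider "i + 1 < m" | "i + 1 = m" | "i = m" | "i > m" by linarith
    then have "z \<in> diff F (i + 1) ` S (i + 1)"
    proof cases
      case 1 then show ?thesis using b by (simp add: boundaries_def S_def)
    next
      case 2
      then obtain x where x: "x \<in> carrier (obj F m)" "z = diff F m x" using b
        by (auto simp: boundaries_def)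
      show ?thesis
      proof (rule image_eqI)
        show "z = diff F (i + 1) (e x)" using de[OF x(1)] x(2) 2 by simp
        show "e x \<in> S (i + 1)" using x(1) 2 by (simp add: S_def)
      qed
    next
      case 3
      then obtain x where x: "x \<in> carrier (obj F m)" "z = e x" using z by (auto simp: S_def)
      have "z = \<zero>\<^bsub>obj F i\<^esub>" using e_bd b e_idem[OF x(1)] x(2) 3 by simp
      then show ?thesis using zero by simp
    next
      case 4
      then show ?thesis using z zero by (simp add: S_def)
    qed
    then show "z \<in> boundaries ?F i" by (simp add: sc(4))
  next
    fix i w assume w: "w \<in> cycles F i"
    have wc: "w \<in> carrier (obj F i)" by (rule cycles_carrier[OF aF w])
    interpret Fi: module R "obj F i" by (rule FM)
    consider "i < m" | "i = m" | "i > m" by linarith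
    then have "\<exists>z\<in>S i \<inter> cycles F i. z \<ominus>\<^bsub>obj F i\<^esub> w \<in> boundaries F i"
    proof cases
      case 1
      then have "w \<in> S i \<inter> cycles F i" using w wc by (simp add: S_def)
      moreover have "w \<ominus>\<^bsub>obj F i\<^esub> w \<in> boundaries F i"
        using wc boundaries_zero[OF aF]
          by (simp add: ag_minus_eq_zero[OF module_abelian_group[OF FM], THEN iffD2])
      ultimately show ?thesis by blast
    next
      case 2
      have "e w \<in> S i \<inter> cycles F i"
        using w wc 2 de hom_closed[OF eh] by (auto simp: S_def cycles_def)
      moreover have "e w \<ominus>\<^bsub>obj F i\<^esub> w = \<zero>\<^bsub>obj F i\<^esub> \<ominus>\<^bsub>obj F i\<^esub> G w"
        using wc hom_closed[OF G] 2 by (simp add: e_def Fm.ag_normalize)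
      moreover have "\<zero>\<^bsub>obj F i\<^esub> \<ominus>\<^bsub>obj F i\<^esub> G w \<in> boundaries F i"
        using boundaries_minus[OF aF boundaries_zero[OF aF]] G_into wc 2 by blast
      ultimately show ?thesis by (intro bexI[of _ "e w"]) simp_all
    next
      case 3
      have "\<zero>\<^bsub>obj F i\<^esub> \<ominus>\<^bsub>obj F i\<^esub> w \<in> boundaries F i"
        using boundaries_minus[OF aF boundaries_zero[OF aF]] acyclic[OF 3] w by blast
      then show ?thesis using 3 cycles_zero[OF aF]
        by (intro bexI[of _ "\<zero>\<^bsub>obj F i\<^esub>"]) (simp_all add: S_def)
    qed
    then show "\<exists>z\<in>cycles ?F i. z \<ominus>\<^bsub>obj F i\<^esub> w \<in> boundaries F i" by (simp only: sc(3))
  qed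
  from quasi_iso_comp[OF sc(1) F M this q] have "quasi_iso R ?F M \<pi>" by simp
  moreover have "\<forall>i>m. zero_module (obj ?F i)" by (simp add: zero_module_def subcomplex_def S_def)
  ultimately show ?thesis by blast
qed

section \<open>Cocycles with values in syzygies\<close>

text \<open>
  For a resolution \<open>F\<close> of \<open>M\<close> and a module \<open>N\<close> this expresses that \<open>Ext\<^sup>j(M, N) = 0\<close>.
\<close>

definition cocycles_extend :: "('a, 'r) ring_scheme \<Rightarrow> ('a, 'p) cpx \<Rightarrow> ('a, 'n) module \<Rightarrow> int \<Rightarrow> bool"
  where
  "cocycles_extend R F N j \<longleftrightarrow> (\<forall>f\<in>module_hom R (obj F j) N.
     (\<forall>x\<in>carrier (obj F (j + 1)). f (diff F (j + 1) x) = \<zero>\<^bsub>N\<^esub>) \<longrightarrow>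
     (\<exists>g\<in>module_hom R (obj F (j - 1)) N. \<forall>x\<in>carrier (obj F j). f x = g (diff F j x)))"

lemma cocycles_extendD:
  assumes "cocycles_extend R F N j" "f \<in> module_hom R (obj F j) N"
    "\<And>x. x \<in> carrier (obj F (j + 1)) \<Longrightarrow> f (diff F (j + 1) x) = \<zero>\<^bsub>N\<^esub>"
  shows "\<exists>g\<in>module_hom R (obj F (j - 1)) N. \<forall>x\<in>carrier (obj F j). f x = g (diff F j x)"
  using assms unfolding cocycles_extend_def by simp

text \<open>
  The coordinates of a cocycle with respect to a dual basis are cocycles with values in the ring.
\<close>

lemma cocycles_extend_finite_projective:
  assumes F: "is_complex R F" and fp: "finite_projective R P"
    and ext: "cocycles_extend R F (regular_module R) j"
  shows "cocycles_extend R F P j"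
  unfolding cocycles_extend_def
proof (intro ballI impI)
  have P: "module R P" using fp by (rule finite_projective_module)
  interpret P: module R P by fact
  have Rm: "module R (regular_module R)" by (rule regular_module[OF P.R.is_cring])
  fix f assume f: "f \<in> module_hom R (obj F j) P"
    and fd: "\<forall>x\<in>carrier (obj F (j + 1)). f (diff F (j + 1) x) = \<zero>\<^bsub>P\<^esub>"
  obtain n b \<phi> where b: "\<And>k. k < n \<Longrightarrow> b k \<in> carrier P"
    and \<phi>: "\<And>k. k < n \<Longrightarrow> \<phi> k \<in> module_hom R P (regular_module R)"
    and ex: "\<And>x. x \<in> carrier P \<Longrightarrow> x = (\<Oplus>\<^bsub>P\<^esub>k\<in>{..<n::nat}. \<phi> k x \<odot>\<^bsub>P\<^esub> b k)"
    using fp unfolding finite_projective_def by blast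
  have "\<exists>g. k < n \<longrightarrow> g \<in> module_hom R (obj F (j - 1)) (regular_module R) \<and>
      (\<forall>x\<in>carrier (obj F j). \<phi> k (f x) = g (diff F j x))" for k
  proof (cases "k < n")
    case True
    have "\<exists>g\<in>module_hom R (obj F (j - 1)) (regular_module R). \<forall>x\<in>carrier (obj F j). \<phi> k (f x) =
        g (diff F j x)"
      by (rule cocycles_extendD[OF ext module_hom_comp[OF f \<phi>[OF True]]])
        (use fd hom_zero[OF P Rm \<phi>[OF True]] in simp)
    then show ?thesis by blast
  qed simp
  then obtain g where g: "\<And>k. k < n \<Longrightarrow> g k \<in> module_hom R (obj F (j - 1)) (regular_module R)"
    "\<And>k x. k < n \<Longrightarrow> x \<in> carrier (obj F j) \<Longrightarrow> \<phi> k (f x) = g k (diff F j x)" by metis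
  show "\<exists>g\<in>module_hom R (obj F (j - 1)) P. \<forall>x\<in>carrier (obj F j). f x = g (diff F j x)"
  proof (intro bexI ballI)
    show "(\<lambda>y. \<Oplus>\<^bsub>P\<^esub>k\<in>{..<n}. g k y \<odot>\<^bsub>P\<^esub> b k) \<in> module_hom R (obj F (j - 1)) P"
      by (rule module_hom_lincomb[OF is_complexD(1)[OF F] P g(1) b])
    fix x assume x: "x \<in> carrier (obj F j)"
    have c: "g k (diff F j x) \<in> carrier R" if "k < n" for k
      using hom_closed[OF g(1)[OF that] is_complexD(4)[OF F x]] by simp
    have "f x = (\<Oplus>\<^bsub>P\<^esub>k\<in>{..<n}. \<phi> k (f x) \<odot>\<^bsub>P\<^esub> b k)" by (rule ex[OF hom_closed[OF f x]])
    also have "\<dots> = (\<Oplus>\<^bsub>P\<^esub>k\<in>{..<n}. g k (diff F j x) \<odot>\<^bsub>P\<^esub> b k)"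
      by (rule P.finsum_cong') (use g(2) x b c in auto)
    finally show "f x = (\<Oplus>\<^bsub>P\<^esub>k\<in>{..<n}. g k (diff F j x) \<odot>\<^bsub>P\<^esub> b k)" .
  qed
qed

text \<open>
  The lower half of a chain map into the finite complex of all \<open>X\<^sub>j\<close> with \<open>j < i\<close>: \<open>f\<close> extends along the
  differential to \<open>g : F\<^sub>i\<^sub>-\<^sub>1 \<rightarrow> X\<^sub>i\<^sub>-\<^sub>1\<close>, then \<open>d g\<close> is a cocycle in degree \<open>i - 1\<close>, and so on until \<open>X\<close>
  vanishes.
\<close>

lemma extend_downwards:
  assumes F: "is_complex R F" and X: "is_complex R X" and fpX: "\<And>j. finite_projective R (obj X j)"
    and zX: "\<And>j. j < a \<Longrightarrow> zero_module (obj X j)"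
    and ext: "\<And>j. j > a \<Longrightarrow> cocycles_extend R F (regular_module R) j"
  shows "\<lbrakk>f \<in> module_hom R (obj F i) (obj X (i - 1));
     \<And>x. x \<in> carrier (obj F (i + 1)) \<Longrightarrow> f (diff F (i + 1) x) = \<zero>\<^bsub>obj X (i - 1)\<^esub>;
     \<And>x. x \<in> carrier (obj F i) \<Longrightarrow> diff X (i - 1) (f x) = \<zero>\<^bsub>obj X (i - 2)\<^esub>\<rbrakk> \<Longrightarrow>
   \<exists>g. (\<forall>j<i. g j \<in> module_hom R (obj F j) (obj X j)) \<and>
     (\<forall>x\<in>carrier (obj F i). f x = g (i - 1) (diff F i x)) \<and>
     (\<forall>j<i. \<forall>x\<in>carrier (obj F j). diff X j (g j x) = g (j - 1) (diff F j x))"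
proof (induction "nat (i - a)" arbitrary: i f)
  case 0
  note XM = is_complexD(1)[OF X]
  have "f x = \<zero>\<^bsub>obj X (i - 1)\<^esub>" if "x \<in> carrier (obj F i)" for x
    using zero_moduleD[OF zX[of "i - 1"] hom_closed[OF 0(2) that]] 0(1) by simp
  then show ?case
    by (intro exI[of _ "\<lambda>j x. \<zero>\<^bsub>obj X j\<^esub>"])
      (auto simp: hom_zero[OF XM XM is_complexD(2)[OF X]] intro: module_hom_zero XM)
next
  case (Suc n)
  note XM = is_complexD(1)[OF X]
  have ia: "i > a" using Suc(2) by linarith
  obtain g0 where g0: "g0 \<in> module_hom R (obj F (i - 1)) (obj X (i - 1))"
    "\<And>x. x \<in> carrier (obj F i) \<Longrightarrow> f x = g0 (diff F i x)"
    using cocycles_extendD[OF cocycles_extend_finite_projective[OF F fpX ext[OF ia]] Suc.prems(1,2)]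
      by blast
  let ?f = "\<lambda>x. diff X (i - 1) (g0 x)"
  have e: "i - 1 - 1 = i - 2" "i - 1 + 1 = i" "i - 1 - 2 = i - 2 - 1" by simp_all
  have "\<exists>g. (\<forall>j<i-1. g j \<in> module_hom R (obj F j) (obj X j)) \<and>
     (\<forall>x\<in>carrier (obj F (i - 1)). ?f x = g (i - 1 - 1) (diff F (i - 1) x)) \<and>
     (\<forall>j<i-1. \<forall>x\<in>carrier (obj F j). diff X j (g j x) = g (j - 1) (diff F j x))"
  proof (rule Suc.hyps(1))
    show "n = nat (i - 1 - a)" using Suc(2) by linarith
    show "?f \<in> module_hom R (obj F (i - 1)) (obj X (i - 1 - 1))"
      by (rule module_hom_comp[OF g0(1) is_complexD(2)[OF X]])
    show "diff X (i - 1) (g0 (diff F (i - 1 + 1) x)) = \<zero>\<^bsub>obj X (i - 1 - 1)\<^esub>"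
      if "x \<in> carrier (obj F (i - 1 + 1))" for x
      using that g0(2)[of x] Suc.prems(3)[of x] by (simp add: e)
    show "diff X (i - 1 - 1) (diff X (i - 1) (g0 x)) = \<zero>\<^bsub>obj X (i - 1 - 2)\<^esub>"
      if "x \<in> carrier (obj F (i - 1))" for x
      using is_complexD(3)[OF X hom_closed[OF g0(1) that]] by simp
  qed
  then obtain g where g: "\<And>j. j < i - 1 \<Longrightarrow> g j \<in> module_hom R (obj F j) (obj X j)"
    "\<And>x. x \<in> carrier (obj F (i - 1)) \<Longrightarrow> ?f x = g (i - 2) (diff F (i - 1) x)"
    "\<And>j x. j < i - 1 \<Longrightarrow> x \<in> carrier (obj F j) \<Longrightarrow> diff X j (g j x) = g (j - 1) (diff F j x)"
    unfolding e by blast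
  show ?case
  proof (intro exI[of _ "\<lambda>j. if j = i - 1 then g0 else g j"] conjI allI impI ballI)
    fix j assume j: "j < i"
    show "(if j = i - 1 then g0 else g j) \<in> module_hom R (obj F j) (obj X j)" using g0 g(1) j
      by simp
    fix x assume "x \<in> carrier (obj F j)"
    then show "diff X j ((if j = i - 1 then g0 else g j) x) =
        (if j - 1 = i - 1 then g0 else g (j - 1)) (diff F j x)"
      using j g(2,3) by (cases "j = i - 1") (simp_all add: e)
  qed (use g0 in simp)
qed

text \<open>
  The upper half of the chain map exists because \<open>F\<close> is projective and \<open>X\<close> is exact there.
\<close>

lemma extend_upwards:
  assumes F: "is_complex R F" and fpF: "\<And>j. finite_projective R (obj F j)" and X: "is_complex R X"
    and exact: "\<And>j. j \<ge> i - 1 \<Longrightarrow> cycles X j \<subseteq> boundaries X j"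
    and f: "f \<in> module_hom R (obj F i) (obj X (i - 1))"
    and fd: "\<And>x. x \<in> carrier (obj F (i + 1)) \<Longrightarrow> f (diff F (i + 1) x) = \<zero>\<^bsub>obj X (i - 1)\<^esub>"
    and df: "\<And>x. x \<in> carrier (obj F i) \<Longrightarrow> diff X (i - 1) (f x) = \<zero>\<^bsub>obj X (i - 2)\<^esub>"
  shows "\<exists>g. (\<forall>j\<ge>i. g j \<in> module_hom R (obj F j) (obj X j)) \<and>
     (\<forall>x\<in>carrier (obj F i). diff X i (g i x) = f x) \<and>
     (\<forall>j>i. \<forall>x\<in>carrier (obj F j). diff X j (g j x) = g (j - 1) (diff F j x))"
proof -
  note XM = is_complexD(1)[OF X] and FM = is_complexD(1)[OF F]
  have lift: "\<exists>\<tau>\<in>module_hom R (obj F j) (obj X j). \<forall>x\<in>carrier (obj F j). diff X j (\<tau> x) = \<sigma> x"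
    if \<sigma>: "\<sigma> \<in> module_hom R (obj F j) (obj X (j - 1))" and j: "j \<ge> i"
      and c: "\<And>x. x \<in> carrier (obj F j) \<Longrightarrow> diff X (j - 1) (\<sigma> x) = \<zero>\<^bsub>obj X (j - 2)\<^esub>" for \<sigma> j
  proof (rule finite_projective_lift[OF fpF XM XM is_complexD(2)[OF X] \<sigma>])
    fix x assume x: "x \<in> carrier (obj F j)"
    have "\<sigma> x \<in> cycles X (j - 1)" using hom_closed[OF \<sigma> x] c[OF x] by (simp add: cycles_def)
    then have "\<sigma> x \<in> boundaries X (j - 1)" using exact[of "j - 1"] j by auto
    then show "\<exists>u\<in>carrier (obj X j). diff X j u = \<sigma> x" by (auto simp: boundaries_def)
  qed
  let ?j = "\<lambda>n::nat. i + int n"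
  let ?P = "\<lambda>n g. g \<in> module_hom R (obj F (?j n)) (obj X (?j n)) \<and>
      (\<forall>x\<in>carrier (obj F (?j n + 1)). diff X (?j n) (g (diff F (?j n + 1) x)) = \<zero>\<^bsub>obj X (?j n - 1)\<^esub>) \<and>
      (n = 0 \<longrightarrow> (\<forall>x\<in>carrier (obj F i). diff X i (g x) = f x))"
  let ?Q = "\<lambda>n g g'. \<forall>x\<in>carrier (obj F (?j n + 1)). diff X (?j n + 1) (g' x) =
      g (diff F (?j n + 1) x)"
  have "\<exists>s. \<forall>n. ?P n (s n) \<and> ?Q n (s n) (s (Suc n))"
  proof (rule dependent_nat_choice)
    obtain g where g: "g \<in> module_hom R (obj F i) (obj X i)"
      "\<forall>x\<in>carrier (obj F i). diff X i (g x) = f x"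
      using lift[OF f _ df] by auto
    moreover have "\<forall>x\<in>carrier (obj F (i + 1)). diff X i (g (diff F (i + 1) x)) = \<zero>\<^bsub>obj X (i - 1)\<^esub>"
      using g(2) fd diff_diff(2)[OF F] by simp
    ultimately show "\<exists>g. ?P 0 g" by auto
  next
    fix g n assume P: "?P n g"
    let ?k = "?j n + 1"
    have k: "?j (Suc n) = ?k" by simp
    have \<sigma>: "(\<lambda>x. g (diff F ?k x)) \<in> module_hom R (obj F ?k) (obj X (?k - 1))"
      using module_hom_comp[OF diff_hom[OF F] conjunct1[OF P]] by simp
    obtain g' where g': "g' \<in> module_hom R (obj F ?k) (obj X ?k)"
      "\<forall>x\<in>carrier (obj F ?k). diff X ?k (g' x) = g (diff F ?k x)"
      using lift[OF \<sigma>] P by auto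
    have "diff X ?k (g' (diff F (?k + 1) x)) = \<zero>\<^bsub>obj X (?k - 1)\<^esub>" if x: "x \<in> carrier (obj F (?k + 1))"
      for x
      using g'(2) diff_diff[OF F x] hom_zero[OF FM XM conjunct1[OF P]] by simp
    with g' have "?P (Suc n) g'" unfolding k by simp
    with g'(2) show "\<exists>g'. ?P (Suc n) g' \<and> ?Q n g g'" by blast
  qed
  then obtain s where s: "\<forall>n. ?P n (s n) \<and> ?Q n (s n) (s (Suc n))" by (rule exE)
  show ?thesis
  proof (intro exI[of _ "\<lambda>j. s (nat (j - i))"] conjI allI impI)
    fix j :: int assume "i \<le> j"
    then show "s (nat (j - i)) \<in> module_hom R (obj F j) (obj X j)"
      using s[rule_format, of "nat (j - i)"] by simp
  next
    show "\<forall>x\<in>carrier (obj F i). diff X i (s (nat (i - i)) x) = f x" using s[rule_format, of 0]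
      by simp
  next
    fix j :: int assume j: "i < j"
    then have "nat (j - i) = Suc (nat (j - 1 - i))" "?j (nat (j - 1 - i)) + 1 = j" by simp_all
    then show "\<forall>x\<in>carrier (obj F j). diff X j (s (nat (j - i)) x) =
        s (nat (j - 1 - i)) (diff F j x)"
      using s[rule_format, of "nat (j - 1 - i)"] by simp
  qed
qed

text \<open>
  A cocycle \<open>f\<close> from \<open>F\<^sub>i\<close> to the cycles of \<open>X\<^sub>i\<^sub>-\<^sub>1\<close> is the middle of a chain map \<open>F \<rightarrow> X\<close>, obtained by
  extending it in both directions.  A null homotopy \<open>h\<close> of this chain map satisfies \<open>f = d h d\<close>.  When
  \<open>X\<close> is a shift of \<open>F\<close>, this replaces the long exact sequence which places \<open>Ext(M, Z\<^sub>m)\<close> between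
  \<open>Ext(M, M)\<close> and \<open>Ext(M, F\<^sub>\<le>\<^sub>m)\<close>.
\<close>

lemma syzygy_cocycle_extends:
  assumes F: "is_complex R F" and fpF: "\<And>j. finite_projective R (obj F j)"
    and X: "is_complex R X" and fpX: "\<And>j. finite_projective R (obj X j)"
    and zX: "\<And>j. j < a \<Longrightarrow> zero_module (obj X j)"
    and ext: "\<And>j. j > a \<Longrightarrow> cocycles_extend R F (regular_module R) j"
    and exact: "\<And>j. j \<ge> i - 1 \<Longrightarrow> cycles X j \<subseteq> boundaries X j"
    and null: "homs_null R F X"
    and f: "f \<in> module_hom R (obj F i) (obj X (i - 1))"
    and fd: "\<And>x. x \<in> carrier (obj F (i + 1)) \<Longrightarrow> f (diff F (i + 1) x) = \<zero>\<^bsub>obj X (i - 1)\<^esub>"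
    and df: "\<And>x. x \<in> carrier (obj F i) \<Longrightarrow> diff X (i - 1) (f x) = \<zero>\<^bsub>obj X (i - 2)\<^esub>"
  shows "\<exists>g\<in>module_hom R (obj F (i - 1)) (obj X (i - 1)).
     (\<forall>y\<in>carrier (obj F (i - 1)). g y \<in> boundaries X (i - 1)) \<and>
     (\<forall>x\<in>carrier (obj F i). f x = g (diff F i x))"
proof -
  note XM = is_complexD(1)[OF X] and FM = is_complexD(1)[OF F]
  obtain u where u: "\<And>j. j \<ge> i \<Longrightarrow> u j \<in> module_hom R (obj F j) (obj X j)"
     "\<And>x. x \<in> carrier (obj F i) \<Longrightarrow> diff X i (u i x) = f x"
     "\<And>j x. j > i \<Longrightarrow> x \<in> carrier (obj F j) \<Longrightarrow> diff X j (u j x) = u (j - 1) (diff F j x)"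
    using extend_upwards[OF F fpF X exact f fd df] by blast
  obtain l where l: "\<And>j. j < i \<Longrightarrow> l j \<in> module_hom R (obj F j) (obj X j)"
     "\<And>x. x \<in> carrier (obj F i) \<Longrightarrow> f x = l (i - 1) (diff F i x)"
     "\<And>j x. j < i \<Longrightarrow> x \<in> carrier (obj F j) \<Longrightarrow> diff X j (l j x) = l (j - 1) (diff F j x)"
    using extend_downwards[OF F X fpX zX ext f fd df] by blast
  define g where "g j = (if j < i then l j else u j)" for j
  have "chain_map R F X g"
    unfolding chain_map_def
  proof (intro allI conjI ballI)
    fix j show "g j \<in> module_hom R (obj F j) (obj X j)" using u(1) l(1) by (simp add: g_def)
    fix x assume x: "x \<in> carrier (obj F j)"
    consider "j < i" | "j = i" | "j > i" by linarith
    then show "diff X j (g j x) = g (j - 1) (diff F j x)"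
      by cases (use x u(2,3) l(2,3) in \<open>simp_all add: g_def\<close>)
  qed
  then obtain h where h: "\<And>j. h j \<in> module_hom R (obj F j) (obj X (j + 1))"
    "\<And>j x. x \<in> carrier (obj F j) \<Longrightarrow> g j x = diff X (j + 1) (h j x) \<oplus>\<^bsub>obj X j\<^esub> h (j - 1) (diff F j x)"
    using null unfolding homs_null_def null_homotopic_def by blast
  have h1: "h (i - 1) \<in> module_hom R (obj F (i - 1)) (obj X i)" using h(1)[of "i - 1"] by simp
  let ?q = "\<lambda>y. diff X i (h (i - 1) y)"
  show ?thesis
  proof (intro bexI[of _ ?q] conjI ballI)
    show "?q \<in> module_hom R (obj F (i - 1)) (obj X (i - 1))"
      by (rule module_hom_comp[OF h1 is_complexD(2)[OF X]])
    show "?q y \<in> boundaries X (i - 1)" if "y \<in> carrier (obj F (i - 1))" for y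
      using hom_closed[OF h1 that] by (simp add: boundaries_def)
    fix x assume x: "x \<in> carrier (obj F i)"
    have dx: "diff F i x \<in> carrier (obj F (i - 1))" by (rule is_complexD(4)[OF F x])
    interpret A: abelian_group "obj X (i - 1)" by (rule is_complexD(5)[OF X])
    have "f x = g (i - 1) (diff F i x)" using l(2)[OF x] by (simp add: g_def)
    also have "\<dots> = ?q (diff F i x) \<oplus>\<^bsub>obj X (i - 1)\<^esub> h (i - 1 - 1) (diff F (i - 1) (diff F i x))"
      using h(2)[OF dx] by simp
    also have "h (i - 1 - 1) (diff F (i - 1) (diff F i x)) = \<zero>\<^bsub>obj X (i - 1)\<^esub>"
      using is_complexD(3)[OF F x] hom_zero[OF FM XM h(1)[of "i - 2"]] by simp
    finally show "f x = ?q (diff F i x)"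
      using is_complexD(4)[OF X hom_closed[OF h1 dx]] by simp
  qed
qed

lemma cocycles_extend_zero_module:
  assumes F: "is_complex R F" and N: "module R N" and z: "carrier N = {\<zero>\<^bsub>N\<^esub>}"
  shows "cocycles_extend R F N j"
  unfolding cocycles_extend_def
proof (intro ballI impI)
  fix f assume f: "f \<in> module_hom R (obj F j) N"
  have "f x = \<zero>\<^bsub>N\<^esub>" if "x \<in> carrier (obj F j)" for x using hom_closed[OF f that] z by simp
  then show "\<exists>g\<in>module_hom R (obj F (j - 1)) N. \<forall>x\<in>carrier (obj F j). f x = g (diff F j x)"
    by (intro bexI[of _ "\<lambda>x. \<zero>\<^bsub>N\<^esub>"] module_hom_zero N) simp
qed

section \<open>Modules as complexes\<close>

definition concentrated :: "('a, 'm) module \<Rightarrow> ('a, 'm) cpx" where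
  "concentrated N = \<lparr>obj = (\<lambda>i. N\<lparr>carrier := if i = 0 then carrier N else {\<zero>\<^bsub>N\<^esub>}\<rparr>), diff =
      (\<lambda>i x. \<zero>\<^bsub>N\<^esub>)\<rparr>"

lemma ring_complex_concentrated: "ring_complex R = concentrated (regular_module R)"
  by (auto simp: ring_complex_def concentrated_def regular_module_def fun_eq_iff)

context
  fixes R :: "('a, 'r) ring_scheme" and N :: "('a, 'm) module"
  assumes N: "module R N"
begin

lemma concentrated_complex: "is_complex R (concentrated N)"
proof -
  interpret N: module R N by (rule N)
  have m: "module R (N\<lparr>carrier := if i = 0 then carrier N else {\<zero>\<^bsub>N\<^esub>}\<rparr>)" for i :: int
    using submodule_module[OF N submodule_carrier[OF N]] submodule_module[OF N zero_submodule[OF N]]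
      by simp
  show ?thesis
    by (rule is_complexI) (auto simp: concentrated_def m intro!: module_homI)
qed

lemma concentrated_cycles: "cycles (concentrated N) i = (if i = 0 then carrier N else {\<zero>\<^bsub>N\<^esub>})"
  by (auto simp: cycles_def concentrated_def)

lemma concentrated_boundaries: "boundaries (concentrated N) i = {\<zero>\<^bsub>N\<^esub>}"
proof -
  interpret N: module R N by (rule N)
  have "carrier N \<noteq> {}" using N.zero_closed by blast
  then show ?thesis by (auto simp: boundaries_def concentrated_def)
qed

lemma homs_null_concentrated:
  assumes P: "is_complex R P"
  shows "homs_null R P (shift (- n) (concentrated N)) \<longleftrightarrow> cocycles_extend R P N n"
proof -
  interpret N: module R N by (rule N)
  let ?X = "shift (- n) (concentrated N)"
  have ob: "obj ?X i = N\<lparr>carrier := if i = n then carrier N else {\<zero>\<^bsub>N\<^esub>}\<rparr>" for i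
    by (simp add: concentrated_def)
  have un: "\<ominus>\<^bsub>N\<lparr>carrier := if i = n then carrier N else {\<zero>\<^bsub>N\<^esub>}\<rparr>\<^esub> \<zero>\<^bsub>N\<^esub> = \<zero>\<^bsub>N\<^esub>" for i
    using ag_uminus_zero[OF is_complexD(5)[OF is_complex_shift[OF concentrated_complex]], of "- n"
      i] unfolding ob by simp
  have df: "diff ?X i x = \<zero>\<^bsub>N\<^esub>" for i x
    using un[of "i - 1"] by (simp add: shift_def concentrated_def)
  have hom: "f \<in> module_hom R L (obj ?X i) \<longleftrightarrow>
      f \<in> module_hom R L N \<and> (i \<noteq> n \<longrightarrow> (\<forall>x\<in>carrier L. f x = \<zero>\<^bsub>N\<^esub>))" for f i and L :: "('a, 'p) module"
    unfolding ob module_hom_def by (auto simp: Pi_def)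
  note hom = hom[of _ "obj P _"]
  show ?thesis
  proof
    assume null: "homs_null R P ?X"
    show "cocycles_extend R P N n"
      unfolding cocycles_extend_def
    proof (intro ballI impI)
      fix f assume f: "f \<in> module_hom R (obj P n) N"
        and fd: "\<forall>x\<in>carrier (obj P (n + 1)). f (diff P (n + 1) x) = \<zero>\<^bsub>N\<^esub>"
      let ?f = "\<lambda>i x. if i = n then f x else \<zero>\<^bsub>N\<^esub>"
      have "chain_map R P ?X ?f"
        unfolding chain_map_def hom df
      proof (intro allI conjI ballI impI)
        fix i show "?f i \<in> module_hom R (obj P i) N" using f module_hom_zero[OF N]
          by (cases "i = n") simp_all
        show "i \<noteq> n \<Longrightarrow> ?f i x = \<zero>\<^bsub>N\<^esub>" for x by simp
        fix x assume "x \<in> carrier (obj P i)"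
        then show "\<zero>\<^bsub>N\<^esub> = ?f (i - 1) (diff P i x)" using fd by (cases "i = n + 1") auto
      qed
      then obtain h where h: "\<And>i. h i \<in> module_hom R (obj P i) (obj ?X (i + 1))"
        "\<And>i x. x \<in> carrier (obj P i) \<Longrightarrow>
          ?f i x = diff ?X (i + 1) (h i x) \<oplus>\<^bsub>obj ?X i\<^esub> h (i - 1) (diff P i x)"
        using null unfolding homs_null_def null_homotopic_def by blast
      have g: "h (n - 1) \<in> module_hom R (obj P (n - 1)) N" using h(1)[of "n - 1"] unfolding hom
        by simp
      show "\<exists>g\<in>module_hom R (obj P (n - 1)) N. \<forall>x\<in>carrier (obj P n). f x = g (diff P n x)"
      proof (rule bexI[OF _ g], rule ballI)
        fix x assume x: "x \<in> carrier (obj P n)"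
        show "f x = h (n - 1) (diff P n x)"
          using h(2)[OF x] hom_closed[OF g is_complexD(4)[OF P x]] unfolding df ob by simp
      qed
    qed
  next
    assume ext: "cocycles_extend R P N n"
    show "homs_null R P ?X" unfolding homs_null_def
    proof (intro allI impI)
      fix f assume ch: "chain_map R P ?X f"
      have f: "f n \<in> module_hom R (obj P n) N" using chain_mapD(1)[OF ch, of n] unfolding hom
        by simp
      have fz: "f i x = \<zero>\<^bsub>N\<^esub>" if "i \<noteq> n" "x \<in> carrier (obj P i)" for i x
        using chain_mapD(1)[OF ch, of i] that unfolding hom by simp
      have fd: "f n (diff P (n + 1) x) = \<zero>\<^bsub>N\<^esub>" if "x \<in> carrier (obj P (n + 1))" for x
        using chain_mapD(3)[OF ch that] unfolding df by simp
      obtain g where g: "g \<in> module_hom R (obj P (n - 1)) N"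
        "\<And>x. x \<in> carrier (obj P n) \<Longrightarrow> f n x = g (diff P n x)"
        using cocycles_extendD[OF ext f fd] by blast
      let ?h = "\<lambda>i x. if i = n - 1 then g x else \<zero>\<^bsub>N\<^esub>"
      show "null_homotopic R P ?X f"
        unfolding null_homotopic_def hom df
      proof (intro exI[of _ ?h] allI conjI ballI impI)
        fix i show "?h i \<in> module_hom R (obj P i) N" using g module_hom_zero[OF N]
          by (cases "i = n - 1") simp_all
        show "i + 1 \<noteq> n \<Longrightarrow> ?h i x = \<zero>\<^bsub>N\<^esub>" for x by auto
        fix x assume x: "x \<in> carrier (obj P i)"
        show "f i x = \<zero>\<^bsub>N\<^esub> \<oplus>\<^bsub>obj ?X i\<^esub> ?h (i - 1) (diff P i x)"
        proof (cases "i = n")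
          case True
          then show ?thesis using g x hom_closed[OF g(1) is_complexD(4)[OF P]] unfolding ob by simp
        next
          case False
          then show ?thesis using fz[OF False x] unfolding ob by simp
        qed
      qed
    qed
  qed
qed

end

section \<open>Bounds for Ext\<close>

lemma Inf_int_ereal:
  assumes "P k" "\<And>i. P i \<Longrightarrow> k \<le> i"
  shows "Inf {ereal (of_int i) | i. P i} = ereal (of_int k)"
proof (rule antisym)
  show "Inf {ereal (of_int i) | i. P i} \<le> ereal (of_int k)" using assms(1)
    by (auto intro: Inf_lower)
  show "ereal (of_int k) \<le> Inf {ereal (of_int i) | i. P i}" using assms(2)
    by (auto intro!: Inf_greatest)
qed

lemma int_least:
  fixes P :: "int \<Rightarrow> bool"
  assumes "P k" "\<And>i. P i \<Longrightarrow> a \<le> i"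
  shows "\<exists>h. P h \<and> (\<forall>i. P i \<longrightarrow> h \<le> i)"
proof -
  define m where "m = (LEAST m::nat. P (a + int m))"
  have ex: "P (a + int (nat (k - a)))" using assms(1) assms(2)[OF assms(1)] by simp
  have "P (a + int m)" unfolding m_def by (rule LeastI[where P="\<lambda>m. P (a + int m)", OF ex])
  moreover have "a + int m \<le> i" if "P i" for i
  proof -
    have "P (a + int (nat (i - a)))" using that assms(2)[OF that] by simp
    then have "m \<le> nat (i - a)" unfolding m_def by (rule Least_le)
    then show ?thesis using assms(2)[OF that] by linarith
  qed
  ultimately show ?thesis by blast
qed

lemma homology_inf_concentrated:
  assumes N: "module R N" and nz: "carrier N \<noteq> {\<zero>\<^bsub>N\<^esub>}"
  shows "homology_inf (concentrated N) = ereal (of_int 0)"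
  unfolding homology_inf_def
proof (rule Inf_int_ereal)
  interpret N: module R N by (rule N)
  note * = zero_module_homology[OF is_complex_additive[OF concentrated_complex[OF N]]]
  show "\<not> zero_module (homology (concentrated N) 0)"
    using nz N.zero_closed unfolding * concentrated_cycles[OF N] concentrated_boundaries[OF N]
      by auto
  show "0 \<le> i" if "\<not> zero_module (homology (concentrated N) i)" for i
    using that unfolding * concentrated_cycles[OF N] concentrated_boundaries[OF N]
      by (cases "i = 0") simp_all
qed

lemma Sup_int_bounded:
  assumes "Sup {ereal (of_int n) | n. P n} < \<infinity>"
  shows "\<exists>b::int. \<forall>n. P n \<longrightarrow> n < b"
proof -
  obtain k :: nat where k: "Sup {ereal (of_int n) | n. P n} < ereal (real k)"
    using less_PInf_Ex_of_nat[THEN iffD1, OF less_imp_neq[OF assms]] by blast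
  have "n < int k" if "P n" for n
  proof -
    have "ereal (of_int n) \<le> Sup {ereal (of_int n) | n. P n}" using that by (auto intro: Sup_upper)
    then have "ereal (of_int n) < ereal (real k)" using k by (rule le_less_trans)
    then show ?thesis by simp
  qed
  then show ?thesis by blast
qed

text \<open>
  Copies of \<open>C\<close> serve as the bounded complex and as the apex of the roof.
\<close>

lemma bounded_in_Dbf:
  fixes C :: "('a, 'u) cpx"
  assumes C: "is_complex R C" and b: "bounded_complex C"
      and fg: "\<And>i. fin_gen_module R (homology C i)"
  shows "in_Dbf R C"
proof -
  let ?i = "\<lambda>x. [Inr x] :: ('a, 'u) univ"
  let ?k = "\<lambda>x. [Inr (Inl x)] :: ('a, 'u + ('a, 'u) univ) univ"
  have i: "inj ?i" and k: "inj ?k" by (auto simp: inj_def)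
  note N = copy_complex[OF i C] and X = copy_complex[OF k C]
  have "derived_iso R C (copy_cpx ?i C)"
    unfolding derived_iso_def
    using X copy_quasi_isos(2)[OF k C]
      quasi_iso_comp[OF X C N copy_quasi_isos(2)[OF k C] copy_quasi_isos(1)[OF i C]] by blast
  moreover have "bounded_complex (copy_cpx ?i C)"
  proof -
    obtain l u where lu: "\<And>i. i < l \<or> u < i \<Longrightarrow> zero_module (obj C i)" using b
      unfolding bounded_complex_def by blast
    have "zero_module (obj (copy_cpx ?i C) j)" if "j < l \<or> u < j" for j
      using lu[OF that] by (simp add: zero_module_def copy_cpx_def copy_module_def)
    then show ?thesis unfolding bounded_complex_def by blast
  qed
  ultimately show ?thesis unfolding in_Dbf_def using C N fg by blast
qed

lemma concentrated_in_Dbf: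
  assumes N: "module R N" and A: "A \<subseteq> carrier N" "finite A" "carrier N \<subseteq> linear_span R N A"
  shows "in_Dbf R (concentrated N)"
proof (rule bounded_in_Dbf[OF concentrated_complex[OF N]])
  interpret N: module R N by (rule N)
  show "bounded_complex (concentrated N)"
    unfolding bounded_complex_def
    by (intro exI[of _ 0] allI impI) (auto simp: zero_module_def concentrated_def)
  fix i
  have z: "s \<ominus>\<^bsub>obj (concentrated N) i\<^esub> s \<in> boundaries (concentrated N) i"
    if "s \<in> cycles (concentrated N) i" for s
    by (rule subsetD[OF _ boundaries_zero[OF is_complex_additive[OF concentrated_complex[OF N]],
      of i], THEN rev_mp])
      (use that ag_minus_eq_zero[OF is_complexD(5)[OF concentrated_complex[OF N]], of s i s]
         cycles_carrier[OF is_complex_additive[OF concentrated_complex[OF N]] that]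
         boundaries_zero[OF is_complex_additive[OF concentrated_complex[OF N]], of i] in auto)
  show "fin_gen_module R (homology (concentrated N) i)"
    unfolding fin_gen_homology_iff[OF concentrated_complex[OF N]]
  proof (cases "i = 0")
    case True
    then have "obj (concentrated N) i = N" by (simp add: concentrated_def)
    then show "\<exists>A\<subseteq>cycles (concentrated N) i. finite A \<and> (\<forall>z\<in>cycles (concentrated N) i.
        \<exists>s\<in>linear_span R (obj (concentrated N) i) A. s \<ominus>\<^bsub>obj (concentrated N) i\<^esub> z \<in>
        boundaries (concentrated N) i)"
      using A z True by (intro exI[of _ A]) (auto simp: concentrated_cycles[OF N])
  next
    case False
    have "\<zero>\<^bsub>N\<^esub> \<in> linear_span R (obj (concentrated N) i) {}"
      using linear_span.zero[of "obj (concentrated N) i" R "{}"] by (simp add: concentrated_def)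
    then show "\<exists>A\<subseteq>cycles (concentrated N) i. finite A \<and> (\<forall>z\<in>cycles (concentrated N) i.
        \<exists>s\<in>linear_span R (obj (concentrated N) i) A. s \<ominus>\<^bsub>obj (concentrated N) i\<^esub> z \<in>
        boundaries (concentrated N) i)"
      using z False by (intro exI[of _ "{}"]) (auto simp: concentrated_cycles[OF N])
  qed
qed

lemma P_bound_finite:
  assumes "P_bound R M N < \<infinity>" and "homology_inf N = ereal (of_int h)"
  shows "\<exists>b. \<forall>n\<ge>b. zero_module (Ext R n M N)"
proof -
  obtain b where b: "\<And>n. \<exists>h. homology_inf N = ereal (of_int h) \<and> \<not> zero_module (Ext R (n - h) M N) \<Longrightarrow>
      n < b"
    using Sup_int_bounded[OF assms(1)[unfolded P_bound_def]] by blast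
  have "zero_module (Ext R n M N)" if "n \<ge> b - h" for n
  proof (rule ccontr)
    assume "\<not> zero_module (Ext R n M N)"
    then have "n + h < b" using assms(2) by (intro b exI[of _ h]) simp
    then show False using that by simp
  qed
  then show ?thesis by blast
qed

lemma bounded_below_semiprojective_resolution:
  "bounded_below_fp R F a \<Longrightarrow> quasi_iso R F M \<pi> \<Longrightarrow> semiprojective_resolution R M F \<pi>"
  by (simp add: semiprojective_resolution_def bounded_below_semiprojective)

text \<open>
  The existence of \<open>F\<close> guarantees that the resolution chosen in \<open>RHom\<close> is semiprojective, and the
  comparison of resolutions then replaces it by \<open>F\<close>.
\<close>

lemma Ext_zero_iff:
  fixes M :: "('a, 'm) cpx" and F :: "('a, ('a, 'm) univ) cpx" and N :: "('a, 'n) cpx"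
  assumes M: "is_complex R M" and bb: "bounded_below_fp R F a" and q: "quasi_iso R F M \<pi>"
    and N: "is_complex R N"
  shows "zero_module (Ext R n M N) \<longleftrightarrow> homs_null R F (shift (- n) N)"
proof -
  define Q :: "('a, ('a, 'm) univ) cpx" where "Q = (SOME P. \<exists>\<pi>. semiprojective_resolution R M P \<pi>)"
  have "\<exists>\<pi>. semiprojective_resolution R M Q \<pi>"
    unfolding Q_def by (rule someI[of _ F])
      (use bounded_below_semiprojective_resolution[OF bb q] in blast)
  then obtain \<rho> where Q: "semiprojective_resolution R M Q \<rho>" by blast
  then have QC: "is_complex R Q" by (simp add: semiprojective_resolution_def semiprojective_def)
  have "Ext R n M N = homology (hom_complex R Q N) (- n)" by (simp add: Ext_def RHom_def Q_def)
  then show ?thesis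
    using homology_hom_zero_iff[OF QC N]
      homs_null_resolution_iff[OF M Q bb q is_complex_shift[OF N]] by simp
qed

section \<open>Resolutions of minimal length\<close>

text \<open>
  Finite generation is what allows \<open>Ext(M, R)\<close> to control \<open>Ext(M, F\<^sub>p)\<close>.
\<close>

definition has_fp_resolution :: "('a, 'r) ring_scheme \<Rightarrow> ('a, 'm) cpx \<Rightarrow> int \<Rightarrow> bool" where
  "has_fp_resolution R M p \<longleftrightarrow> (\<exists>(F :: ('a, ('a, 'm) univ) cpx) \<pi> a.
     bounded_below_fp R F a \<and> quasi_iso R F M \<pi> \<and> (\<forall>i>p. zero_module (obj F i)))"

lemma Ext_ring_zero_iff:
  fixes M :: "('a, 'm) cpx" and F :: "('a, ('a, 'm) univ) cpx"
  assumes R: "cring R" and M: "is_complex R M" and bb: "bounded_below_fp R F a"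
      and q: "quasi_iso R F M \<pi>"
  shows "zero_module (Ext R n M (ring_complex R)) \<longleftrightarrow> cocycles_extend R F (regular_module R) n"
proof -
  have F: "is_complex R F" using bb by (simp add: bounded_below_fp_def)
  show ?thesis
    unfolding ring_complex_concentrated
      Ext_zero_iff[OF M bb q concentrated_complex[OF regular_module[OF R]]]
      homs_null_concentrated[OF regular_module[OF R] F] ..
qed

text \<open>
  The identity of \<open>F\<^sub>p\<close> is a cocycle because \<open>F\<^sub>p\<^sub>+\<^sub>1 = 0\<close>.  As \<open>F\<^sub>p\<close> is finitely generated projective, it
  is a coboundary \<open>g d\<close>, and then \<open>d g\<close> is a retraction of \<open>F\<^sub>p\<^sub>-\<^sub>1\<close> onto the boundaries.
\<close>

lemma shorten_resolution:
  fixes M :: "('a, 'm) cpx"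
  assumes R: "cring R" and M: "is_complex R M" and p: "has_fp_resolution R M p"
    and E: "zero_module (Ext R p M (ring_complex R))"
  shows "has_fp_resolution R M (p - 1)"
proof -
  obtain F :: "('a, ('a, 'm) univ) cpx" and \<pi> a where bb: "bounded_below_fp R F a"
    and q: "quasi_iso R F M \<pi>"
    and z: "\<And>i. i > p \<Longrightarrow> zero_module (obj F i)" using p unfolding has_fp_resolution_def by blast
  have F: "is_complex R F" and fp: "\<And>i. finite_projective R (obj F i)"
    using bb by (auto simp: bounded_below_fp_def)
  note FM = is_complexD(1)[OF F] and aF = is_complex_additive[OF F]
  have "cocycles_extend R F (obj F p) p"
    using E unfolding Ext_ring_zero_iff[OF R M bb q]
      by (rule cocycles_extend_finite_projective[OF F fp])
  then have "\<exists>g\<in>module_hom R (obj F (p - 1)) (obj F p). \<forall>x\<in>carrier (obj F p). x = g (diff F p x)"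
  proof (rule cocycles_extendD[OF _ module_hom_id])
    fix x assume "x \<in> carrier (obj F (p + 1))"
    then have "x = \<zero>\<^bsub>obj F (p + 1)\<^esub>" using zero_moduleD[OF z] by simp
    then show "diff F (p + 1) x = \<zero>\<^bsub>obj F p\<^esub>" using hom_zero[OF FM FM diff_hom[OF F]] by simp
  qed
  then obtain g where g: "g \<in> module_hom R (obj F (p - 1)) (obj F p)"
    "\<And>x. x \<in> carrier (obj F p) \<Longrightarrow> g (diff F p x) = x" by metis
  let ?G = "\<lambda>y. diff F p (g y)"
  have "\<exists>(F' :: ('a, ('a, 'm) univ) cpx) \<pi>'. bounded_below_fp R F' a \<and> quasi_iso R F' M \<pi>' \<and>
      (\<forall>i>p - 1. zero_module (obj F' i))"
  proof (rule truncate_resolution[OF M bb q])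
    show "?G \<in> module_hom R (obj F (p - 1)) (obj F (p - 1))"
      by (rule module_hom_comp[OF g(1) is_complexD(2)[OF F]])
    show "?G y \<in> boundaries F (p - 1)" if "y \<in> carrier (obj F (p - 1))" for y
      using hom_closed[OF g(1) that] by (simp add: boundaries_def)
    show "?G b = b" if b: "b \<in> boundaries F (p - 1)" for b
    proof -
      obtain x where "x \<in> carrier (obj F p)" "b = diff F p x" using b by (auto simp: boundaries_def)
      then show ?thesis using g(2) by simp
    qed
    fix i assume i: "p - 1 < i"
    show "cycles F i \<subseteq> boundaries F i"
    proof
      fix x assume x: "x \<in> cycles F i"
      have "x = \<zero>\<^bsub>obj F i\<^esub>"
      proof (cases "i = p")
        case True
        have "x = g (diff F p x)" using g(2) cycles_carrier[OF aF x] True by simp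
        also have "diff F p x = \<zero>\<^bsub>obj F (p - 1)\<^esub>" using x True by (simp add: cycles_def)
        finally show ?thesis using hom_zero[OF FM FM g(1)] True by simp
      next
        case False
        then show ?thesis using zero_moduleD[OF z cycles_carrier[OF aF x]] i by simp
      qed
      then show "x \<in> boundaries F i" using boundaries_zero[OF aF] by simp
    qed
  qed
  then show ?thesis unfolding has_fp_resolution_def by blast
qed

text \<open>
  Cocycles on a module \<open>P\<^sub>n = 0\<close> are trivial, and \<open>P\<close> computes the same \<open>Ext\<close> as \<open>F\<close>.
\<close>

lemma Ext_ring_zero_above:
  fixes M :: "('a, 'm) cpx" and F P :: "('a, ('a, 'm) univ) cpx"
  assumes R: "cring R" and M: "is_complex R M" and bb: "bounded_below_fp R F a"
      and q: "quasi_iso R F M \<pi>"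
    and P: "semiprojective_resolution R M P \<rho>" and z: "zero_module (obj P n)"
  shows "zero_module (Ext R n M (ring_complex R))"
proof -
  have PC: "is_complex R P" using P by (simp add: semiprojective_resolution_def semiprojective_def)
  have F: "is_complex R F" using bb by (simp add: bounded_below_fp_def)
  have Rm: "module R (regular_module R)" by (rule regular_module[OF R])
  have "cocycles_extend R P (regular_module R) n"
    unfolding cocycles_extend_def
  proof (intro ballI impI bexI)
    fix f x assume f: "f \<in> module_hom R (obj P n) (regular_module R)" and x: "x \<in> carrier (obj P n)"
    show "f x = \<zero>\<^bsub>regular_module R\<^esub>"
      using hom_zero[OF is_complexD(1)[OF PC] Rm f] zero_moduleD[OF z x] by simp
  qed (rule module_hom_zero[OF Rm])
  then have "homs_null R P (shift (- n) (ring_complex R))"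
    unfolding ring_complex_concentrated homs_null_concentrated[OF Rm PC] .
  then have "homs_null R F (shift (- n) (ring_complex R))"
    using homs_null_resolution_iff[OF M P bb q is_complex_shift[OF concentrated_complex[OF Rm]]]
    by (simp add: ring_complex_concentrated)
  then show ?thesis
    unfolding ring_complex_concentrated Ext_zero_iff[OF M bb q concentrated_complex[OF Rm]] .
qed

text \<open>
  Over the zero ring \<open>inf H(R)\<close> is not an integer and the bound carries no information, but then all
  cocycles with values in \<open>R\<close> are zero.
\<close>

lemma Ext_ring_eventually_zero:
  fixes M :: "('a, 'm) cpx" and F :: "('a, ('a, 'm) univ) cpx"
  assumes R: "cring R" and M: "is_complex R M" and bb: "bounded_below_fp R F a"
      and q: "quasi_iso R F M \<pi>"
    and P: "P_bound R M (ring_complex R) < \<infinity>"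
  shows "\<exists>b. \<forall>n\<ge>b. cocycles_extend R F (regular_module R) n"
proof (cases "carrier (regular_module R) = {\<zero>\<^bsub>regular_module R\<^esub>}")
  case True
  have "is_complex R F" using bb by (simp add: bounded_below_fp_def)
  then show ?thesis using cocycles_extend_zero_module[OF _ regular_module[OF R] True] by blast
next
  case False
  have "homology_inf (ring_complex R) = ereal (of_int 0)"
    unfolding ring_complex_concentrated
      by (rule homology_inf_concentrated[OF regular_module[OF R] False])
  then show ?thesis
    using P_bound_finite[OF P] unfolding Ext_ring_zero_iff[OF R M bb q] by blast
qed

text \<open>
  If \<open>M\<close> is acyclic, its resolution can be cut off below the lowest degree.  Otherwise the syzygy
  \<open>Z\<^sub>m\<close> is an admissible test module for the Auslander bound, which forces the differential onto \<open>Z\<^sub>m\<close>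
  to be a coboundary.
\<close>

lemma has_fp_resolution_exists:
  fixes R :: "('a, 'r) ring_scheme" and M :: "('a, 'm) cpx"
  assumes R: "cring R" and noeth: "noetherian_ring R" and Dbf: "in_Dbf R M"
    and B: "auslander_bound R M < \<infinity>" and PR: "P_bound R M (ring_complex R) < \<infinity>"
        and PM: "P_bound R M M < \<infinity>"
  shows "\<exists>p. has_fp_resolution R M p"
proof -
  have M: "is_complex R M" and fgM: "\<And>i. fin_gen_module R (homology M i)" using Dbf
    by (auto simp: in_Dbf_def)
  note aM = is_complex_additive[OF M]
  obtain a b where ab: "\<And>i. i < a \<or> b < i \<Longrightarrow> cycles M i \<subseteq> boundaries M i"
    using in_Dbf_bounded[OF Dbf] by blast
  have low: "cycles M i \<subseteq> boundaries M i" if "i \<le> a - 1" for i using ab that by simp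
  obtain F :: "('a, ('a, 'm) univ) cpx" and \<pi> where bb: "bounded_below_fp R F a"
    and q: "quasi_iso R F M \<pi>"
    using free_resolution_exists[OF R noeth M fgM, where a="a - 1", OF low]
      unfolding diff_add_cancel by blast
  have F: "is_complex R F" and fp: "\<And>i. finite_projective R (obj F i)"
    and zF: "\<And>i. i < a \<Longrightarrow> zero_module (obj F i)" using bb by (auto simp: bounded_below_fp_def)
  note FM = is_complexD(1)[OF F] and aF = is_complex_additive[OF F]
  have trunc: "has_fp_resolution R M m"
    if "\<And>i. i > m \<Longrightarrow> cycles F i \<subseteq> boundaries F i" "G \<in> module_hom R (obj F m) (obj F m)"
      "\<And>x. x \<in> carrier (obj F m) \<Longrightarrow> G x \<in> boundaries F m" "\<And>b. b \<in> boundaries F m \<Longrightarrow> G b = b" for m G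
    using truncate_resolution[OF M bb q that] unfolding has_fp_resolution_def by blast
  show ?thesis
  proof (cases "\<forall>i. cycles M i \<subseteq> boundaries M i")
    case True
    then have "cycles F i \<subseteq> boundaries F i" for i using quasi_iso_acyclic_iff[OF F M q] by blast
    moreover have "x \<in> boundaries F (a - 1)" if "x \<in> carrier (obj F (a - 1))" for x
      using zero_moduleD[OF zF that] boundaries_zero[OF aF] by simp
    ultimately show ?thesis using trunc[of "a - 1" "\<lambda>x. x"] module_hom_id by blast
  next
    case False
    then obtain k where k: "\<not> zero_module (homology M k)" using zero_module_homology[OF aM] by blast
    have "a \<le> i" if "\<not> zero_module (homology M i)" for i
      using that ab[of i] zero_module_homology[OF aM, of i] by linarith
    from int_least[where P="\<lambda>i. \<not> zero_module (homology M i)", OF k this]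
    obtain h where h: "\<not> zero_module (homology M h)" "\<And>i. \<not> zero_module (homology M i) \<Longrightarrow> h \<le> i"
      by blast
    have "homology_inf M = ereal (of_int h)"
      unfolding homology_inf_def
        by (rule Inf_int_ereal[where P="\<lambda>i. \<not> zero_module (homology M i)", OF h])
    from P_bound_finite[OF PM this] obtain bM where bM: "\<And>n. n \<ge> bM \<Longrightarrow> homs_null R F (shift (- n) M)"
      unfolding Ext_zero_iff[OF M bb q M] by blast
    have bF: "homs_null R F (shift (- n) F)" if n: "n \<ge> bM" for n
      unfolding homs_null_def
    proof (intro allI impI)
      fix f assume f: "chain_map R F (shift (- n) F) f"
      have l: "lifts_along R F (shift (- n) F) (shift (- n) M) (\<lambda>i. \<pi> (i + - n))"
        by (rule lifts_bounded_below[OF bb is_complex_shift[OF F] is_complex_shift[OF M]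
          quasi_iso_shift[OF F M q]])
      have "chain_map R F (shift (- n) M) (\<lambda>i x. \<pi> (i + - n) (f i x))"
        by (rule chain_map_comp[OF f chain_map_shift[OF F M quasi_isoD(1)[OF F M q]]])
      then have "null_homotopic R F (shift (- n) M) (\<lambda>i x. \<pi> (i + - n) (f i x))"
        using bM[OF n] unfolding homs_null_def by blast
      with f l show "null_homotopic R F (shift (- n) F) f" unfolding lifts_along_def by blast
    qed
    obtain bR where bR: "\<And>n. n \<ge> bR \<Longrightarrow> cocycles_extend R F (regular_module R) n"
      using Ext_ring_eventually_zero[OF R M bb q PR] by blast
    obtain \<beta> :: nat where \<beta>: "auslander_bound R M < ereal (real \<beta>)"
      using less_PInf_Ex_of_nat[THEN iffD1, OF less_imp_neq[OF B]] by blast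
    \<comment> \<open>\<open>m\<close> lies above the homology of \<open>M\<close>, and \<open>m + 1\<close> exceeds the Auslander bound\<close>
    define m where "m = max (int \<beta>) (max (b + 1) a)"
    have acyc: "cycles F i \<subseteq> boundaries F i" if "i \<ge> m" for i
      using quasi_iso_acyclic_iff[OF F M q, of i] ab[of i] that by (simp add: m_def)
    let ?N = "(obj F m)\<lparr>carrier := cycles F m\<rparr>"
    have N: "module R ?N" by (rule submodule_module[OF FM submodule_cycles[OF F]])
    have d_into: "diff F (m + 1) \<in> module_hom R (obj F (m + 1)) ?N"
    proof (rule module_homI)
      fix x assume x: "x \<in> carrier (obj F (m + 1))"
      then have "diff F (m + 1) x \<in> boundaries F m" by (simp add: boundaries_def)
      then show "diff F (m + 1) x \<in> carrier ?N" using boundaries_subset_cycles[OF aF, of m] by auto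
    qed (simp_all add: hom_add[OF diff_hom[OF F]] hom_smult[OF diff_hom[OF F]])
    have into_F: "f \<in> module_hom R L (obj F m)" if "f \<in> module_hom R L ?N" for f
      and L :: "('a, 'l) module"
      using that cycles_carrier[OF aF] by (auto simp: module_hom_def Pi_def)
    have "cocycles_extend R F ?N (m + 1)"
    proof (cases "carrier ?N = {\<zero>\<^bsub>?N\<^esub>}")
      case True
      show ?thesis by (rule cocycles_extend_zero_module[OF F N True])
    next
      case False
      have large: "cocycles_extend R F ?N n" if n: "n \<ge> max (bM + m + 1) (bR + m + 1 - a)" for n
        unfolding cocycles_extend_def
      proof (intro ballI impI)
        fix f assume f: "f \<in> module_hom R (obj F n) ?N"
          and fd: "\<forall>x\<in>carrier (obj F (n + 1)). f (diff F (n + 1) x) = \<zero>\<^bsub>?N\<^esub>"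
        \<comment> \<open>the shift of \<open>F\<close> by \<open>s\<close> has \<open>F\<^sub>m\<close> in degree \<open>n - 1\<close>\<close>
        define s where "s = n - m - 1"
        let ?X = "shift (- s) F"
        have X: "is_complex R ?X" by (rule is_complex_shift[OF F])
        have e: "n - 1 + - s = m" "n - 2 + - s = m - 1" by (simp_all add: s_def)
        have "\<exists>g\<in>module_hom R (obj F (n - 1)) (obj ?X (n - 1)).
           (\<forall>y\<in>carrier (obj F (n - 1)). g y \<in> boundaries ?X (n - 1)) \<and>
           (\<forall>x\<in>carrier (obj F n). f x = g (diff F n x))"
        proof (rule syzygy_cocycle_extends[OF F fp X])
          show "finite_projective R (obj ?X j)" for j using fp by simp
          show "zero_module (obj ?X j)" if "j < a + s" for j using zF that by simp
          show "cocycles_extend R F (regular_module R) j" if "j > a + s" for j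
            using bR that n by (simp add: s_def)
          show "cycles ?X j \<subseteq> boundaries ?X j" if "j \<ge> n - 1" for j
            using acyc[of "j + - s"] that
              by (simp add: cycles_shift[OF F] boundaries_shift[OF F] s_def)
          show "homs_null R F ?X" using bF[of s] n by (simp add: s_def)
          show "f \<in> module_hom R (obj F n) (obj ?X (n - 1))" using into_F[OF f]
            unfolding obj_shift e .
          show "f (diff F (n + 1) x) = \<zero>\<^bsub>obj ?X (n - 1)\<^esub>" if "x \<in> carrier (obj F (n + 1))" for x
            using fd that unfolding obj_shift e by simp
          show "diff ?X (n - 1) (f x) = \<zero>\<^bsub>obj ?X (n - 2)\<^esub>" if "x \<in> carrier (obj F n)" for x
          proof -
            have "f x \<in> cycles ?X (n - 1)"
              using hom_closed[OF f that] unfolding cycles_shift[OF F] e by simp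
            then show ?thesis by (simp add: cycles_def)
          qed
        qed
        then obtain g where g: "g \<in> module_hom R (obj F (n - 1)) (obj F m)"
          "\<And>y. y \<in> carrier (obj F (n - 1)) \<Longrightarrow> g y \<in> boundaries F m"
          "\<And>x. x \<in> carrier (obj F n) \<Longrightarrow> f x = g (diff F n x)"
          unfolding obj_shift boundaries_shift[OF F] e by blast
        have "g \<in> module_hom R (obj F (n - 1)) ?N"
          using g(1,2) boundaries_subset_cycles[OF aF, of m] by (auto simp: module_hom_def Pi_def)
        with g(3) show "\<exists>g\<in>module_hom R (obj F (n - 1)) ?N. \<forall>x\<in>carrier (obj F n). f x =
            g (diff F n x)"
          by blast
      qed
      have E: "zero_module (Ext R n M (concentrated ?N)) \<longleftrightarrow> cocycles_extend R F ?N n" for n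
        unfolding Ext_zero_iff[OF M bb q concentrated_complex[OF N]] homs_null_concentrated[OF N F]
          ..
      note h0 = homology_inf_concentrated[OF N False]
      let ?b = "max (bM + m + 1) (bR + m + 1 - a)"
      have "P_bound R M (concentrated ?N) \<le> ereal (of_int ?b)"
        unfolding P_bound_def
      proof (rule Sup_least, clarify)
        fix n h assume "homology_inf (concentrated ?N) = ereal (of_int h)"
          "\<not> zero_module (Ext R (n - h) M (concentrated ?N))"
        then have "\<not> cocycles_extend R F ?N n" unfolding E h0 by simp
        then have "n \<le> ?b" using large[of n] by linarith
        then show "ereal (of_int n) \<le> ereal (of_int ?b)" by simp
      qed
      then have fin: "P_bound R M (concentrated ?N) < \<infinity>" by (rule le_less_trans) simp
      obtain A where A: "A \<subseteq> cycles F m" "finite A" "cycles F m \<subseteq> linear_span R (obj F m) A"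
        using finite_projective_noetherian[OF R noeth fp submodule_cycles[OF F]] by blast
      have "linear_span R (obj F m) A \<subseteq> linear_span R ?N A"
      proof
        fix x assume "x \<in> linear_span R (obj F m) A"
        then show "x \<in> linear_span R ?N A"
        proof induction
          case zero then show ?case using linear_span.zero[of ?N R A] by simp
        next
          case (step r a x) then show ?case using linear_span.step[of r R a A x ?N] by simp
        qed
      qed
      then have "in_Dbf R (concentrated ?N)" using A by (intro concentrated_in_Dbf[OF N]) auto
      then have "P_bound R M (concentrated ?N) \<le> auslander_bound R M"
        unfolding auslander_bound_def using fin by (auto intro!: Sup_upper)
      then have less: "P_bound R M (concentrated ?N) < ereal (real \<beta>)" using \<beta>
        by (rule le_less_trans)
      show ?thesis
      proof (rule ccontr)
        assume "\<not> cocycles_extend R F ?N (m + 1)"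
        then have "\<not> zero_module (Ext R (m + 1 - 0) M (concentrated ?N))" unfolding E by simp
        then have "ereal (of_int (m + 1)) \<le> P_bound R M (concentrated ?N)"
          unfolding P_bound_def using h0
          by (intro Sup_upper CollectI exI[of _ "m + 1"] exI[of _ "0 :: int"] conjI refl)
        then have "ereal (of_int (m + 1)) < ereal (real \<beta>)" using less by (rule le_less_trans)
        then show False by (simp add: m_def)
      qed
    qed
    then have "\<exists>g\<in>module_hom R (obj F (m + 1 - 1)) ?N.
        \<forall>x\<in>carrier (obj F (m + 1)). diff F (m + 1) x = g (diff F (m + 1) x)"
    proof (rule cocycles_extendD[OF _ d_into])
      show "diff F (m + 1) (diff F (m + 1 + 1) x) = \<zero>\<^bsub>?N\<^esub>" if "x \<in> carrier (obj F (m + 1 + 1))" for x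
        using diff_diff(1)[OF F that] by simp
    qed
    then obtain g where
      g: "g \<in> module_hom R (obj F m) ?N"
        "\<And>x. x \<in> carrier (obj F (m + 1)) \<Longrightarrow> diff F (m + 1) x = g (diff F (m + 1) x)"
      by auto
    have "has_fp_resolution R M m"
    proof (rule trunc)
      show "g \<in> module_hom R (obj F m) (obj F m)" by (rule into_F[OF g(1)])
      show "g x \<in> boundaries F m" if "x \<in> carrier (obj F m)" for x
        using hom_closed[OF g(1) that] acyc[of m] by auto
      show "g b = b" if "b \<in> boundaries F m" for b
        using that g(2) by (auto simp: boundaries_def)
    qed (use acyc in simp)
    then show ?thesis by blast
  qed
qed

theorem theorem5p2:
  fixes R :: "('a, 'r) ring_scheme" and M :: "('a, 'm) cpx"
  assumes "cring R" and "noetherian_ring R"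
    and "in_Dbf R M"
    and "auslander_bound R M < \<infinity>"
    and "P_bound R M (ring_complex R) < \<infinity>"
    and "P_bound R M M < \<infinity>"
  shows "proj_dim R M < \<infinity> \<and>
         proj_dim R M = - homology_inf (RHom R M (ring_complex R))"
proof -
  have M: "is_complex R M" using assms(3) by (simp add: in_Dbf_def)
  let ?E = "\<lambda>n. \<not> zero_module (Ext R n M (ring_complex R))"
  let ?pd = "\<lambda>p. \<exists>(P :: ('a, ('a, 'm) univ) cpx) \<pi>. semiprojective_resolution R M P \<pi> \<and>
      (\<forall>i>p. zero_module (obj P i))"
  obtain p0 where p0: "has_fp_resolution R M p0" using has_fp_resolution_exists[OF assms] by blast
  then obtain F :: "('a, ('a, 'm) univ) cpx" and \<pi> a where bb: "bounded_below_fp R F a"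
    and q: "quasi_iso R F M \<pi>"
    unfolding has_fp_resolution_def by blast
  have pd: "?pd p" if "has_fp_resolution R M p" for p
    using that bounded_below_semiprojective_resolution unfolding has_fp_resolution_def by blast
  have up: "n \<le> p" if "?pd p" "?E n" for n p
    using that Ext_ring_zero_above[OF assms(1) M bb q] by (meson not_le)
  have down: "has_fp_resolution R M (p0 - int k)" if "\<And>n. n > p0 - int k \<Longrightarrow> \<not> ?E n" for k
    using that
  proof (induction k)
    case (Suc k)
    then show ?case using shorten_resolution[OF assms(1) M, of "p0 - int k"]
      by (simp add: algebra_simps)
  qed (use p0 in simp)
  have hinf: "homology_inf (RHom R M (ring_complex R)) = Inf {ereal (of_int i) | i. ?E (- i)}"
    by (simp add: homology_inf_def Ext_def)
  have "proj_dim R M \<le> ereal (of_int p0)"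
    unfolding proj_dim_def using pd[OF p0] by (intro Inf_lower) blast
  then have fin: "proj_dim R M < \<infinity>" by (rule le_less_trans) simp
  have "proj_dim R M = - homology_inf (RHom R M (ring_complex R))"
  proof (cases "\<exists>n. ?E n")
    case True
    then obtain n0 where "?E n0" by blast
    then have n0: "?E (- (- n0))" by simp
    have "- p0 \<le> i" if "?E (- i)" for i using up[OF pd[OF p0] that] by simp
    from int_least[where P="\<lambda>i. ?E (- i)", OF n0 this]
    obtain i0 where i0: "?E (- i0)" "\<And>i. ?E (- i) \<Longrightarrow> i0 \<le> i" by blast
    have "homology_inf (RHom R M (ring_complex R)) = ereal (of_int i0)"
      unfolding hinf by (rule Inf_int_ereal[where P="\<lambda>i. ?E (- i)", OF i0])
    moreover have "proj_dim R M = ereal (of_int (- i0))"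
      unfolding proj_dim_def
    proof (rule Inf_int_ereal[where P="?pd"])
      have "- i0 \<le> p0" by (rule up[OF pd[OF p0] i0(1)])
      then have "p0 - int (nat (p0 + i0)) = - i0" by simp
      moreover have "\<not> ?E n" if "n > - i0" for n using i0(2)[of "- n"] that by auto
      ultimately show "?pd (- i0)" using pd[OF down[of "nat (p0 + i0)"]] by simp
      show "- i0 \<le> p" if "?pd p" for p by (rule up[OF that i0(1)])
    qed
    ultimately show ?thesis by simp
  next
    case False
    have "homology_inf (RHom R M (ring_complex R)) = \<infinity>"
      unfolding hinf using False by (simp add: top_ereal_def)
    moreover have "proj_dim R M = - \<infinity>"
    proof (rule ccontr)
      assume "proj_dim R M \<noteq> - \<infinity>"
      then obtain r where r: "proj_dim R M = ereal r" using fin by (cases "proj_dim R M") auto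
      obtain k :: nat where k: "real k > real_of_int p0 - r" using reals_Archimedean2 by blast
      have "?pd (p0 - int k)" using pd[OF down[of k]] False by blast
      then have "proj_dim R M \<le> ereal (of_int (p0 - int k))" unfolding proj_dim_def
        by (intro Inf_lower) blast
      then show False using r k by simp
    qed
    ultimately show ?thesis by simp
  qed
  with fin show ?thesis by blast
qed

end
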